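(* Let $M$ be a connected Riemannian manifold on which the connected Lie group $G$ acts effectively and isometrically, and let $\mathfrak{g}=\mathrm{Lie}(G)$. Assume that $X\in\mathfrak{g}$ defines a bounded Killing vector field on $M$. Then all (complex) eigenvalues of $\mathrm{ad}(X):\mathfrak{g}\rightarrow\mathfrak{g}$ are imaginary, i.e. lie in $\mathbb{R}\sqrt{-1}$.
   Context: The Lie algebra $\mathfrak{g}$ is real and finite-dimensional; the eigenvalue $0$ is counted as imaginary. The vector $X\in\mathfrak{g}$ defines the Killing vector field $x\mapsto \frac{d}{dt}\big|_{t=0}\exp(tX)\cdot x$ on $M$; it is bounded if its length function with respect to the Riemannian metric is bounded on $M$. *)

theory Defs
  imports "HOL-Analysis.Analysis" "HOL-Algebra.Group_Action" "HOL-Library.Function_Algebras"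
begin

section \<open>Model spaces\<close>

text \<open>
  Finite-dimensional real inner product spaces. This is \<open>euclidean_space\<close> without the requirement
  that the orthonormal basis is nonempty, so that zero-dimensional manifolds and Lie groups are
  not excluded.
\<close>

class findim_inner = real_inner +
  assumes findim: "\<exists>B. finite B \<and>
    (\<forall>u\<in>B. \<forall>v\<in>B. inner u v = (if u = v then 1 else 0)) \<and>
    (\<forall>x. (\<forall>u\<in>B. inner x u = 0) \<longleftrightarrow> x = 0)"

instance euclidean_space \<subseteq> findim_inner
  by standard (rule exI[of _ Basis], auto simp: inner_Basis euclidean_all_zero_iff)

instance prod :: (findim_inner, findim_inner) findim_inner
proof
  obtain A :: "'a set" where A: "finite A"
      "\<forall>u\<in>A. \<forall>v\<in>A. inner u v = (if u = v then 1 else 0)"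
      "\<forall>x. (\<forall>u\<in>A. inner x u = 0) \<longleftrightarrow> x = 0"
    using findim[where 'a='a] by (elim exE conjE)
  obtain B :: "'b set" where B: "finite B"
      "\<forall>u\<in>B. \<forall>v\<in>B. inner u v = (if u = v then 1 else 0)"
      "\<forall>x. (\<forall>u\<in>B. inner x u = 0) \<longleftrightarrow> x = 0"
    using findim[where 'a='b] by (elim exE conjE)
  let ?C = "((\<lambda>a. (a, 0::'b)) ` A) \<union> ((\<lambda>b. (0::'a, b)) ` B)"
  have "0 \<notin> A" using bspec[OF bspec[OF A(2)], of 0 0] by auto
  moreover have "0 \<notin> B" using bspec[OF bspec[OF B(2)], of 0 0] by auto
  ultimately have "inner u v = (if u = v then 1 else 0)" if "u \<in> ?C" "v \<in> ?C" for u v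
    using that bspec[OF bspec[OF A(2)], of "fst u" "fst v"]
      bspec[OF bspec[OF B(2)], of "snd u" "snd v"]
    by (elim UnE imageE) (simp_all add: inner_prod_def, auto)
  moreover have "(\<forall>u\<in>?C. inner x u = 0) \<longleftrightarrow> x = 0" for x :: "'a \<times> 'b"
  proof -
    have "(\<forall>u\<in>?C. inner x u = 0) \<longleftrightarrow> (\<forall>u\<in>A. inner (fst x) u = 0) \<and> (\<forall>u\<in>B. inner (snd x) u = 0)"
      by (simp add: ball_Un inner_prod_def)
    also have "\<dots> \<longleftrightarrow> x = 0"
      by (simp only: A(3) B(3) prod_eq_iff fst_zero snd_zero)
    finally show ?thesis .
  qed
  moreover have "finite ?C" using A(1) B(1) by simp
  ultimately show "\<exists>C::('a \<times> 'b) set. finite C \<and>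
      (\<forall>u\<in>C. \<forall>v\<in>C. inner u v = (if u = v then 1 else 0)) \<and>
      (\<forall>x. (\<forall>u\<in>C. inner x u = 0) \<longleftrightarrow> x = 0)"
    by (intro exI[of _ ?C] conjI ballI allI)
qed

section \<open>Smooth functions on open sets\<close>

text \<open>Meaningful for open \<open>S\<close> and a finite-dimensional domain.\<close>

primrec Ck_on :: "nat \<Rightarrow> 'a::real_normed_vector set \<Rightarrow> ('a \<Rightarrow> 'b::real_normed_vector) \<Rightarrow> bool" where
  "Ck_on 0 = (\<lambda>S f. continuous_on S f)"
| "Ck_on (Suc k) = (\<lambda>S f. (\<forall>x\<in>S. f differentiable (at x)) \<and>
      (\<forall>v. Ck_on k S (\<lambda>x. frechet_derivative f (at x) v)))"

definition smooth_on :: "'a::real_normed_vector set \<Rightarrow> ('a \<Rightarrow> 'b::real_normed_vector) \<Rightarrow> bool" where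
  "smooth_on S f \<longleftrightarrow> (\<forall>k. Ck_on k S f)"

section \<open>Smooth manifolds\<close>

text \<open>
  A chart is a pair consisting of its domain and its coordinate map; the values of the coordinate
  map outside the domain are irrelevant. Atlases need not be maximal.
\<close>

type_synonym ('m, 'e) chart = "'m set \<times> ('m \<Rightarrow> 'e)"

abbreviation dom_of :: "('m, 'e) chart \<Rightarrow> 'm set" where "dom_of c \<equiv> fst c"
abbreviation coord :: "('m, 'e) chart \<Rightarrow> 'm \<Rightarrow> 'e" where "coord c \<equiv> snd c"
abbreviation img_of :: "('m, 'e) chart \<Rightarrow> 'e set" where "img_of c \<equiv> snd c ` fst c"

definition coord_inv :: "('m, 'e) chart \<Rightarrow> 'e \<Rightarrow> 'm" where
  "coord_inv c = inv_into (dom_of c) (coord c)"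

record ('m, 'e) manifold =
  mtop :: "'m topology"
  atlas :: "('m, 'e) chart set"

abbreviation points :: "('m, 'e) manifold \<Rightarrow> 'm set" where
  "points M \<equiv> topspace (mtop M)"

definition is_chart :: "'m topology \<Rightarrow> ('m, 'e::findim_inner) chart \<Rightarrow> bool" where
  "is_chart X c \<longleftrightarrow> openin X (dom_of c) \<and> open (img_of c) \<and>
     homeomorphic_map (subtopology X (dom_of c)) (top_of_set (img_of c)) (coord c)"

definition smooth_manifold :: "('m, 'e::findim_inner) manifold \<Rightarrow> bool" where
  "smooth_manifold M \<longleftrightarrow>
     Hausdorff_space (mtop M) \<and> second_countable (mtop M) \<and>
     (\<forall>c\<in>atlas M. is_chart (mtop M) c) \<and>
     (\<Union>c\<in>atlas M. dom_of c) = points M \<and>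
     (\<forall>c\<in>atlas M. \<forall>d\<in>atlas M.
        smooth_on (coord c ` (dom_of c \<inter> dom_of d)) (coord d \<circ> coord_inv c))"

definition real_line :: "(real, real) manifold" where
  "real_line = \<lparr>mtop = euclidean, atlas = {(UNIV, \<lambda>t. t)}\<rparr>"

definition prod_manifold ::
    "('m, 'e) manifold \<Rightarrow> ('n, 'f) manifold \<Rightarrow> ('m \<times> 'n, 'e \<times> 'f) manifold" where
  "prod_manifold M N =
     \<lparr>mtop = prod_topology (mtop M) (mtop N),
      atlas = {(dom_of c \<times> dom_of d, map_prod (coord c) (coord d)) | c d.
                 c \<in> atlas M \<and> d \<in> atlas N}\<rparr>"

definition smooth_map ::
    "('m, 'e::findim_inner) manifold \<Rightarrow> ('n, 'f::findim_inner) manifold \<Rightarrow> ('m \<Rightarrow> 'n) \<Rightarrow> bool" where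
  "smooth_map M N f \<longleftrightarrow> continuous_map (mtop M) (mtop N) f \<and>
     (\<forall>c\<in>atlas M. \<forall>d\<in>atlas N.
        smooth_on (coord c ` {x \<in> dom_of c. f x \<in> dom_of d}) (coord d \<circ> f \<circ> coord_inv c))"

section \<open>Tangent vectors\<close>

instantiation "fun" :: (type, real_vector) real_vector
begin

definition "r *\<^sub>R f = (\<lambda>x. r *\<^sub>R f x)"

instance
  by standard (auto simp: scaleR_fun_def fun_eq_iff scaleR_add_right scaleR_add_left)

end

text \<open>
  A tangent vector at \<open>p\<close> is the family of its coordinate vectors with respect to the charts
  around \<open>p\<close>, related by the derivatives of the coordinate changes. The family is set to \<open>0\<close> on all
  other charts, so that addition and scaling of tangent vectors are the pointwise operations.
\<close>

type_synonym ('m, 'e) tvec = "('m, 'e) chart \<Rightarrow> 'e"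

definition charts_at :: "('m, 'e) manifold \<Rightarrow> 'm \<Rightarrow> ('m, 'e) chart set" where
  "charts_at M p = {c \<in> atlas M. p \<in> dom_of c}"

definition tangent_space :: "('m, 'e::findim_inner) manifold \<Rightarrow> 'm \<Rightarrow> ('m, 'e) tvec set" where
  "tangent_space M p =
     {v. (\<forall>c. c \<notin> charts_at M p \<longrightarrow> v c = 0) \<and>
         (\<forall>c\<in>charts_at M p. \<forall>d\<in>charts_at M p.
            v d = frechet_derivative (coord d \<circ> coord_inv c) (at (coord c p)) (v c))}"

text \<open>The tangent vector at \<open>p\<close> whose coordinate vector in the chart \<open>c\<close> around \<open>p\<close> is \<open>u\<close>.\<close>

definition coord_tvec ::
    "('m, 'e::findim_inner) manifold \<Rightarrow> 'm \<Rightarrow> ('m, 'e) chart \<Rightarrow> 'e \<Rightarrow> ('m, 'e) tvec" where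
  "coord_tvec M p c u =
     (\<lambda>d. if d \<in> charts_at M p
          then frechet_derivative (coord d \<circ> coord_inv c) (at (coord c p)) u else 0)"

text \<open>For smooth \<open>f\<close> and \<open>v\<close> tangent at \<open>p\<close>, the chart chosen around \<open>p\<close> does not matter.\<close>

definition differential ::
    "('m, 'e::findim_inner) manifold \<Rightarrow> ('n, 'f::findim_inner) manifold \<Rightarrow>
     ('m \<Rightarrow> 'n) \<Rightarrow> 'm \<Rightarrow> ('m, 'e) tvec \<Rightarrow> ('n, 'f) tvec" where
  "differential M N f p v =
     (let c = (SOME c. c \<in> charts_at M p) in
      (\<lambda>d. if d \<in> charts_at N (f p)
           then frechet_derivative (coord d \<circ> f \<circ> coord_inv c) (at (coord c p)) (v c) else 0))"

definition velocity ::
    "('m, 'e::findim_inner) manifold \<Rightarrow> (real \<Rightarrow> 'm) \<Rightarrow> real \<Rightarrow> ('m, 'e) tvec" where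
  "velocity M \<gamma> t =
     (\<lambda>c. if c \<in> charts_at M (\<gamma> t) then vector_derivative (coord c \<circ> \<gamma>) (at t) else 0)"

text \<open>In each chart, \<open>[V, W] = DW(V) - DV(W)\<close>.\<close>

definition vf_bracket ::
    "('m, 'e::findim_inner) manifold \<Rightarrow> ('m \<Rightarrow> ('m, 'e) tvec) \<Rightarrow> ('m \<Rightarrow> ('m, 'e) tvec) \<Rightarrow>
     'm \<Rightarrow> ('m, 'e) tvec" where
  "vf_bracket M V W p =
     (\<lambda>c. if c \<in> charts_at M p
          then frechet_derivative (\<lambda>x. W (coord_inv c x) c) (at (coord c p)) (V p c)
             - frechet_derivative (\<lambda>x. V (coord_inv c x) c) (at (coord c p)) (W p c)
          else 0)"

section \<open>Riemannian metrics\<close>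

definition riemannian_metric ::
    "('m, 'e::findim_inner) manifold \<Rightarrow> ('m \<Rightarrow> ('m, 'e) tvec \<Rightarrow> ('m, 'e) tvec \<Rightarrow> real) \<Rightarrow> bool" where
  "riemannian_metric M h \<longleftrightarrow>
     (\<forall>p\<in>points M.
        (\<forall>u\<in>tangent_space M p. \<forall>v\<in>tangent_space M p. \<forall>w\<in>tangent_space M p. \<forall>r.
           h p (u + v) w = h p u w + h p v w \<and>
           h p (r *\<^sub>R u) w = r * h p u w \<and>
           h p u w = h p w u) \<and>
        (\<forall>u\<in>tangent_space M p. u \<noteq> 0 \<longrightarrow> h p u u > 0)) \<and>
     (\<forall>c\<in>atlas M. \<forall>u w.
        smooth_on (img_of c)
          (\<lambda>x. let p = coord_inv c x in h p (coord_tvec M p c u) (coord_tvec M p c w)))"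

definition riemannian_manifold ::
    "('m, 'e::findim_inner) manifold \<Rightarrow> ('m \<Rightarrow> ('m, 'e) tvec \<Rightarrow> ('m, 'e) tvec \<Rightarrow> real) \<Rightarrow> bool" where
  "riemannian_manifold M h \<longleftrightarrow> smooth_manifold M \<and> riemannian_metric M h"

definition tvec_length ::
    "('m \<Rightarrow> ('m, 'e) tvec \<Rightarrow> ('m, 'e) tvec \<Rightarrow> real) \<Rightarrow> 'm \<Rightarrow> ('m, 'e) tvec \<Rightarrow> real" where
  "tvec_length h p v = sqrt (h p v v)"

section \<open>Lie groups\<close>

definition lie_group :: "('g, 'z) monoid_scheme \<Rightarrow> ('g, 'e::findim_inner) manifold \<Rightarrow> bool" where
  "lie_group G L \<longleftrightarrow> group G \<and> smooth_manifold L \<and> points L = carrier G \<and>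
     smooth_map (prod_manifold L L) L (\<lambda>(x, y). x \<otimes>\<^bsub>G\<^esub> y) \<and>
     smooth_map L L (\<lambda>x. inv\<^bsub>G\<^esub> x)"

definition lie_algebra ::
    "('g, 'z) monoid_scheme \<Rightarrow> ('g, 'e::findim_inner) manifold \<Rightarrow> ('g, 'e) tvec set" where
  "lie_algebra G L = tangent_space L \<one>\<^bsub>G\<^esub>"

definition left_invariant_vf ::
    "('g, 'z) monoid_scheme \<Rightarrow> ('g, 'e::findim_inner) manifold \<Rightarrow>
     ('g, 'e) tvec \<Rightarrow> 'g \<Rightarrow> ('g, 'e) tvec" where
  "left_invariant_vf G L X g = differential L L (\<lambda>x. g \<otimes>\<^bsub>G\<^esub> x) \<one>\<^bsub>G\<^esub> X"

definition ad ::
    "('g, 'z) monoid_scheme \<Rightarrow> ('g, 'e::findim_inner) manifold \<Rightarrow>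
     ('g, 'e) tvec \<Rightarrow> ('g, 'e) tvec \<Rightarrow> ('g, 'e) tvec" where
  "ad G L X Y = vf_bracket L (left_invariant_vf G L X) (left_invariant_vf G L Y) \<one>\<^bsub>G\<^esub>"

definition one_parameter_subgroup ::
    "('g, 'z) monoid_scheme \<Rightarrow> ('g, 'e::findim_inner) manifold \<Rightarrow> (real \<Rightarrow> 'g) \<Rightarrow> bool" where
  "one_parameter_subgroup G L \<gamma> \<longleftrightarrow>
     smooth_map real_line L \<gamma> \<and> (\<forall>s t. \<gamma> (s + t) = \<gamma> s \<otimes>\<^bsub>G\<^esub> \<gamma> t)"

definition lie_exp ::
    "('g, 'z) monoid_scheme \<Rightarrow> ('g, 'e::findim_inner) manifold \<Rightarrow> ('g, 'e) tvec \<Rightarrow> 'g" where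
  "lie_exp G L X = (THE \<gamma>. one_parameter_subgroup G L \<gamma> \<and> velocity L \<gamma> 0 = X) 1"

section \<open>Isometric actions and Killing vector fields\<close>

definition smooth_action ::
    "('g, 'z) monoid_scheme \<Rightarrow> ('g, 'f::findim_inner) manifold \<Rightarrow> ('m, 'e::findim_inner) manifold \<Rightarrow>
     ('g \<Rightarrow> 'm \<Rightarrow> 'm) \<Rightarrow> bool" where
  "smooth_action G L M \<phi> \<longleftrightarrow> group_action G (points M) \<phi> \<and>
     smooth_map (prod_manifold L M) M (\<lambda>(g, x). \<phi> g x)"

definition isometric_action ::
    "('g, 'z) monoid_scheme \<Rightarrow> ('m, 'e::findim_inner) manifold \<Rightarrow>
     ('m \<Rightarrow> ('m, 'e) tvec \<Rightarrow> ('m, 'e) tvec \<Rightarrow> real) \<Rightarrow> ('g \<Rightarrow> 'm \<Rightarrow> 'm) \<Rightarrow> bool" where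
  "isometric_action G M h \<phi> \<longleftrightarrow>
     (\<forall>g\<in>carrier G. \<forall>p\<in>points M. \<forall>u\<in>tangent_space M p. \<forall>v\<in>tangent_space M p.
        h (\<phi> g p) (differential M M (\<phi> g) p u) (differential M M (\<phi> g) p v) = h p u v)"

definition killing_field ::
    "('g, 'z) monoid_scheme \<Rightarrow> ('g, 'f::findim_inner) manifold \<Rightarrow> ('m, 'e::findim_inner) manifold \<Rightarrow>
     ('g \<Rightarrow> 'm \<Rightarrow> 'm) \<Rightarrow> ('g, 'f) tvec \<Rightarrow> 'm \<Rightarrow> ('m, 'e) tvec" where
  "killing_field G L M \<phi> X x = velocity M (\<lambda>t. \<phi> (lie_exp G L (t *\<^sub>R X)) x) 0"

definition bounded_vf ::
    "('m, 'e::findim_inner) manifold \<Rightarrow> ('m \<Rightarrow> ('m, 'e) tvec \<Rightarrow> ('m, 'e) tvec \<Rightarrow> real) \<Rightarrow>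
     ('m \<Rightarrow> ('m, 'e) tvec) \<Rightarrow> bool" where
  "bounded_vf M h V \<longleftrightarrow> bounded ((\<lambda>x. tvec_length h x (V x)) ` points M)"

section \<open>Complex eigenvalues of a real endomorphism\<close>

text \<open>
  Elements \<open>u + \<i>v\<close> of the complexification of a real vector space are represented as pairs
  \<open>(u, v)\<close>; a real-linear map \<open>T\<close> is extended by \<open>T (u + \<i>v) = T u + \<i> T v\<close>.
\<close>

definition complex_scale :: "complex \<Rightarrow> 'v::real_vector \<times> 'v \<Rightarrow> 'v \<times> 'v" where
  "complex_scale z w =
     (Re z *\<^sub>R fst w - Im z *\<^sub>R snd w, Im z *\<^sub>R fst w + Re z *\<^sub>R snd w)"

definition complex_eigenvalue :: "'v::real_vector set \<Rightarrow> ('v \<Rightarrow> 'v) \<Rightarrow> complex \<Rightarrow> bool" where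
  "complex_eigenvalue S T z \<longleftrightarrow>
     (\<exists>w\<in>S \<times> S. w \<noteq> 0 \<and> map_prod T T w = complex_scale z w)"

end

theory Submission
  imports Defs
begin

text \<open>
  Write \<open>Y*\<close> for the Killing field of an element \<open>Y\<close> of the Lie algebra. Since \<open>G\<close> acts by
  isometries and \<open>g\<close> maps the field \<open>Y*\<close> to \<open>(Ad g Y)*\<close> (\<open>differential_fund\<close>), the elements with
  bounded Killing field form a subspace \<open>B\<close> of the Lie algebra which is invariant under \<open>Ad\<close>, and the
  supremum of the length of \<open>Y*\<close> is an \<open>Ad\<close>-invariant norm on \<open>B\<close>; it is definite because the
  action is effective (\<open>fund_eq_0_imp\<close>).

  Differentiating \<open>Ad\<close> at the identity gives \<open>ad\<close> (\<open>has_derivative_Ad\<close>), so the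
  \<open>Ad\<close>-invariant subspace \<open>B\<close> is an ideal. Let \<open>X\<close> be in \<open>B\<close> and let \<open>w\<close> be a complex eigenvector of
  \<open>ad X\<close> with eigenvalue \<open>z\<close>, \<open>Re z \<noteq> 0\<close>. As \<open>ad X\<close> maps the whole Lie algebra into \<open>B\<close>, \<open>w\<close> lies in
  the complexification of \<open>B\<close>. On the one hand \<open>Ad (exp t X) w = exp (t z) w\<close>; on the other hand
  \<open>Ad (exp t X)\<close> preserves the norm. Letting \<open>t\<close> tend to \<open>\<infinity>\<close> or \<open>-\<infinity>\<close>, according to the sign of \<open>Re z\<close>, forces \<open>w = 0\<close>
  (\<open>qform_eigenvector_eq_0\<close>).

  Most of the work lies in the foundations. The smooth functions of several variables need
  the chain rule and the symmetry of second derivatives; the latter is what turns the derivative of \<open>Ad\<close>,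
  which involves left and right translations, into a bracket of left-invariant fields. One-parameter subgroups
  with prescribed velocity come from Picard iteration, and their uniqueness gives
  a meaning to \<^const>\<open>lie_exp\<close>, hence to \<^const>\<open>killing_field\<close>. Vectors of the Lie algebra are represented
  by their coordinates in one fixed chart around the identity.
\<close>

section \<open>Finite-dimensional inner product spaces\<close>

definition onb :: "'a::findim_inner set" where
  "onb = (SOME B. finite B \<and> (\<forall>u\<in>B. \<forall>v\<in>B. inner u v = (if u = v then 1 else 0)) \<and>
    (\<forall>x. (\<forall>u\<in>B. inner x u = 0) \<longleftrightarrow> x = 0))"

lemma onb:
  shows finite_onb [simp]: "finite (onb :: 'a::findim_inner set)"
    and inner_onb: "u \<in> (onb :: 'a set) \<Longrightarrow> v \<in> onb \<Longrightarrow> inner u v = (if u = v then 1 else 0)"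
    and onb_eq_0_iff: "(\<forall>u\<in>onb. inner (x::'a) u = 0) \<longleftrightarrow> x = 0"
proof -
  have *: "finite (onb::'a set) \<and> (\<forall>u\<in>(onb::'a set). \<forall>v\<in>onb. inner u v = (if u = v then 1 else 0)) \<and>
    (\<forall>x::'a. (\<forall>u\<in>onb. inner x u = 0) \<longleftrightarrow> x = 0)"
    unfolding onb_def by (rule someI_ex[OF findim])
  from * show "finite (onb::'a set)" by (elim conjE)
  from * show "u \<in> (onb :: 'a set) \<Longrightarrow> v \<in> onb \<Longrightarrow> inner u v = (if u = v then 1 else 0)"
    by (elim conjE) blast
  from * show "(\<forall>u\<in>onb. inner (x::'a) u = 0) \<longleftrightarrow> x = 0" by (elim conjE) blast
qed

lemma onb_expansion: "(\<Sum>u\<in>onb. inner x u *\<^sub>R u) = (x :: 'a::findim_inner)"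
proof -
  have "inner (x - (\<Sum>u\<in>onb. inner x u *\<^sub>R u)) v = 0" if v: "v \<in> onb" for v
  proof -
    have "(\<Sum>u\<in>onb. inner x u * inner u v) = (\<Sum>u\<in>onb. if u = v then inner x u else 0)"
      using v by (intro sum.cong) (auto simp: inner_onb)
    then show ?thesis using v by (simp add: inner_diff_left inner_sum_left)
  qed
  then show ?thesis using onb_eq_0_iff[of "x - (\<Sum>u\<in>onb. inner x u *\<^sub>R u)"] by simp
qed

lemma linear_onb_expansion:
  fixes f :: "'a::findim_inner \<Rightarrow> 'b::real_vector"
  assumes "linear f"
  shows "f x = (\<Sum>u\<in>onb. inner x u *\<^sub>R f u)"
proof -
  have "f x = f (\<Sum>u\<in>onb. inner x u *\<^sub>R u)" by (simp add: onb_expansion)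
  also have "\<dots> = (\<Sum>u\<in>onb. inner x u *\<^sub>R f u)"
    by (simp add: linear_sum[OF assms] linear_scale[OF assms])
  finally show ?thesis .
qed

text \<open>The coordinates of a Cauchy sequence in the orthonormal basis converge. Completeness is what Picard
  iteration needs.\<close>

instance findim_inner \<subseteq> banach
proof
  fix X :: "nat \<Rightarrow> 'a" assume X: "Cauchy X"
  have "\<exists>l. (\<lambda>n. inner (X n) u) \<longlonglongrightarrow> l" for u
    using bounded_linear.Cauchy[OF bounded_linear_inner_left X, of u]
    by (simp add: Cauchy_convergent_iff convergent_def)
  then obtain l where l: "\<And>u. (\<lambda>n. inner (X n) u) \<longlonglongrightarrow> l u" by metis
  have "(\<lambda>n. \<Sum>u\<in>onb. inner (X n) u *\<^sub>R u) \<longlonglongrightarrow> (\<Sum>u\<in>onb. l u *\<^sub>R u)"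
    by (intro tendsto_sum tendsto_scaleR l tendsto_const)
  then show "convergent X" by (auto simp: onb_expansion convergent_def)
qed

lemma linear_imp_bounded_linear:
  fixes f :: "'a::findim_inner \<Rightarrow> 'b::real_normed_vector"
  assumes "linear f"
  shows "bounded_linear f"
proof -
  have "bounded_linear (\<lambda>x. \<Sum>u\<in>onb. inner x u *\<^sub>R f u)"
    by (intro bounded_linear_sum bounded_linear_compose[OF bounded_linear_scaleR_left]
        bounded_linear_inner_left)
  also have "(\<lambda>x. \<Sum>u\<in>onb. inner x u *\<^sub>R f u) = f"
    by (rule ext) (rule linear_onb_expansion[OF assms, symmetric])
  finally show ?thesis .
qed

text \<open>The map is the orthogonal projection onto the subspace.\<close>

lemma subspace_eq_fixed_points:
  fixes S :: "'a::findim_inner set"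
  assumes "subspace S"
  obtains P where "bounded_linear P" "S = {x. P x = x}"
proof -
  obtain B where B: "B \<subseteq> S" "independent B" "S \<subseteq> span B"
    using basis_exists[of S] by metis
  have "x \<in> span onb" for x :: 'a
    by (subst onb_expansion[symmetric]) (intro span_sum span_scale span_base)
  then have "finite B"
    using independent_span_bound[of onb B] B(2) finite_onb by blast
  then obtain C where C: "finite C" "span C = span B" "pairwise orthogonal C"
    using basis_orthogonal by blast
  have SC: "S = span C"
    using B C(2) assms by (simp add: span_minimal subset_antisym)
  define P where "P x = (\<Sum>c\<in>C. (inner x c / inner c c) *\<^sub>R c)" for x
  have "P x = x" if "x \<in> S" for x
  proof -
    have "inner (x - P x) c = 0" if c: "c \<in> C" for c
    proof -
      have "inner (P x) c = (\<Sum>d\<in>C. inner x d / inner d d * inner d c)"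
        by (simp add: P_def inner_sum_left)
      also have "\<dots> = (\<Sum>d\<in>C. if d = c then inner x c else 0)"
      proof (rule sum.cong)
        fix d assume "d \<in> C"
        then show "inner x d / inner d d * inner d c = (if d = c then inner x c else 0)"
          using C(3) c by (auto simp: pairwise_def orthogonal_def)
      qed simp
      also have "\<dots> = inner x c" using c C(1) by simp
      finally show ?thesis by (simp add: inner_diff_left)
    qed
    then have "C \<subseteq> {y. inner (x - P x) y = 0}" by blast
    moreover have "subspace {y. inner (x - P x) y = 0}"
      by (simp add: subspace_def inner_add_right)
    ultimately have "span C \<subseteq> {y. inner (x - P x) y = 0}" by (rule span_minimal)
    moreover have "x - P x \<in> span C"
      using that unfolding SC P_def by (intro span_diff span_sum span_scale) (auto intro: span_base)
    ultimately have "inner (x - P x) (x - P x) = 0" by blast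
    then show ?thesis by simp
  qed
  moreover have "P x \<in> S" for x
    unfolding SC P_def by (intro span_sum span_scale span_base)
  ultimately have "S = {x. P x = x}" by (metis (mono_tags, lifting) mem_Collect_eq subsetI subset_antisym)
  moreover have "linear P"
    by (rule linearI)
      (simp_all add: P_def inner_add_left add_divide_distrib scaleR_add_left sum.distrib scaleR_sum_right)
  ultimately show ?thesis using that linear_imp_bounded_linear by blast
qed

text \<open>A differentiable map with values in a subspace is unchanged by the projection \<open>P\<close>, and so is its
  derivative, since \<open>P\<close> is continuous and linear.\<close>

lemma derivative_in_subspace:
  fixes f :: "'b::real_normed_vector \<Rightarrow> 'a::findim_inner"
  assumes S: "subspace S" and f: "(f has_derivative D) (at x)"
    and U: "open U" "x \<in> U" "\<And>y. y \<in> U \<Longrightarrow> f y \<in> S"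
  shows "D v \<in> S"
proof -
  obtain P where P: "bounded_linear P" "S = {x. P x = x}"
    using subspace_eq_fixed_points[OF S] by blast
  have "((\<lambda>y. P (f y)) has_derivative (\<lambda>v. P (D v))) (at x)"
    by (rule bounded_linear.has_derivative[OF P(1) f])
  then have "(f has_derivative (\<lambda>v. P (D v))) (at x)"
    by (rule has_derivative_transform_within_open[OF _ U(1,2)]) (use U(3) P(2) in blast)
  from has_derivative_unique[OF this f] have "P (D v) = D v" by (rule fun_cong)
  then show ?thesis using P(2) by blast
qed

section \<open>Calculus of smooth functions\<close>

lemma Ck_on_SucI:
  assumes "\<And>x. x \<in> S \<Longrightarrow> (f has_derivative D x) (at x)"
    "\<And>v. Ck_on k S (\<lambda>x. frechet_derivative f (at x) v)"
  shows "Ck_on (Suc k) S f"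
  using assms by (auto simp: differentiable_def)

lemma Ck_on_SucD:
  assumes "Ck_on (Suc k) S f" "x \<in> S"
  shows "(f has_derivative frechet_derivative f (at x)) (at x)"
  using assms by (simp add: frechet_derivative_works[symmetric])

lemma Ck_on_cong:
  assumes "open S" "Ck_on k S f" "\<And>x. x \<in> S \<Longrightarrow> f x = g x"
  shows "Ck_on k S g"
  using assms(2,3)
proof (induction k arbitrary: f g)
  case 0
  then show ?case using continuous_on_cong[of S S f g] by simp
next
  case (Suc k)
  have d: "(g has_derivative frechet_derivative f (at x)) (at x)" if x: "x \<in> S" for x
    using has_derivative_transform_within_open[OF Ck_on_SucD[OF Suc.prems(1) x] assms(1) x]
      Suc.prems(2) by auto
  have "Ck_on k S (\<lambda>x. frechet_derivative g (at x) v)" for v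
    by (rule Suc.IH[of "\<lambda>x. frechet_derivative f (at x) v"])
      (use Suc.prems(1) frechet_derivative_at[OF d] in auto)
  with d show ?case by (intro Ck_on_SucI)
qed

lemma Ck_on_SucI':
  assumes "open S" "\<And>x. x \<in> S \<Longrightarrow> (f has_derivative D x) (at x)" "\<And>v. Ck_on k S (\<lambda>x. D x v)"
  shows "Ck_on (Suc k) S f"
proof (rule Ck_on_SucI[OF assms(2)])
  show "Ck_on k S (\<lambda>x. frechet_derivative f (at x) v)" for v
    by (rule Ck_on_cong[OF assms(1) assms(3)[of v]]) (simp add: frechet_derivative_at[OF assms(2)])
qed

lemma Ck_on_subset: "Ck_on k S f \<Longrightarrow> T \<subseteq> S \<Longrightarrow> Ck_on k T f"
  by (induction k arbitrary: f) (auto intro: continuous_on_subset)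

lemma Ck_on_mono: "Ck_on (Suc k) S f \<Longrightarrow> Ck_on k S f"
proof (induction k arbitrary: f)
  case 0
  then show ?case
    by (auto intro!: continuous_at_imp_continuous_on differentiable_imp_continuous_within)
next
  case (Suc k)
  then show ?case by simp
qed

lemma Ck_on_local:
  assumes "\<And>x. x \<in> S \<Longrightarrow> \<exists>U. open U \<and> x \<in> U \<and> Ck_on k U f"
  shows "Ck_on k S f"
  using assms
proof (induction k arbitrary: f)
  case 0
  have "isCont f x" if "x \<in> S" for x
    using 0[OF that] continuous_on_eq_continuous_at by auto
  then show ?case by (simp add: continuous_at_imp_continuous_on)
next
  case (Suc k)
  have "f differentiable at x" if "x \<in> S" for x
    using Suc.prems[OF that] by auto
  moreover have "Ck_on k S (\<lambda>x. frechet_derivative f (at x) v)" for v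
    by (rule Suc.IH) (use Suc.prems in force)
  ultimately show ?case by simp
qed

lemma Ck_on_const: "open S \<Longrightarrow> Ck_on k S (\<lambda>x. c)"
proof (induction k arbitrary: c)
  case (Suc k)
  then show ?case by (intro Ck_on_SucI'[where D = "\<lambda>x v. 0"]) auto
qed simp

lemma Ck_on_bounded_linear:
  assumes "bounded_linear L" "open S"
  shows "Ck_on k S L"
proof (cases k)
  case 0
  then show ?thesis using assms linear_continuous_on by auto
next
  case (Suc k)
  show ?thesis unfolding Suc
    by (rule Ck_on_SucI'[where D = "\<lambda>x. L"])
      (use assms in \<open>auto intro: bounded_linear_imp_has_derivative Ck_on_const\<close>)
qed

lemma Ck_on_add:
  assumes "open S" "Ck_on k S f" "Ck_on k S g"
  shows "Ck_on k S (\<lambda>x. f x + g x)"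
  using assms(2,3)
proof (induction k arbitrary: f g)
  case 0
  then show ?case by (auto intro: continuous_intros)
next
  case (Suc k)
  show ?case
  proof (rule Ck_on_SucI'[OF assms(1)])
    show "((\<lambda>x. f x + g x) has_derivative
        (\<lambda>v. frechet_derivative f (at x) v + frechet_derivative g (at x) v)) (at x)"
      if "x \<in> S" for x
      by (intro has_derivative_add Ck_on_SucD[OF Suc.prems(1) that] Ck_on_SucD[OF Suc.prems(2) that])
  qed (use Suc.prems in \<open>auto intro: Suc.IH\<close>)
qed

lemma Ck_on_sum:
  assumes "open S" "\<And>i. i \<in> I \<Longrightarrow> Ck_on k S (f i)"
  shows "Ck_on k S (\<lambda>x. \<Sum>i\<in>I. f i x)"
  using assms(2)
  by (induction I rule: infinite_finite_induct) (auto intro!: Ck_on_add Ck_on_const assms(1))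

lemma Ck_on_linear_comp:
  assumes "open S" "bounded_linear L" "Ck_on k S f"
  shows "Ck_on k S (\<lambda>x. L (f x))"
  using assms(3)
proof (induction k arbitrary: f)
  case 0
  then show ?case by (auto intro: bounded_linear.continuous_on[OF assms(2)])
next
  case (Suc k)
  show ?case
  proof (rule Ck_on_SucI'[OF assms(1)])
    show "((\<lambda>x. L (f x)) has_derivative (\<lambda>v. L (frechet_derivative f (at x) v))) (at x)"
      if "x \<in> S" for x
      by (intro bounded_linear.has_derivative[OF assms(2)] Ck_on_SucD[OF Suc.prems that])
  qed (use Suc.prems in \<open>auto intro: Suc.IH\<close>)
qed

text \<open>Each of the two terms of the product rule contains an undifferentiated factor, which has one
  derivative more than the induction hypothesis asks for.\<close>

lemma Ck_on_scaleR:
  assumes "open S" "Ck_on k S (f :: _ \<Rightarrow> real)" "Ck_on k S g"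
  shows "Ck_on k S (\<lambda>x. f x *\<^sub>R g x)"
  using assms(2,3)
proof (induction k arbitrary: f g)
  case 0
  then show ?case by (auto intro: continuous_intros)
next
  case (Suc k)
  note m = Suc.prems[THEN Ck_on_mono]
  show ?case
  proof (rule Ck_on_SucI'[OF assms(1)])
    show "((\<lambda>x. f x *\<^sub>R g x) has_derivative
        (\<lambda>v. f x *\<^sub>R frechet_derivative g (at x) v + frechet_derivative f (at x) v *\<^sub>R g x)) (at x)"
      if "x \<in> S" for x
      by (intro has_derivative_scaleR Ck_on_SucD[OF Suc.prems(1) that] Ck_on_SucD[OF Suc.prems(2) that])
    show "Ck_on k S (\<lambda>x. f x *\<^sub>R frechet_derivative g (at x) v + frechet_derivative f (at x) v *\<^sub>R g x)"
      for v
      using Suc.prems m by (intro Ck_on_add[OF assms(1)] Suc.IH) auto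
  qed
qed

lemma Ck_on_Pair:
  assumes "open S" "Ck_on k S f" "Ck_on k S g"
  shows "Ck_on k S (\<lambda>x. (f x, g x))"
  using assms(2,3)
proof (induction k arbitrary: f g)
  case 0
  then show ?case by (auto intro: continuous_intros)
next
  case (Suc k)
  show ?case
  proof (rule Ck_on_SucI'[OF assms(1)])
    show "((\<lambda>x. (f x, g x)) has_derivative
        (\<lambda>v. (frechet_derivative f (at x) v, frechet_derivative g (at x) v))) (at x)"
      if "x \<in> S" for x
      by (intro has_derivative_Pair Ck_on_SucD[OF Suc.prems(1) that] Ck_on_SucD[OF Suc.prems(2) that])
  qed (use Suc.prems in \<open>auto intro: Suc.IH\<close>)
qed

text \<open>The derivative of the composition is \<open>D g (f x) (D f x v)\<close>, whose inner argument varies with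
  \<open>x\<close>; expanding it in an orthonormal basis turns it into a sum of products to which the
  induction hypothesis applies.\<close>

lemma Ck_on_compose:
  fixes g :: "'b::findim_inner \<Rightarrow> 'c::real_normed_vector"
  assumes "open S" "open T" "Ck_on k S f" "Ck_on k T g" "f ` S \<subseteq> T"
  shows "Ck_on k S (\<lambda>x. g (f x))"
  using assms(3,4)
proof (induction k arbitrary: g)
  case 0
  then show ?case using assms(5) by (auto intro: continuous_on_compose2)
next
  case (Suc k)
  note f = Suc.prems(1) and g = Suc.prems(2)
  have T: "f x \<in> T" if "x \<in> S" for x using that assms(5) by auto
  show ?case
  proof (rule Ck_on_SucI'[OF assms(1)])
    fix x assume x: "x \<in> S"
    have "((\<lambda>x. g (f x)) has_derivative
        (\<lambda>v. frechet_derivative g (at (f x)) (frechet_derivative f (at x) v))) (at x)"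
      by (rule has_derivative_compose[OF Ck_on_SucD[OF f x] Ck_on_SucD[OF g T[OF x]]])
    also have "(\<lambda>v. frechet_derivative g (at (f x)) (frechet_derivative f (at x) v)) =
      (\<lambda>v. \<Sum>u\<in>onb. inner (frechet_derivative f (at x) v) u *\<^sub>R frechet_derivative g (at (f x)) u)"
      by (intro ext linear_onb_expansion has_derivative_linear[OF Ck_on_SucD[OF g T[OF x]]])
    finally show "((\<lambda>x. g (f x)) has_derivative (\<lambda>v. \<Sum>u\<in>onb.
        inner (frechet_derivative f (at x) v) u *\<^sub>R frechet_derivative g (at (f x)) u)) (at x)" .
  next
    fix v
    show "Ck_on k S (\<lambda>x. \<Sum>u\<in>onb.
        inner (frechet_derivative f (at x) v) u *\<^sub>R frechet_derivative g (at (f x)) u)"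
    proof (intro Ck_on_sum Ck_on_scaleR assms(1))
      fix u :: 'b
      show "Ck_on k S (\<lambda>x. inner (frechet_derivative f (at x) v) u)"
        using f by (intro Ck_on_linear_comp[OF assms(1) bounded_linear_inner_left]) auto
      show "Ck_on k S (\<lambda>x. frechet_derivative g (at (f x)) u)"
        using g by (intro Suc.IH Ck_on_mono[OF f]) auto
    qed
  qed
qed

lemma smooth_on_has_derivative:
  "smooth_on S f \<Longrightarrow> x \<in> S \<Longrightarrow> (f has_derivative frechet_derivative f (at x)) (at x)"
  unfolding smooth_on_def using Ck_on_SucD by blast

lemma smooth_on_frechet_derivative:
  "smooth_on S f \<Longrightarrow> smooth_on S (\<lambda>x. frechet_derivative f (at x) v)"
  unfolding smooth_on_def
proof
  fix k assume "\<forall>k. Ck_on k S f"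
  then have "Ck_on (Suc k) S f" ..
  then show "Ck_on k S (\<lambda>x. frechet_derivative f (at x) v)" by simp
qed

lemma smooth_on_cong:
  "smooth_on S f \<Longrightarrow> open S \<Longrightarrow> (\<And>x. x \<in> S \<Longrightarrow> f x = g x) \<Longrightarrow> smooth_on S g"
  unfolding smooth_on_def using Ck_on_cong by blast

lemma smooth_on_subset: "smooth_on S f \<Longrightarrow> T \<subseteq> S \<Longrightarrow> smooth_on T f"
  unfolding smooth_on_def using Ck_on_subset by blast

lemma smooth_on_local:
  "(\<And>x. x \<in> S \<Longrightarrow> \<exists>U. open U \<and> x \<in> U \<and> smooth_on U f) \<Longrightarrow> smooth_on S f"
  unfolding smooth_on_def by (intro allI Ck_on_local) meson

lemma smooth_on_const: "open S \<Longrightarrow> smooth_on S (\<lambda>x. c)"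
  unfolding smooth_on_def by (simp add: Ck_on_const)

lemma smooth_on_bounded_linear: "bounded_linear L \<Longrightarrow> open S \<Longrightarrow> smooth_on S L"
  unfolding smooth_on_def by (simp add: Ck_on_bounded_linear)

lemma smooth_on_Pair:
  "smooth_on S f \<Longrightarrow> smooth_on S g \<Longrightarrow> open S \<Longrightarrow> smooth_on S (\<lambda>x. (f x, g x))"
  unfolding smooth_on_def by (simp add: Ck_on_Pair)

lemma smooth_on_compose:
  fixes g :: "'b::findim_inner \<Rightarrow> 'c::real_normed_vector"
  shows "smooth_on T g \<Longrightarrow> smooth_on S f \<Longrightarrow> open S \<Longrightarrow> open T \<Longrightarrow> f ` S \<subseteq> T \<Longrightarrow>
    smooth_on S (\<lambda>x. g (f x))"
  unfolding smooth_on_def using Ck_on_compose by blast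

lemma smooth_on_continuous_on: "smooth_on S f \<Longrightarrow> continuous_on S f"
  unfolding smooth_on_def by (drule spec[of _ 0]) simp

section \<open>Symmetry of second derivatives\<close>

lemma has_real_derivative_along_line:
  fixes f :: "'a::real_normed_vector \<Rightarrow> 'b::real_inner"
  assumes "(f has_derivative D) (at (p + t *\<^sub>R v))"
  shows "((\<lambda>t. inner (f (p + t *\<^sub>R v)) e) has_real_derivative inner (D v) e) (at t)"
proof -
  have "((\<lambda>t. p + t *\<^sub>R v) has_derivative (\<lambda>h. h *\<^sub>R v)) (at t)"
    by (auto intro!: derivative_eq_intros)
  from has_derivative_compose[OF this assms]
  have "((\<lambda>t. f (p + t *\<^sub>R v)) has_derivative (\<lambda>h. h *\<^sub>R D v)) (at t)"
    by (simp add: linear_scale[OF has_derivative_linear[OF assms]])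
  then show ?thesis
    unfolding has_field_derivative_def
    by (auto intro!: derivative_eq_intros simp: mult.commute)
qed

text \<open>The mean value theorem, first in direction \<open>v\<close> and then in direction \<open>w\<close>, expresses the second
  difference of \<open>f\<close> by the second derivative at some point of the parallelogram. The
  second difference does not change when \<open>v\<close> and \<open>w\<close> are exchanged.\<close>

lemma second_difference_mean_value:
  fixes f :: "'a::real_normed_vector \<Rightarrow> 'b::real_inner"
  assumes C2: "Ck_on (Suc (Suc 0)) S f" and s: "s > 0"
    and S: "\<And>\<sigma> \<tau>. 0 \<le> \<sigma> \<Longrightarrow> \<sigma> \<le> s \<Longrightarrow> 0 \<le> \<tau> \<Longrightarrow> \<tau> \<le> s \<Longrightarrow> z + \<sigma> *\<^sub>R v + \<tau> *\<^sub>R w \<in> S"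
  obtains \<sigma> \<tau> where "0 \<le> \<sigma>" "\<sigma> \<le> s" "0 \<le> \<tau>" "\<tau> \<le> s"
    "inner (f (z + s *\<^sub>R v + s *\<^sub>R w) - f (z + s *\<^sub>R v) - f (z + s *\<^sub>R w) + f z) e =
     s * (s * inner (frechet_derivative (\<lambda>x. frechet_derivative f (at x) v)
                (at (z + \<sigma> *\<^sub>R v + \<tau> *\<^sub>R w)) w) e)"
proof -
  let ?d = "\<lambda>x. frechet_derivative f (at x) v"
  let ?dd = "\<lambda>x. frechet_derivative ?d (at x) w"
  have C1: "Ck_on (Suc 0) S ?d" using C2 by simp
  let ?\<phi> = "\<lambda>\<sigma>. inner (f ((z + s *\<^sub>R w) + \<sigma> *\<^sub>R v)) e - inner (f (z + \<sigma> *\<^sub>R v)) e"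
  have "\<exists>\<sigma>>0. \<sigma> < s \<and> ?\<phi> s - ?\<phi> 0 =
      (s - 0) * (inner (?d ((z + s *\<^sub>R w) + \<sigma> *\<^sub>R v)) e - inner (?d (z + \<sigma> *\<^sub>R v)) e)"
  proof (rule MVT2[OF s])
    fix \<sigma> :: real assume \<sigma>: "0 \<le> \<sigma>" "\<sigma> \<le> s"
    have "(z + s *\<^sub>R w) + \<sigma> *\<^sub>R v \<in> S" using S[OF \<sigma>, of s] s by (simp add: algebra_simps)
    moreover have "z + \<sigma> *\<^sub>R v \<in> S" using S[OF \<sigma>, of 0] s by simp
    ultimately show "(?\<phi> has_real_derivative
        (inner (?d ((z + s *\<^sub>R w) + \<sigma> *\<^sub>R v)) e - inner (?d (z + \<sigma> *\<^sub>R v)) e)) (at \<sigma>)"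
      by (intro DERIV_diff has_real_derivative_along_line Ck_on_SucD[OF C2])
  qed
  then obtain \<sigma> where \<sigma>: "0 < \<sigma>" "\<sigma> < s" and eq1: "?\<phi> s - ?\<phi> 0 =
      s * (inner (?d ((z + s *\<^sub>R w) + \<sigma> *\<^sub>R v)) e - inner (?d (z + \<sigma> *\<^sub>R v)) e)" by auto
  let ?\<psi> = "\<lambda>\<tau>. inner (?d ((z + \<sigma> *\<^sub>R v) + \<tau> *\<^sub>R w)) e"
  have "\<exists>\<tau>>0. \<tau> < s \<and> ?\<psi> s - ?\<psi> 0 = (s - 0) * inner (?dd (z + \<sigma> *\<^sub>R v + \<tau> *\<^sub>R w)) e"
  proof (rule MVT2[OF s])
    fix \<tau> :: real assume "0 \<le> \<tau>" "\<tau> \<le> s"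
    then have "z + \<sigma> *\<^sub>R v + \<tau> *\<^sub>R w \<in> S" using S[of \<sigma> \<tau>] \<sigma> by simp
    then show "(?\<psi> has_real_derivative inner (?dd (z + \<sigma> *\<^sub>R v + \<tau> *\<^sub>R w)) e) (at \<tau>)"
      by (intro has_real_derivative_along_line Ck_on_SucD[OF C1])
  qed
  then obtain \<tau> where \<tau>: "0 < \<tau>" "\<tau> < s" and
    eq2: "?\<psi> s - ?\<psi> 0 = s * inner (?dd (z + \<sigma> *\<^sub>R v + \<tau> *\<^sub>R w)) e" by auto
  have "inner (f (z + s *\<^sub>R v + s *\<^sub>R w) - f (z + s *\<^sub>R v) - f (z + s *\<^sub>R w) + f z) e = ?\<phi> s - ?\<phi> 0"
    by (simp add: inner_diff_left inner_add_left algebra_simps)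
  also have "\<dots> = s * (?\<psi> s - ?\<psi> 0)" unfolding eq1 by (simp add: algebra_simps)
  also note eq2
  finally show ?thesis using \<sigma> \<tau> by (intro that[of \<sigma> \<tau>]) auto
qed

text \<open>As the parallelogram shrinks to \<open>z\<close>, both mean values converge by continuity.\<close>

lemma second_derivative_symmetric:
  fixes f :: "'a::real_normed_vector \<Rightarrow> 'b::real_inner"
  assumes "open S" and C2: "Ck_on (Suc (Suc 0)) S f" and z: "z \<in> S"
  shows "frechet_derivative (\<lambda>x. frechet_derivative f (at x) v) (at z) w =
    frechet_derivative (\<lambda>x. frechet_derivative f (at x) w) (at z) v" (is "?A z = ?B z")
proof -
  have cont: "isCont (\<lambda>x. frechet_derivative (\<lambda>x. frechet_derivative f (at x) a) (at x) b) z" for a b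
    using C2 z \<open>open S\<close> by (auto simp: continuous_on_eq_continuous_at)
  have "norm (inner (?A z) e - inner (?B z) e) < \<epsilon>" if "\<epsilon> > 0" for e \<epsilon>
  proof -
    have "\<epsilon> / 2 > 0" using that by simp
    have lim: "\<exists>d>0. \<forall>x. norm (x - z) < d \<longrightarrow> norm (g x - g z) < \<epsilon> / 2"
      if "isCont g z" for g :: "'a \<Rightarrow> real"
      using that[unfolded continuous_at_eps_delta, rule_format, OF \<open>\<epsilon> / 2 > 0\<close>]
      by (simp add: dist_norm)
    obtain d1 d2 where d: "d1 > 0" "d2 > 0"
      "\<And>x. norm (x - z) < d1 \<Longrightarrow> norm (inner (?A x) e - inner (?A z) e) < \<epsilon> / 2"
      "\<And>x. norm (x - z) < d2 \<Longrightarrow> norm (inner (?B x) e - inner (?B z) e) < \<epsilon> / 2"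
      using lim[of "\<lambda>x. inner (?A x) e", OF continuous_inner[OF cont continuous_const]]
        lim[of "\<lambda>x. inner (?B x) e", OF continuous_inner[OF cont continuous_const]] by blast
    from \<open>open S\<close> z obtain d3 where d3: "d3 > 0" "ball z d3 \<subseteq> S" by (auto simp: open_contains_ball)
    define d where "d = min d1 (min d2 d3)"
    have d0: "d > 0" using d d3 by (simp add: d_def)
    \<comment> \<open>so small that the parallelogram spanned by \<open>s v\<close> and \<open>s w\<close> at \<open>z\<close> lies in the ball of radius \<open>d\<close>\<close>
    define s where "s = d / (norm v + norm w + 1)"
    have s: "s > 0" using d0 by (simp add: s_def add_nonneg_pos)
    have near: "norm (z + \<sigma> *\<^sub>R a + \<tau> *\<^sub>R b - z) < d"
      if "0 \<le> \<sigma>" "\<sigma> \<le> s" "0 \<le> \<tau>" "\<tau> \<le> s" "norm a + norm b = norm v + norm w" for \<sigma> \<tau> a b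
    proof -
      have "norm (z + \<sigma> *\<^sub>R a + \<tau> *\<^sub>R b - z) \<le> \<sigma> * norm a + \<tau> * norm b"
        using norm_triangle_ineq[of "\<sigma> *\<^sub>R a" "\<tau> *\<^sub>R b"] that by (simp add: algebra_simps)
      also have "\<dots> \<le> s * norm a + s * norm b"
        using that by (intro add_mono mult_right_mono) auto
      also have "\<dots> = s * (norm v + norm w)" using that(5) by (simp flip: distrib_left)
      also have "\<dots> < s * (norm v + norm w + 1)" using s by simp
      also have "\<dots> = d"
        using add_nonneg_pos[of "norm v + norm w" 1] unfolding s_def by simp
      finally show ?thesis .
    qed
    have inS: "z + \<sigma> *\<^sub>R a + \<tau> *\<^sub>R b \<in> S"
      if "0 \<le> \<sigma>" "\<sigma> \<le> s" "0 \<le> \<tau>" "\<tau> \<le> s" "norm a + norm b = norm v + norm w" for \<sigma> \<tau> a b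
    proof -
      have "z + \<sigma> *\<^sub>R a + \<tau> *\<^sub>R b \<in> ball z d3"
        using near[OF that] unfolding d_def mem_ball by (subst dist_commute) (simp add: dist_norm)
      then show ?thesis using d3 by blast
    qed
    obtain \<sigma>1 \<tau>1 where 1: "0 \<le> \<sigma>1" "\<sigma>1 \<le> s" "0 \<le> \<tau>1" "\<tau>1 \<le> s"
      "inner (f (z + s *\<^sub>R v + s *\<^sub>R w) - f (z + s *\<^sub>R v) - f (z + s *\<^sub>R w) + f z) e =
        s * (s * inner (?A (z + \<sigma>1 *\<^sub>R v + \<tau>1 *\<^sub>R w)) e)"
      using second_difference_mean_value[OF C2 s, of z v w e] inS[of _ _ v w] by auto
    obtain \<sigma>2 \<tau>2 where 2: "0 \<le> \<sigma>2" "\<sigma>2 \<le> s" "0 \<le> \<tau>2" "\<tau>2 \<le> s"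
      "inner (f (z + s *\<^sub>R w + s *\<^sub>R v) - f (z + s *\<^sub>R w) - f (z + s *\<^sub>R v) + f z) e =
        s * (s * inner (?B (z + \<sigma>2 *\<^sub>R w + \<tau>2 *\<^sub>R v)) e)"
      using second_difference_mean_value[OF C2 s, of z w v e] inS[of _ _ w v]
      by (auto simp: add.commute)
    have "f (z + s *\<^sub>R w + s *\<^sub>R v) - f (z + s *\<^sub>R w) - f (z + s *\<^sub>R v) + f z =
      f (z + s *\<^sub>R v + s *\<^sub>R w) - f (z + s *\<^sub>R v) - f (z + s *\<^sub>R w) + f z"
      by (simp add: algebra_simps)
    with 1(5) 2(5) have "s * (s * inner (?A (z + \<sigma>1 *\<^sub>R v + \<tau>1 *\<^sub>R w)) e) =
      s * (s * inner (?B (z + \<sigma>2 *\<^sub>R w + \<tau>2 *\<^sub>R v)) e)" by simp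
    then have eq: "inner (?A (z + \<sigma>1 *\<^sub>R v + \<tau>1 *\<^sub>R w)) e = inner (?B (z + \<sigma>2 *\<^sub>R w + \<tau>2 *\<^sub>R v)) e"
      using s by simp
    have "norm (inner (?A (z + \<sigma>1 *\<^sub>R v + \<tau>1 *\<^sub>R w)) e - inner (?A z) e) < \<epsilon> / 2"
      by (rule d(3)) (use near[OF 1(1-4), of v w] in \<open>simp add: d_def\<close>)
    moreover have "norm (inner (?B (z + \<sigma>2 *\<^sub>R w + \<tau>2 *\<^sub>R v)) e - inner (?B z) e) < \<epsilon> / 2"
      by (rule d(4)) (use near[OF 2(1-4), of w v] in \<open>simp add: d_def add.commute\<close>)
    ultimately show ?thesis using eq by (simp add: abs_if split: if_splits)
  qed
  then have "inner (?A z) e = inner (?B z) e" for e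
    by (metis eq_iff_diff_eq_0 less_irrefl zero_less_norm_iff)
  then have "inner (?A z - ?B z) (?A z - ?B z) = 0" by (simp add: inner_diff_left)
  then show ?thesis by simp
qed

section \<open>Ordinary differential equations\<close>

text \<open>By continuity the partial derivatives in the finitely many basis directions are bounded near \<open>x0\<close>; their
  bounds add up to a bound on the operator norm of the derivative.\<close>

lemma C1_imp_locally_lipschitz:
  fixes F :: "'a::findim_inner \<Rightarrow> 'b::real_normed_vector"
  assumes "open U" and C1: "Ck_on (Suc 0) U F" and x0: "x0 \<in> U"
  obtains r K where "r > 0" "K \<ge> 0" "cball x0 r \<subseteq> U"
    "\<And>x y. x \<in> cball x0 r \<Longrightarrow> y \<in> cball x0 r \<Longrightarrow> norm (F x - F y) \<le> K * norm (x - y)"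
proof -
  let ?D = "\<lambda>x. frechet_derivative F (at x)"
  have "eventually (\<lambda>x. norm (?D x u) < norm (?D x0 u) + 1) (nhds x0)" for u
  proof -
    have "isCont (\<lambda>x. ?D x u) x0" using C1 \<open>open U\<close> x0 by (auto simp: continuous_on_eq_continuous_at)
    then have "isCont (\<lambda>x. norm (?D x u)) x0" by (rule continuous_norm)
    then have "((\<lambda>x. norm (?D x u)) \<longlongrightarrow> norm (?D x0 u)) (nhds x0)"
      unfolding isCont_def
      by (rule tendsto_at_iff_tendsto_nhds[where g = "\<lambda>x. norm (?D x u)", THEN iffD1])
    then show ?thesis by (rule order_tendstoD(2)) simp
  qed
  then have "eventually (\<lambda>x. \<forall>u\<in>onb. norm (?D x u) < norm (?D x0 u) + 1) (nhds x0)"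
    by (intro eventually_ball_finite) auto
  moreover have "eventually (\<lambda>x. x \<in> U) (nhds x0)"
    using \<open>open U\<close> x0 by (rule eventually_nhds_in_open)
  ultimately have "eventually (\<lambda>x. x \<in> U \<and> (\<forall>u\<in>onb. norm (?D x u) < norm (?D x0 u) + 1)) (nhds x0)"
    by eventually_elim simp
  then obtain d where d: "d > 0"
    "\<And>x. dist x x0 < d \<Longrightarrow> x \<in> U \<and> (\<forall>u\<in>onb. norm (?D x u) < norm (?D x0 u) + 1)"
    by (auto simp: eventually_nhds_metric)
  define K where "K = (\<Sum>u\<in>(onb::'a set). norm (?D x0 u) + 1)"
  have K: "K \<ge> 0" by (auto simp: K_def intro!: sum_nonneg)
  have near: "x \<in> U" "\<And>u. u \<in> onb \<Longrightarrow> norm (?D x u) \<le> norm (?D x0 u) + 1" if "x \<in> cball x0 (d/2)" for x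
    using d(2)[of x] that d(1) by (auto simp: dist_commute less_imp_le)
  have "norm (F x - F y) \<le> K * norm (x - y)" if "x \<in> cball x0 (d/2)" "y \<in> cball x0 (d/2)" for x y
  proof (rule differentiable_bound[OF convex_cball[of x0 "d/2"] _ _ that])
    fix x assume x: "x \<in> cball x0 (d/2)"
    show D: "(F has_derivative ?D x) (at x within cball x0 (d/2))"
      by (rule has_derivative_at_withinI[OF Ck_on_SucD[OF C1 near(1)[OF x]]])
    show "onorm (?D x) \<le> K"
    proof (rule onorm_bound[OF K])
      fix v
      have "norm (?D x v) = norm (\<Sum>u\<in>onb. inner v u *\<^sub>R ?D x u)"
        by (subst linear_onb_expansion[OF has_derivative_linear[OF D]]) simp
      also have "\<dots> \<le> (\<Sum>u\<in>onb. norm (inner v u *\<^sub>R ?D x u))" by (rule norm_sum)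
      also have "\<dots> \<le> (\<Sum>u\<in>onb. norm v * (norm (?D x0 u) + 1))"
      proof (rule sum_mono)
        fix u :: 'a assume u: "u \<in> onb"
        have "norm u = 1" using inner_onb[OF u u] by (simp add: norm_eq_sqrt_inner)
        then have "\<bar>inner v u\<bar> \<le> norm v" using Cauchy_Schwarz_ineq2[of v u] by simp
        then show "norm (inner v u *\<^sub>R ?D x u) \<le> norm v * (norm (?D x0 u) + 1)"
          using near(2)[OF x u] by (simp add: mult_mono)
      qed
      also have "\<dots> = K * norm v" by (simp add: K_def sum_distrib_left mult.commute)
      finally show "norm (?D x v) \<le> K * norm v" .
    qed
  qed
  moreover have "cball x0 (d/2) \<subseteq> U" using near(1) by blast
  ultimately show ?thesis using d(1) K by (intro that[of "d/2" K]) auto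
qed

lemma vector_derivative_bound:
  fixes f :: "real \<Rightarrow> 'a::real_normed_vector"
  assumes "convex I" "\<And>t. t \<in> I \<Longrightarrow> (f has_vector_derivative f' t) (at t within I)"
    "\<And>t. t \<in> I \<Longrightarrow> norm (f' t) \<le> B" "s \<in> I" "t \<in> I"
  shows "norm (f s - f t) \<le> B * \<bar>s - t\<bar>"
proof -
  have "B \<ge> 0" using assms(3,4) norm_ge_zero order_trans by blast
  then have "onorm (\<lambda>h. h *\<^sub>R f' x) \<le> B" if "x \<in> I" for x
    using assms(3)[OF that] by (intro onorm_bound) (auto simp: mult.commute[of B] intro!: mult_left_mono)
  with assms show ?thesis
    using differentiable_bound[of I f "\<lambda>x h. h *\<^sub>R f' x" B s t]
    by (simp add: has_vector_derivative_def)
qed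

text \<open>Picard iteration on the space of continuous curves in the ball: since \<open>K * \<epsilon> < 1\<close>, it is a contraction
  for the supremum norm. The bound is part of the conclusion because uniqueness uses it as well.\<close>

lemma picard_local_existence:
  fixes F :: "'a::banach \<Rightarrow> 'a"
  assumes r: "r > 0" and K: "K \<ge> 0"
    and lip: "\<And>x y. x \<in> cball x0 r \<Longrightarrow> y \<in> cball x0 r \<Longrightarrow> norm (F x - F y) \<le> K * norm (x - y)"
  obtains \<epsilon> y where "\<epsilon> > 0" "K * \<epsilon> < 1" "y 0 = x0"
    "\<And>t. \<bar>t\<bar> < \<epsilon> \<Longrightarrow> y t \<in> cball x0 r"
    "\<And>t. \<bar>t\<bar> < \<epsilon> \<Longrightarrow> (y has_vector_derivative F (y t)) (at t)"
proof -
  define B where "B = norm (F x0) + K * r"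
  have B: "norm (F x) \<le> B" if "x \<in> cball x0 r" for x
  proof -
    have "norm (F x) \<le> norm (F x0) + norm (F x - F x0)" by norm
    also have "norm (F x - F x0) \<le> K * norm (x - x0)" using lip[OF that] r by simp
    also have "\<dots> \<le> K * r" using that K by (intro mult_left_mono) (auto simp: dist_norm norm_minus_commute)
    finally show ?thesis by (simp add: B_def)
  qed
  have B0: "B \<ge> 0" using K r by (simp add: B_def)
  \<comment> \<open>the first bound keeps the iterates in the ball, the second makes the iteration a contraction\<close>
  define \<epsilon> where "\<epsilon> = min (r / (B + 1)) (1 / (2 * (K + 1)))"
  have \<epsilon>: "\<epsilon> > 0" using r B0 K by (simp add: \<epsilon>_def)
  have "B * \<epsilon> \<le> B * (r / (B + 1))" using B0 by (intro mult_left_mono) (auto simp: \<epsilon>_def)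
  also have "\<dots> \<le> r" using B0 r by (simp add: field_simps)
  finally have B\<epsilon>: "B * \<epsilon> \<le> r" .
  have "K * \<epsilon> \<le> K * (1 / (2 * (K + 1)))" using K by (intro mult_left_mono) (auto simp: \<epsilon>_def)
  also have "\<dots> < 1" using K by (simp add: field_simps)
  finally have K\<epsilon>: "K * \<epsilon> < 1" .
  let ?I = "{-\<epsilon>..\<epsilon>}"
  \<comment> \<open>Curves on the interval are extended by constants, to be bounded continuous functions on \<open>\<real>\<close>.\<close>
  define cl where "cl t = max (-\<epsilon>) (min \<epsilon> t)" for t
  have cl: "cl t \<in> ?I" for t using \<epsilon> by (auto simp: cl_def)
  have cl_id: "cl t = t" if "t \<in> ?I" for t using that by (auto simp: cl_def)
  have cl_cont: "continuous_on UNIV cl" unfolding cl_def by (intro continuous_intros)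
  define S :: "(real \<Rightarrow>\<^sub>C 'a) set" where "S = PiC UNIV (\<lambda>_. cball x0 r)"
  have S: "f \<in> S \<longleftrightarrow> (\<forall>t. apply_bcontfun f t \<in> cball x0 r)" for f
    by (auto simp: S_def mem_PiC_iff)
  \<comment> \<open>\<open>J f t\<close> is the integral from \<open>0\<close> to \<open>t\<close>, with the correct sign also for negative \<open>t\<close>\<close>
  define J where "J f t = integral {-\<epsilon>..t} (\<lambda>s. F (apply_bcontfun f s)) -
    integral {-\<epsilon>..0} (\<lambda>s. F (apply_bcontfun f s))" for f t
  have Fcont: "continuous_on (cball x0 r) F"
  proof (rule continuous_on_iff[THEN iffD2], intro ballI allI impI)
    fix x and e :: real assume x: "x \<in> cball x0 r" and e: "e > 0"
    have "norm (F y - F x) < e" if "y \<in> cball x0 r" "norm (y - x) < e / (K + 1)" for y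
    proof -
      have "norm (F y - F x) \<le> K * norm (y - x)" using lip that(1) x by blast
      also have "\<dots> \<le> K * (e / (K + 1))" using that(2) K by (intro mult_left_mono) auto
      also have "\<dots> < e" using K e by (simp add: field_simps)
      finally show ?thesis .
    qed
    moreover have "e / (K + 1) > 0" using e K by simp
    ultimately show "\<exists>d>0. \<forall>y\<in>cball x0 r. dist y x < d \<longrightarrow> dist (F y) (F x) < e"
      by (auto simp: dist_norm)
  qed
  have J_deriv: "(J f has_vector_derivative F (apply_bcontfun f t)) (at t within ?I)"
    if "f \<in> S" "t \<in> ?I" for f t
  proof -
    have "continuous_on ?I (\<lambda>s. F (apply_bcontfun f s))"
      by (rule continuous_on_compose2[OF Fcont]) (use that(1) in \<open>auto simp: S\<close>)
    from integral_has_vector_derivative[OF this that(2)] show ?thesis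
      unfolding J_def by (auto intro!: derivative_eq_intros)
  qed
  have J0: "J f 0 = 0" for f by (simp add: J_def)
  have J_bound: "norm (J f t) \<le> r" if "f \<in> S" "t \<in> ?I" for f t
  proof -
    have "norm (J f t - J f 0) \<le> B * \<bar>t - 0\<bar>"
      by (rule vector_derivative_bound[OF _ J_deriv[OF that(1)]])
        (use that \<epsilon> in \<open>auto simp: S intro!: B\<close>)
    also have "\<dots> \<le> B * \<epsilon>" using that B0 by (intro mult_left_mono) auto
    finally show ?thesis using B\<epsilon> J0 by simp
  qed
  have J_cont: "continuous_on ?I (J f)" if "f \<in> S" for f
    by (rule continuous_on_vector_derivative[OF J_deriv[OF that]])
  have in_bc: "(\<lambda>t. x0 + J f (cl t)) \<in> bcontfun" if "f \<in> S" for f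
  proof (rule bcontfun_normI[where b = "norm x0 + r"])
    show "continuous_on UNIV (\<lambda>t. x0 + J f (cl t))"
      by (intro continuous_intros continuous_on_compose2[OF J_cont[OF that] cl_cont]) (use cl in auto)
    show "norm (x0 + J f (cl t)) \<le> norm x0 + r" for t
      using J_bound[OF that cl[of t]] norm_triangle_ineq[of x0 "J f (cl t)"] by linarith
  qed
  define T where "T f = Bcontfun (\<lambda>t. x0 + J f (cl t))" for f
  have T: "apply_bcontfun (T f) t = x0 + J f (cl t)" if "f \<in> S" for f t
    unfolding T_def by (simp add: Bcontfun_inverse in_bc[OF that])
  have "\<exists>!f. f \<in> S \<and> T f = f"
  proof (rule Banach_fix)
    show "complete S" unfolding complete_eq_closed S_def by (intro closed_PiC) simp
    have "const_bcontfun x0 \<in> S" unfolding S using r by (simp add: const_bcontfun.rep_eq)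
    then show "S \<noteq> {}" by blast
    show "0 \<le> K * \<epsilon>" using K \<epsilon> by simp
    show "K * \<epsilon> < 1" by (rule K\<epsilon>)
    show "T ` S \<subseteq> S"
    proof safe
      fix f assume f: "f \<in> S"
      then show "T f \<in> S" using J_bound[OF f cl] by (auto simp: S[of "T f"] T dist_norm)
    qed
    fix f g assume f: "f \<in> S" and g: "g \<in> S"
    show "dist (T f) (T g) \<le> K * \<epsilon> * dist f g"
    proof (rule dist_bound)
      fix t
      have "norm ((J f (cl t) - J g (cl t)) - (J f 0 - J g 0)) \<le> (K * dist f g) * \<bar>cl t - 0\<bar>"
      proof (rule vector_derivative_bound[where I = ?I])
        fix s assume s: "s \<in> ?I"
        show "((\<lambda>t. J f t - J g t) has_vector_derivative F (apply_bcontfun f s) - F (apply_bcontfun g s))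
            (at s within ?I)"
          by (intro has_vector_derivative_diff J_deriv f g s)
        have "norm (F (apply_bcontfun f s) - F (apply_bcontfun g s)) \<le>
            K * dist (apply_bcontfun f s) (apply_bcontfun g s)"
          using lip f g by (auto simp: S dist_norm)
        also have "\<dots> \<le> K * dist f g" by (intro mult_left_mono dist_bounded K)
        finally show "norm (F (apply_bcontfun f s) - F (apply_bcontfun g s)) \<le> K * dist f g" .
      qed (use cl \<epsilon> in auto)
      also have "\<dots> \<le> (K * dist f g) * \<epsilon>" using cl[of t] K by (intro mult_left_mono) auto
      finally show "dist (apply_bcontfun (T f) t) (apply_bcontfun (T g) t) \<le> K * \<epsilon> * dist f g"
        by (simp add: T f g J0 dist_norm mult_ac)
    qed
  qed
  then obtain f where f: "f \<in> S" "T f = f" by blast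
  have eq: "apply_bcontfun f t = x0 + J f t" if "t \<in> ?I" for t
    using T[OF f(1), of t] f(2) cl_id[OF that] by simp
  show ?thesis
  proof (rule that[of \<epsilon> "apply_bcontfun f"])
    show "apply_bcontfun f 0 = x0" using eq[of 0] \<epsilon> J0 by simp
    show "apply_bcontfun f t \<in> cball x0 r" for t using f(1) S by blast
    fix t assume t: "\<bar>t\<bar> < \<epsilon>"
    have "((\<lambda>t. x0 + J f t) has_vector_derivative F (apply_bcontfun f t)) (at t within ?I)"
      using J_deriv[OF f(1), of t] t by (auto intro!: derivative_eq_intros simp: abs_less_iff)
    moreover have "t \<in> ?I" using t by (simp add: abs_less_iff)
    ultimately have "(apply_bcontfun f has_vector_derivative F (apply_bcontfun f t)) (at t within ?I)"
      using eq by (intro has_vector_derivative_transform[of t ?I "apply_bcontfun f" "\<lambda>t. x0 + J f t"])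
    then show "(apply_bcontfun f has_vector_derivative F (apply_bcontfun f t)) (at t)"
      using at_within_interior[of t ?I] t by (simp add: abs_less_iff)
  qed (use \<epsilon> K\<epsilon> in auto)
qed

text \<open>At the point where the distance \<open>m\<close> of the two solutions on \<open>[-|t|, |t|]\<close> is largest, the
  mean value inequality gives \<open>m \<le> K * \<delta> * m\<close>, hence \<open>m = 0\<close>.\<close>

lemma picard_unique:
  fixes F :: "'a::real_normed_vector \<Rightarrow> 'a"
  assumes K: "K \<ge> 0" "K * \<delta> < 1"
    and lip: "\<And>x y. x \<in> A \<Longrightarrow> y \<in> A \<Longrightarrow> norm (F x - F y) \<le> K * norm (x - y)"
    and y: "\<And>t. \<bar>t\<bar> < \<delta> \<Longrightarrow> y t \<in> A" "\<And>t. \<bar>t\<bar> < \<delta> \<Longrightarrow> (y has_vector_derivative F (y t)) (at t)"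
    and z: "\<And>t. \<bar>t\<bar> < \<delta> \<Longrightarrow> z t \<in> A" "\<And>t. \<bar>t\<bar> < \<delta> \<Longrightarrow> (z has_vector_derivative F (z t)) (at t)"
    and 0: "y 0 = z 0" and t: "\<bar>t\<bar> < \<delta>"
  shows "y t = z t"
proof -
  let ?I = "{-\<bar>t\<bar>..\<bar>t\<bar>}"
  have d: "((\<lambda>t. y t - z t) has_vector_derivative F (y s) - F (z s)) (at s within ?I)" if "s \<in> ?I" for s
    by (rule has_vector_derivative_at_within[OF has_vector_derivative_diff[OF y(2) z(2)]])
      (use that t in auto)
  have "continuous_on ?I (\<lambda>s. norm (y s - z s))"
    using d by (intro continuous_on_norm continuous_on_vector_derivative)
  then obtain s where s: "s \<in> ?I" "\<And>u. u \<in> ?I \<Longrightarrow> norm (y u - z u) \<le> norm (y s - z s)"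
    using continuous_attains_sup[of ?I "\<lambda>s. norm (y s - z s)"] by fastforce
  have "norm ((y s - z s) - (y 0 - z 0)) \<le> (K * norm (y s - z s)) * \<bar>s - 0\<bar>"
  proof (rule vector_derivative_bound[where I = ?I, OF _ d])
    fix u assume u: "u \<in> ?I"
    have "norm (F (y u) - F (z u)) \<le> K * norm (y u - z u)" using u t by (intro lip y z) auto
    also have "\<dots> \<le> K * norm (y s - z s)" by (intro mult_left_mono s(2) u K)
    finally show "norm (F (y u) - F (z u)) \<le> K * norm (y s - z s)" .
  qed (use s in auto)
  also have "\<dots> \<le> (K * norm (y s - z s)) * \<delta>"
    using s t K by (intro mult_left_mono) auto
  finally have "norm (y s - z s) \<le> (K * \<delta>) * norm (y s - z s)" using 0 by (simp add: mult_ac)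
  then have "norm (y s - z s) = 0"
    using K(2) mult_strict_right_mono[of "K * \<delta>" 1 "norm (y s - z s)"] by (cases "norm (y s - z s) = 0") auto
  moreover have "t \<in> ?I" by (auto simp: abs_if)
  ultimately show ?thesis using s(2)[of t] by simp
qed

section \<open>Calculus in charts\<close>

text \<open>The conditions that a smooth manifold imposes on its charts. Multiplication and action are
  defined on products, and products inherit these conditions chart by chart.\<close>

definition charted :: "('m, 'e::findim_inner) manifold \<Rightarrow> bool" where
  "charted M \<longleftrightarrow> (\<forall>c\<in>atlas M. is_chart (mtop M) c) \<and> (\<Union>c\<in>atlas M. dom_of c) = points M \<and>
     (\<forall>c\<in>atlas M. \<forall>d\<in>atlas M.
        smooth_on (coord c ` (dom_of c \<inter> dom_of d)) (coord d \<circ> coord_inv c))"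

lemma smooth_manifold_imp_charted: "smooth_manifold M \<Longrightarrow> charted M"
  by (simp add: smooth_manifold_def charted_def)

lemma is_chart_inj_on:
  assumes "is_chart X c" shows "inj_on (coord c) (dom_of c)"
proof -
  have "topspace (subtopology X (dom_of c)) = dom_of c"
    using assms openin_subset by (auto simp: is_chart_def)
  moreover have "inj_on (coord c) (topspace (subtopology X (dom_of c)))"
    using assms by (intro homeomorphic_imp_injective_map) (auto simp: is_chart_def)
  ultimately show ?thesis by metis
qed

context
  fixes M :: "('m, 'e::findim_inner) manifold" and c :: "('m, 'e) chart"
  assumes M: "charted M" and c: "c \<in> atlas M"
begin

lemma openin_dom_of: "openin (mtop M) (dom_of c)"
  and open_img_of: "open (img_of c)"
  and homeomorphic_map_coord:
    "homeomorphic_map (subtopology (mtop M) (dom_of c)) (top_of_set (img_of c)) (coord c)"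
  using M c by (auto simp: charted_def is_chart_def)

lemma dom_of_subset: "dom_of c \<subseteq> points M"
  using openin_dom_of openin_subset by blast

lemma inj_on_coord: "inj_on (coord c) (dom_of c)"
  using M c by (intro is_chart_inj_on[of "mtop M"]) (auto simp: charted_def)

lemma coord_inv_coord: "p \<in> dom_of c \<Longrightarrow> coord_inv c (coord c p) = p"
  by (simp add: coord_inv_def inj_on_coord)

lemma coord_inv_in_dom: "x \<in> img_of c \<Longrightarrow> coord_inv c x \<in> dom_of c"
  unfolding coord_inv_def by (rule inv_into_into)

lemma coord_coord_inv: "x \<in> img_of c \<Longrightarrow> coord c (coord_inv c x) = x"
  unfolding coord_inv_def by (rule f_inv_into_f)

lemma open_coord_image:
  assumes "openin (mtop M) U" "U \<subseteq> dom_of c"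
  shows "open (coord c ` U)"
proof -
  have "openin (subtopology (mtop M) (dom_of c)) U"
    using assms by (simp add: openin_open_subtopology openin_dom_of)
  then have "openin (top_of_set (img_of c)) (coord c ` U)"
    using homeomorphic_imp_open_map[OF homeomorphic_map_coord] by (simp add: open_map_def)
  then show ?thesis using open_img_of by (simp add: openin_open_eq)
qed

lemma openin_coord_vimage:
  assumes "open V"
  shows "openin (mtop M) {p \<in> dom_of c. coord c p \<in> V}"
proof -
  have top: "topspace (subtopology (mtop M) (dom_of c)) = dom_of c"
    using dom_of_subset by auto
  have "continuous_map (subtopology (mtop M) (dom_of c)) euclidean (coord c)"
    using homeomorphic_imp_continuous_map[OF homeomorphic_map_coord]
    by (rule continuous_map_into_fulltopology)
  from openin_continuous_map_preimage[OF this, of V] assms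
  have "openin (subtopology (mtop M) (dom_of c)) {p \<in> dom_of c. coord c p \<in> V}"
    unfolding top by simp
  then show ?thesis by (rule openin_trans_full[OF _ openin_dom_of])
qed

lemma openin_preimage_dom:
  assumes "continuous_map (mtop M) Y f" "openin Y V"
  shows "openin (mtop M) {x \<in> dom_of c. f x \<in> V}"
proof -
  have "{x \<in> dom_of c. f x \<in> V} = {x \<in> points M. f x \<in> V} \<inter> dom_of c"
    using dom_of_subset by auto
  then show ?thesis
    using openin_continuous_map_preimage[OF assms] openin_dom_of by auto
qed

lemma open_coord_preimage:
  assumes "continuous_map (mtop M) Y f" "openin Y V"
  shows "open (coord c ` {x \<in> dom_of c. f x \<in> V})"
  using openin_preimage_dom[OF assms] by (rule open_coord_image) auto

end

lemma charted_ex_chart: "charted M \<Longrightarrow> p \<in> points M \<Longrightarrow> \<exists>c. c \<in> charts_at M p"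
proof -
  assume "charted M" "p \<in> points M"
  then have "p \<in> (\<Union>c\<in>atlas M. dom_of c)" by (simp add: charted_def)
  then show ?thesis by (auto simp: charts_at_def simp del: split_paired_Ex)
qed

lemma charts_atD: "c \<in> charts_at M p \<Longrightarrow> c \<in> atlas M" "c \<in> charts_at M p \<Longrightarrow> p \<in> dom_of c"
  by (auto simp: charts_at_def)

lemma charts_at_points: "charted M \<Longrightarrow> c \<in> charts_at M p \<Longrightarrow> p \<in> points M"
  using subsetD[OF dom_of_subset[OF _ charts_atD(1)] charts_atD(2)] .

lemma some_chart_at: "charted M \<Longrightarrow> p \<in> points M \<Longrightarrow> (SOME c. c \<in> charts_at M p) \<in> charts_at M p"
  by (rule someI_ex[OF charted_ex_chart])

text \<open>The differential of \<open>f\<close> at \<open>p\<close>, read in the charts \<open>c\<close> and \<open>d\<close>.\<close>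

abbreviation dmap :: "('m, 'e::findim_inner) chart \<Rightarrow> ('n, 'f::findim_inner) chart \<Rightarrow>
    ('m \<Rightarrow> 'n) \<Rightarrow> 'm \<Rightarrow> 'e \<Rightarrow> 'f" where
  "dmap c d f p \<equiv> frechet_derivative (coord d \<circ> f \<circ> coord_inv c) (at (coord c p))"

lemma smooth_map_continuous: "smooth_map M N f \<Longrightarrow> continuous_map (mtop M) (mtop N) f"
  by (simp add: smooth_map_def)

lemma smooth_map_in_points: "smooth_map M N f \<Longrightarrow> p \<in> points M \<Longrightarrow> f p \<in> points N"
  using funcset_mem[OF continuous_map_funspace[OF smooth_map_continuous]] .

lemma smooth_map_smooth_on: "smooth_map M N f \<Longrightarrow> c \<in> atlas M \<Longrightarrow> d \<in> atlas N \<Longrightarrow>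
    smooth_on (coord c ` {x \<in> dom_of c. f x \<in> dom_of d}) (coord d \<circ> f \<circ> coord_inv c)"
  by (simp add: smooth_map_def)

lemma smooth_map_has_derivative:
  assumes "smooth_map M N f" "c \<in> charts_at M p" "d \<in> charts_at N (f p)"
  shows "((coord d \<circ> f \<circ> coord_inv c) has_derivative dmap c d f p) (at (coord c p))"
  by (rule smooth_on_has_derivative[OF smooth_map_smooth_on[OF assms(1)]])
    (use assms(2,3) in \<open>auto simp: charts_at_def\<close>)

lemma linear_dmap:
  assumes "smooth_map M N f" "c \<in> charts_at M p" "d \<in> charts_at N (f p)"
  shows "linear (dmap c d f p)"
  by (rule has_derivative_linear[OF smooth_map_has_derivative[OF assms]])

lemma frechet_derivative_cong_open:
  assumes "open S" "x \<in> S" "\<And>y. y \<in> S \<Longrightarrow> f y = g y"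
  shows "frechet_derivative f (at x) = frechet_derivative g (at x)"
proof -
  have "(f has_derivative D) (at x) \<longleftrightarrow> (g has_derivative D) (at x)" for D
  proof
    assume "(f has_derivative D) (at x)"
    then show "(g has_derivative D) (at x)"
      by (rule has_derivative_transform_within_open[OF _ assms(1,2)]) (simp add: assms(3))
  next
    assume "(g has_derivative D) (at x)"
    then show "(f has_derivative D) (at x)"
      by (rule has_derivative_transform_within_open[OF _ assms(1,2)]) (simp add: assms(3))
  qed
  then show ?thesis by (simp add: frechet_derivative_def)
qed

lemma dmap_cong:
  assumes M: "charted M" and c: "c \<in> charts_at M p"
    and eq: "\<And>x. x \<in> dom_of c \<Longrightarrow> f x = g x"
  shows "dmap c d f p = dmap c d g p"
proof (rule frechet_derivative_cong_open[OF open_img_of[OF M charts_atD(1)[OF c]]])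
  show "coord c p \<in> img_of c" using charts_atD(2)[OF c] by simp
  show "(coord d \<circ> f \<circ> coord_inv c) y = (coord d \<circ> g \<circ> coord_inv c) y" if "y \<in> img_of c" for y
    using eq[OF coord_inv_in_dom[OF M charts_atD(1)[OF c] that]] by simp
qed

text \<open>The chain rule. The local representative of the composition is the composition of the local
  representatives near \<open>p\<close>, where \<open>f\<close> takes values in the intermediate chart.\<close>

lemma dmap_compose:
  assumes M: "charted M" and N: "charted N" and f: "smooth_map M N f" and g: "smooth_map N P g"
    and c: "c \<in> charts_at M p" and d: "d \<in> charts_at N (f p)" and e: "e \<in> charts_at P (g (f p))"
  shows "dmap c e (\<lambda>x. g (f x)) p v = dmap d e g (f p) (dmap c d f p v)"
proof -
  note c' = charts_atD[OF c] and d' = charts_atD[OF d]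
  let ?h = "\<lambda>x. (coord e \<circ> g \<circ> coord_inv d) ((coord d \<circ> f \<circ> coord_inv c) x)"
  have q: "(coord d \<circ> f \<circ> coord_inv c) (coord c p) = coord d (f p)"
    using coord_inv_coord[OF M c'(1,2)] by simp
  have "(?h has_derivative (\<lambda>v. dmap d e g (f p) (dmap c d f p v))) (at (coord c p))"
    by (rule has_derivative_compose[OF smooth_map_has_derivative[OF f c d]])
      (unfold q, rule smooth_map_has_derivative[OF g d e])
  then have "((coord e \<circ> (\<lambda>x. g (f x)) \<circ> coord_inv c) has_derivative
      (\<lambda>v. dmap d e g (f p) (dmap c d f p v))) (at (coord c p))"
    by (rule has_derivative_transform_within_open[OF _ open_coord_preimage[OF M c'(1)
          smooth_map_continuous[OF f] openin_dom_of[OF N d'(1)]]])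
      (use c' d' in \<open>auto simp: coord_inv_coord[OF M c'(1)] coord_inv_coord[OF N d'(1)]\<close>)
  from fun_cong[OF frechet_derivative_at[OF this], of v] show ?thesis by (rule sym)
qed

lemma dmap_id:
  assumes M: "charted M" and c: "c \<in> charts_at M p"
  shows "dmap c c (\<lambda>x. x) p v = v"
proof -
  note c' = charts_atD[OF c]
  have "((coord c \<circ> (\<lambda>x. x) \<circ> coord_inv c) has_derivative (\<lambda>v. v)) (at (coord c p))"
    by (rule has_derivative_transform_within_open[OF has_derivative_ident open_img_of[OF M c'(1)]])
      (use c' in \<open>auto simp: coord_coord_inv[OF M c'(1)]\<close>)
  from fun_cong[OF frechet_derivative_at[OF this], of v] show ?thesis by (rule sym)
qed

text \<open>Smoothness is local, so a different intermediate chart may be used around each point.\<close>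

lemma smooth_map_compose:
  assumes M: "charted M" and N: "charted N" and P: "charted P"
    and f: "smooth_map M N f" and g: "smooth_map N P g"
  shows "smooth_map M P (\<lambda>x. g (f x))"
  unfolding smooth_map_def
proof (intro conjI ballI)
  show cont: "continuous_map (mtop M) (mtop P) (\<lambda>x. g (f x))"
    using continuous_map_compose[OF smooth_map_continuous[OF f] smooth_map_continuous[OF g]]
    by (simp add: o_def)
  fix c e assume c: "c \<in> atlas M" and e: "e \<in> atlas P"
  show "smooth_on (coord c ` {x \<in> dom_of c. g (f x) \<in> dom_of e})
      (coord e \<circ> (\<lambda>x. g (f x)) \<circ> coord_inv c)"
  proof (rule smooth_on_local)
    fix x assume "x \<in> coord c ` {x \<in> dom_of c. g (f x) \<in> dom_of e}"
    then obtain p where p: "p \<in> dom_of c" "g (f p) \<in> dom_of e" "x = coord c p" by auto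
    then have "p \<in> points M" using dom_of_subset[OF M c] by auto
    then obtain d where "d \<in> charts_at N (f p)"
      using charted_ex_chart[OF N smooth_map_in_points[OF f]] by blast
    note d = charts_atD[OF this]
    let ?V = "{y \<in> dom_of d. g y \<in> dom_of e}"
    let ?U = "coord c ` {x \<in> dom_of c. f x \<in> ?V}"
    have V: "openin (mtop N) ?V"
      by (rule openin_preimage_dom[OF N d(1) smooth_map_continuous[OF g] openin_dom_of[OF P e]])
    have U: "open ?U" by (rule open_coord_preimage[OF M c smooth_map_continuous[OF f] V])
    have "smooth_on ?U (\<lambda>x. (coord e \<circ> g \<circ> coord_inv d) ((coord d \<circ> f \<circ> coord_inv c) x))"
    proof (rule smooth_on_compose[OF smooth_map_smooth_on[OF g d(1) e] _ U])
      show "smooth_on ?U (coord d \<circ> f \<circ> coord_inv c)"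
        by (rule smooth_on_subset[OF smooth_map_smooth_on[OF f c d(1)]]) auto
      show "open (coord d ` ?V)" by (rule open_coord_image[OF N d(1) V]) auto
      show "(coord d \<circ> f \<circ> coord_inv c) ` ?U \<subseteq> coord d ` ?V"
        by (auto simp: coord_inv_coord[OF M c])
    qed
    then have "smooth_on ?U (coord e \<circ> (\<lambda>x. g (f x)) \<circ> coord_inv c)"
      by (rule smooth_on_cong[OF _ U])
        (auto simp: coord_inv_coord[OF M c] coord_inv_coord[OF N d(1)])
    then show "\<exists>U. open U \<and> x \<in> U \<and> smooth_on U (coord e \<circ> (\<lambda>x. g (f x)) \<circ> coord_inv c)"
      using U p d by (intro exI[of _ ?U] conjI) auto
  qed
qed

lemma smooth_map_id: "charted M \<Longrightarrow> smooth_map M M (\<lambda>x. x)"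
  unfolding smooth_map_def
proof (intro conjI ballI)
  fix c d assume M: "charted M" and c: "c \<in> atlas M" and d: "d \<in> atlas M"
  have "{x \<in> dom_of c. x \<in> dom_of d} = dom_of c \<inter> dom_of d" by blast
  then show "smooth_on (coord c ` {x \<in> dom_of c. x \<in> dom_of d}) (coord d \<circ> (\<lambda>x. x) \<circ> coord_inv c)"
    using M c d by (simp add: charted_def comp_def)
qed simp

lemma smooth_map_const:
  assumes "charted M" "q \<in> points N"
  shows "smooth_map M N (\<lambda>x. q)"
  unfolding smooth_map_def
proof (intro conjI ballI)
  fix c d assume c: "c \<in> atlas M" and "d \<in> atlas N"
  have "open (coord c ` {x \<in> dom_of c. q \<in> dom_of d})"
    using open_img_of[OF assms(1) c] by (cases "q \<in> dom_of d") auto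
  then show "smooth_on (coord c ` {x \<in> dom_of c. q \<in> dom_of d}) (coord d \<circ> (\<lambda>x. q) \<circ> coord_inv c)"
    unfolding comp_def by (rule smooth_on_const)
qed (use assms in simp)

section \<open>Products\<close>

abbreviation prod_chart :: "('m, 'e) chart \<Rightarrow> ('n, 'f) chart \<Rightarrow> ('m \<times> 'n, 'e \<times> 'f) chart" where
  "prod_chart c d \<equiv> (dom_of c \<times> dom_of d, map_prod (coord c) (coord d))"

lemma atlas_prod_manifold:
  "atlas (prod_manifold M N) = {prod_chart c d | c d. c \<in> atlas M \<and> d \<in> atlas N}"
  by (simp add: prod_manifold_def)

lemma mtop_prod_manifold: "mtop (prod_manifold M N) = prod_topology (mtop M) (mtop N)"
  by (simp add: prod_manifold_def)

lemma coord_inv_prod_chart: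
  assumes "inj_on (coord c) (dom_of c)" "inj_on (coord d) (dom_of d)"
    and "x \<in> img_of c" "y \<in> img_of d"
  shows "coord_inv (prod_chart c d) (x, y) = (coord_inv c x, coord_inv d y)"
  unfolding coord_inv_def
proof (rule inv_into_f_eq)
  show "inj_on (coord (prod_chart c d)) (dom_of (prod_chart c d))"
    using assms(1,2) by (simp add: map_prod_inj_on)
qed (use assms in \<open>simp_all add: f_inv_into_f inv_into_into\<close>)

lemma img_prod_chart: "img_of (prod_chart c d) = img_of c \<times> img_of d"
  by (simp add: map_prod_surj_on)

lemma smooth_on_comp_fst:
  fixes f :: "'a::findim_inner \<Rightarrow> 'b::real_normed_vector" and B :: "'c::findim_inner set"
  assumes "smooth_on A f" "open A" "open B"
  shows "smooth_on (A \<times> B) (\<lambda>z. f (fst z))"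
  by (rule smooth_on_compose[OF assms(1) smooth_on_bounded_linear[OF bounded_linear_fst]])
    (use assms in \<open>auto intro: open_Times\<close>)

lemma smooth_on_comp_snd:
  fixes f :: "'a::findim_inner \<Rightarrow> 'b::real_normed_vector" and B :: "'c::findim_inner set"
  assumes "smooth_on A f" "open A" "open B"
  shows "smooth_on (B \<times> A) (\<lambda>z. f (snd z))"
  by (rule smooth_on_compose[OF assms(1) smooth_on_bounded_linear[OF bounded_linear_snd]])
    (use assms in \<open>auto intro: open_Times\<close>)

lemma charted_prod_manifold:
  assumes M: "charted M" and N: "charted N"
  shows "charted (prod_manifold M N)"
  unfolding charted_def
proof (intro conjI ballI)
  fix k assume "k \<in> atlas (prod_manifold M N)"
  then obtain c d where k: "k = prod_chart c d" and c: "c \<in> atlas M" and d: "d \<in> atlas N"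
    by (auto simp: atlas_prod_manifold)
  obtain c' d' where "homeomorphic_maps (subtopology (mtop M) (dom_of c)) (top_of_set (img_of c)) (coord c) c'"
    and "homeomorphic_maps (subtopology (mtop N) (dom_of d)) (top_of_set (img_of d)) (coord d) d'"
    using homeomorphic_map_coord[OF M c] homeomorphic_map_coord[OF N d] homeomorphic_map_maps by metis
  then have "homeomorphic_maps
      (prod_topology (subtopology (mtop M) (dom_of c)) (subtopology (mtop N) (dom_of d)))
      (prod_topology (top_of_set (img_of c)) (top_of_set (img_of d)))
      (\<lambda>(x, y). (coord c x, coord d y)) (\<lambda>(x, y). (c' x, d' y))"
    by (simp only: homeomorphic_maps_prod) simp
  then have "homeomorphic_map (subtopology (prod_topology (mtop M) (mtop N)) (dom_of c \<times> dom_of d))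
      (top_of_set (img_of c \<times> img_of d)) (\<lambda>(x, y). (coord c x, coord d y))"
    using homeomorphic_map_maps by (auto simp: subtopology_Times)
  moreover have "(\<lambda>(x, y). (coord c x, coord d y)) = map_prod (coord c) (coord d)"
    by auto
  ultimately show "is_chart (mtop (prod_manifold M N)) k"
    using openin_dom_of[OF M c] openin_dom_of[OF N d] open_img_of[OF M c] open_img_of[OF N d]
    unfolding is_chart_def mtop_prod_manifold k img_prod_chart
    by (simp add: openin_prod_Times_iff open_Times)
next
  show "(\<Union>c\<in>atlas (prod_manifold M N). dom_of c) = points (prod_manifold M N)"
  proof -
    have "(\<Union>c\<in>atlas (prod_manifold M N). dom_of c) =
        (\<Union>c\<in>atlas M. dom_of c) \<times> (\<Union>d\<in>atlas N. dom_of d)"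
      unfolding atlas_prod_manifold by force
    then show ?thesis using M N by (simp add: charted_def mtop_prod_manifold)
  qed
next
  fix k l assume "k \<in> atlas (prod_manifold M N)" "l \<in> atlas (prod_manifold M N)"
  then obtain c d c' d' where k: "k = prod_chart c d" and c: "c \<in> atlas M" and d: "d \<in> atlas N"
    and l: "l = prod_chart c' d'" and c': "c' \<in> atlas M" and d': "d' \<in> atlas N"
    by (auto simp: atlas_prod_manifold)
  let ?A = "coord c ` (dom_of c \<inter> dom_of c')" and ?B = "coord d ` (dom_of d \<inter> dom_of d')"
  have A: "open ?A"
    by (intro open_coord_image[OF M c] openin_Int openin_dom_of[OF M] c c') auto
  have B: "open ?B"
    by (intro open_coord_image[OF N d] openin_Int openin_dom_of[OF N] d d') auto
  have AB: "coord k ` (dom_of k \<inter> dom_of l) = ?A \<times> ?B"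
    unfolding k l by (force simp: image_iff)
  have "smooth_on ?A (coord c' \<circ> coord_inv c)" "smooth_on ?B (coord d' \<circ> coord_inv d)"
    using M N c c' d d' by (auto simp: charted_def)
  then have "smooth_on (?A \<times> ?B) (\<lambda>z. ((coord c' \<circ> coord_inv c) (fst z), (coord d' \<circ> coord_inv d) (snd z)))"
    using A B by (intro smooth_on_Pair smooth_on_comp_fst smooth_on_comp_snd open_Times)
  then show "smooth_on (coord k ` (dom_of k \<inter> dom_of l)) (coord l \<circ> coord_inv k)"
    unfolding AB
    by (rule smooth_on_cong[OF _ open_Times[OF A B]])
      (auto simp: k l coord_inv_prod_chart inj_on_coord[OF M c] inj_on_coord[OF N d])
qed

lemma smooth_map_Pair:
  assumes K: "charted K" and M: "charted M" and N: "charted N"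
    and f: "smooth_map K M f" and g: "smooth_map K N g"
  shows "smooth_map K (prod_manifold M N) (\<lambda>x. (f x, g x))"
  unfolding smooth_map_def mtop_prod_manifold
proof (intro conjI ballI)
  show cont: "continuous_map (mtop K) (prod_topology (mtop M) (mtop N)) (\<lambda>x. (f x, g x))"
    using f g by (simp add: continuous_map_paired smooth_map_continuous)
  fix k e assume k: "k \<in> atlas K" and "e \<in> atlas (prod_manifold M N)"
  then obtain c d where e: "e = prod_chart c d" and c: "c \<in> atlas M" and d: "d \<in> atlas N"
    by (auto simp: atlas_prod_manifold)
  let ?S = "coord k ` {x \<in> dom_of k. (f x, g x) \<in> dom_of e}"
  have "open ?S"
    by (rule open_coord_preimage[OF K k cont])
      (simp add: e openin_prod_Times_iff openin_dom_of[OF M c] openin_dom_of[OF N d])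
  moreover have "smooth_on ?S (coord c \<circ> f \<circ> coord_inv k)"
    by (rule smooth_on_subset[OF smooth_map_smooth_on[OF f k c]]) (auto simp: e)
  moreover have "smooth_on ?S (coord d \<circ> g \<circ> coord_inv k)"
    by (rule smooth_on_subset[OF smooth_map_smooth_on[OF g k d]]) (auto simp: e)
  ultimately have "smooth_on ?S (\<lambda>x. ((coord c \<circ> f \<circ> coord_inv k) x, (coord d \<circ> g \<circ> coord_inv k) x))"
    by (intro smooth_on_Pair)
  then show "smooth_on ?S (coord e \<circ> (\<lambda>x. (f x, g x)) \<circ> coord_inv k)"
    by (simp add: e comp_def)
qed

lemma smooth_map_fst:
  assumes M: "charted M" and N: "charted N"
  shows "smooth_map (prod_manifold M N) M fst"
  unfolding smooth_map_def mtop_prod_manifold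
proof (intro conjI ballI)
  fix k e assume "k \<in> atlas (prod_manifold M N)" and e: "e \<in> atlas M"
  then obtain c d where k: "k = prod_chart c d" and c: "c \<in> atlas M" and d: "d \<in> atlas N"
    by (auto simp: atlas_prod_manifold)
  let ?A = "coord c ` (dom_of c \<inter> dom_of e)"
  have A: "open ?A"
    by (intro open_coord_image[OF M c] openin_Int openin_dom_of[OF M] c e) auto
  note B = open_img_of[OF N d]
  have S: "coord k ` {x \<in> dom_of k. fst x \<in> dom_of e} = ?A \<times> img_of d"
    unfolding k by (force simp: image_iff)
  have "smooth_on ?A (coord e \<circ> coord_inv c)" using M c e by (auto simp: charted_def)
  then have "smooth_on (?A \<times> img_of d) (\<lambda>z. (coord e \<circ> coord_inv c) (fst z))"
    using A B by (intro smooth_on_comp_fst)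
  then show "smooth_on (coord k ` {x \<in> dom_of k. fst x \<in> dom_of e}) (coord e \<circ> fst \<circ> coord_inv k)"
    unfolding S
    by (rule smooth_on_cong[OF _ open_Times[OF A B]])
      (auto simp: k coord_inv_prod_chart inj_on_coord[OF M c] inj_on_coord[OF N d])
qed (simp add: continuous_map_fst)

lemma charts_at_prod:
  "c \<in> charts_at M p \<Longrightarrow> d \<in> charts_at N q \<Longrightarrow> prod_chart c d \<in> charts_at (prod_manifold M N) (p, q)"
  unfolding charts_at_def atlas_prod_manifold
  by (intro CollectI conjI exI[of _ c] exI[of _ d]) auto

lemma dmap_fst_slot:
  assumes M: "charted M" and N: "charted N" and F: "smooth_map (prod_manifold M N) P F"
    and c: "c \<in> charts_at M p" and d: "d \<in> charts_at N q" and e: "e \<in> charts_at P (F (p, q))"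
  shows "dmap c e (\<lambda>x. F (x, q)) p v = dmap (prod_chart c d) e F (p, q) (v, 0)"
proof -
  note c' = charts_atD[OF c] and d' = charts_atD[OF d]
  have "((\<lambda>x. (coord e \<circ> F \<circ> coord_inv (prod_chart c d)) (x, coord d q)) has_derivative
      (\<lambda>v. dmap (prod_chart c d) e F (p, q) (v, 0))) (at (coord c p))"
    by (rule has_derivative_compose[OF has_derivative_Pair[OF has_derivative_ident has_derivative_const]])
      (use smooth_map_has_derivative[OF F charts_at_prod[OF c d] e] in \<open>simp add: comp_def\<close>)
  then have "((coord e \<circ> (\<lambda>x. F (x, q)) \<circ> coord_inv c) has_derivative
      (\<lambda>v. dmap (prod_chart c d) e F (p, q) (v, 0))) (at (coord c p))"
    by (rule has_derivative_transform_within_open[OF _ open_img_of[OF M c'(1)]])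
      (use c' d' in \<open>auto simp: coord_inv_prod_chart inj_on_coord[OF M] inj_on_coord[OF N]
          coord_inv_coord[OF N d'(1)]\<close>)
  from fun_cong[OF frechet_derivative_at[OF this], of v] show ?thesis by (rule sym)
qed

lemma dmap_snd_slot:
  assumes M: "charted M" and N: "charted N" and F: "smooth_map (prod_manifold M N) P F"
    and c: "c \<in> charts_at M p" and d: "d \<in> charts_at N q" and e: "e \<in> charts_at P (F (p, q))"
  shows "dmap d e (\<lambda>y. F (p, y)) q v = dmap (prod_chart c d) e F (p, q) (0, v)"
proof -
  note c' = charts_atD[OF c] and d' = charts_atD[OF d]
  have "((\<lambda>y. (coord e \<circ> F \<circ> coord_inv (prod_chart c d)) (coord c p, y)) has_derivative
      (\<lambda>v. dmap (prod_chart c d) e F (p, q) (0, v))) (at (coord d q))"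
    by (rule has_derivative_compose[OF has_derivative_Pair[OF has_derivative_const has_derivative_ident]])
      (use smooth_map_has_derivative[OF F charts_at_prod[OF c d] e] in \<open>simp add: comp_def\<close>)
  then have "((coord e \<circ> (\<lambda>y. F (p, y)) \<circ> coord_inv d) has_derivative
      (\<lambda>v. dmap (prod_chart c d) e F (p, q) (0, v))) (at (coord d q))"
    by (rule has_derivative_transform_within_open[OF _ open_img_of[OF N d'(1)]])
      (use c' d' in \<open>auto simp: coord_inv_prod_chart inj_on_coord[OF M] inj_on_coord[OF N]
          coord_inv_coord[OF M c'(1)]\<close>)
  from fun_cong[OF frechet_derivative_at[OF this], of v] show ?thesis by (rule sym)
qed

section \<open>Curves\<close>

lemma coord_inv_real_line: "coord_inv (UNIV, \<lambda>t. t) = (\<lambda>t::real. t)"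
  by (rule ext) (simp add: coord_inv_def inv_into_f_eq)

lemma smooth_map_real_line:
  "smooth_map real_line N \<gamma> \<longleftrightarrow> continuous_map euclidean (mtop N) \<gamma> \<and>
     (\<forall>d\<in>atlas N. smooth_on {t. \<gamma> t \<in> dom_of d} (coord d \<circ> \<gamma>))"
  by (simp add: smooth_map_def real_line_def coord_inv_real_line comp_def)

text \<open>The curve is only required to stay in the chart near \<open>t\<close>, because solutions of
  differential equations are first known on a short interval.\<close>

lemma has_vector_derivative_compose_smooth_map:
  fixes \<gamma> :: "real \<Rightarrow> 'm"
  assumes M: "charted M" and f: "smooth_map M N f"
    and \<gamma>: "eventually (\<lambda>s. \<gamma> s \<in> dom_of c) (nhds t)"
    and c: "c \<in> charts_at M (\<gamma> t)" and d: "d \<in> charts_at N (f (\<gamma> t))"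
    and v: "((coord c \<circ> \<gamma>) has_vector_derivative v) (at t)"
  shows "((\<lambda>s. coord d (f (\<gamma> s))) has_vector_derivative dmap c d f (\<gamma> t) v) (at t)"
proof -
  note c' = charts_atD[OF c]
  have "((\<lambda>s. (coord d \<circ> f \<circ> coord_inv c) ((coord c \<circ> \<gamma>) s)) has_derivative
      (\<lambda>h. dmap c d f (\<gamma> t) (h *\<^sub>R v))) (at t)"
    by (rule has_derivative_compose[OF v[unfolded has_vector_derivative_def]])
      (use smooth_map_has_derivative[OF f c d] in \<open>simp add: comp_def\<close>)
  also have "(\<lambda>h. dmap c d f (\<gamma> t) (h *\<^sub>R v)) = (\<lambda>h. h *\<^sub>R dmap c d f (\<gamma> t) v)"
    by (simp add: linear_scale[OF linear_dmap[OF f c d]])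
  finally have *: "((\<lambda>s. (coord d \<circ> f \<circ> coord_inv c) ((coord c \<circ> \<gamma>) s)) has_derivative
      (\<lambda>h. h *\<^sub>R dmap c d f (\<gamma> t) v)) (at t)" .
  obtain U where U: "open U" "t \<in> U" "\<And>s. s \<in> U \<Longrightarrow> \<gamma> s \<in> dom_of c"
    using \<gamma> by (auto simp: eventually_nhds)
  show ?thesis
    unfolding has_vector_derivative_def
    by (rule has_derivative_transform_within_open[OF * U(1,2)])
      (use U(3) in \<open>simp add: coord_inv_coord[OF M c'(1)]\<close>)
qed

text \<open>In a chart, a curve with zero velocity is locally constant, and \<open>\<real>\<close> is connected.\<close>

lemma curve_constant:
  fixes \<alpha> :: "real \<Rightarrow> 'm"
  assumes N: "charted N" and \<alpha>: "smooth_map real_line N \<alpha>"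
    and 0: "\<And>t d. d \<in> charts_at N (\<alpha> t) \<Longrightarrow> ((coord d \<circ> \<alpha>) has_vector_derivative 0) (at t)"
  shows "\<alpha> s = \<alpha> t"
proof -
  have cont: "continuous_map euclidean (mtop N) \<alpha>" using \<alpha> by (simp add: smooth_map_real_line)
  have "\<alpha> constant_on UNIV"
  proof (rule locally_constant_imp_constant)
    fix a :: real
    have "\<alpha> a \<in> points N" using cont continuous_map_image_subset_topspace by fastforce
    then obtain d where d: "d \<in> charts_at N (\<alpha> a)" using charted_ex_chart[OF N] by blast
    note d' = charts_atD[OF d]
    have "open {s. \<alpha> s \<in> dom_of d}"
      using openin_continuous_map_preimage[OF cont openin_dom_of[OF N d'(1)]] by simp
    then obtain \<epsilon> where \<epsilon>: "\<epsilon> > 0" "ball a \<epsilon> \<subseteq> {s. \<alpha> s \<in> dom_of d}"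
      using d'(2) by (auto simp: open_contains_ball)
    have const: "\<alpha> s = \<alpha> a" if s: "s \<in> ball a \<epsilon>" for s
    proof -
      have "norm ((coord d \<circ> \<alpha>) s - (coord d \<circ> \<alpha>) a) \<le> 0 * \<bar>s - a\<bar>"
      proof (rule vector_derivative_bound[where I = "ball a \<epsilon>" and f' = "\<lambda>_. 0"])
        show "((coord d \<circ> \<alpha>) has_vector_derivative 0) (at t within ball a \<epsilon>)" if "t \<in> ball a \<epsilon>" for t
          by (rule has_vector_derivative_at_within[OF 0]) (use that \<epsilon>(2) d'(1) in \<open>auto simp: charts_at_def\<close>)
      qed (use s \<epsilon> in auto)
      then have "coord d (\<alpha> s) = coord d (\<alpha> a)" by simp
      moreover have "\<alpha> s \<in> dom_of d" using s \<epsilon>(2) by auto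
      ultimately show ?thesis using d'(2) inj_on_coord[OF N d'(1)] by (auto dest: inj_onD)
    qed
    show "\<exists>T. openin (top_of_set UNIV) T \<and> a \<in> T \<and> (\<forall>x\<in>T. \<alpha> x = \<alpha> a)"
      by (intro exI[of _ "ball a \<epsilon>"] conjI ballI const) (use \<epsilon>(1) in auto)
  qed simp
  then show ?thesis by (metis constant_on_def UNIV_I)
qed

section \<open>The adjoint representation\<close>

text \<open>Applied to multiplication and to conjugation, this says that left-invariant vector fields and the
  adjoint representation are smooth.\<close>

lemma smooth_on_dmap_snd_slot:
  assumes M: "charted M" and N: "charted N" and P: "charted P"
    and F: "smooth_map (prod_manifold M N) P F"
    and c: "c \<in> atlas M" and d: "d \<in> charts_at N q" and e: "e \<in> atlas P"
  shows "smooth_on (coord c ` {x \<in> dom_of c. F (x, q) \<in> dom_of e})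
    (\<lambda>x. dmap d e (\<lambda>y. F (coord_inv c x, y)) q v)"
proof -
  note d' = charts_atD[OF d]
  let ?k = "prod_chart c d"
  let ?S = "coord c ` {x \<in> dom_of c. F (x, q) \<in> dom_of e}"
  let ?W = "coord ?k ` {z \<in> dom_of ?k. F z \<in> dom_of e}"
  let ?m = "coord e \<circ> F \<circ> coord_inv ?k"
  have k: "?k \<in> atlas (prod_manifold M N)" using c d'(1) unfolding atlas_prod_manifold by blast
  have slice: "smooth_map M (prod_manifold M N) (\<lambda>x. (x, q))"
    using charts_at_points[OF N d] by (intro smooth_map_Pair smooth_map_id smooth_map_const M N)
  have S: "open ?S"
    by (rule open_coord_preimage[OF M c _ openin_dom_of[OF P e]])
      (rule smooth_map_continuous[OF smooth_map_compose[OF M charted_prod_manifold[OF M N] P slice F]])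
  have W: "open ?W"
    by (rule open_coord_preimage[OF charted_prod_manifold[OF M N] k smooth_map_continuous[OF F]
          openin_dom_of[OF P e]])
  have "smooth_on ?W (\<lambda>z. frechet_derivative ?m (at z) (0, v))"
    by (rule smooth_on_frechet_derivative[OF smooth_map_smooth_on[OF F k e]])
  moreover have "smooth_on ?S (\<lambda>x. (x, coord d q))"
    by (intro smooth_on_Pair smooth_on_const smooth_on_bounded_linear bounded_linear_ident S)
  moreover have "(\<lambda>x. (x, coord d q)) ` ?S \<subseteq> ?W"
  proof
    fix z assume "z \<in> (\<lambda>x. (x, coord d q)) ` ?S"
    then obtain x where "x \<in> dom_of c" "F (x, q) \<in> dom_of e" "z = (coord c x, coord d q)" by blast
    then show "z \<in> ?W" using d'(2) by (intro image_eqI[of _ _ "(x, q)"]) auto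
  qed
  ultimately have "smooth_on ?S (\<lambda>x. frechet_derivative ?m (at (x, coord d q)) (0, v))"
    by (rule smooth_on_compose[OF _ _ S W])
  then show ?thesis
  proof (rule smooth_on_cong[OF _ S])
    fix x assume "x \<in> ?S"
    then obtain p where p: "p \<in> dom_of c" "F (p, q) \<in> dom_of e" "x = coord c p" by blast
    have cp: "c \<in> charts_at M p" and ep: "e \<in> charts_at P (F (p, q))"
      using c e p by (auto simp: charts_at_def)
    show "frechet_derivative ?m (at (x, coord d q)) (0, v) =
        dmap d e (\<lambda>y. F (coord_inv c x, y)) q v"
      using dmap_snd_slot[OF M N F cp d ep] coord_inv_coord[OF M c p(1)] p(3) by simp
  qed
qed

locale lie_group_context =
  fixes G :: "('g, 'z) monoid_scheme" (structure) and L :: "('g, 'f::findim_inner) manifold"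
  assumes lie_group: "lie_group G L"
begin

sublocale group G
  using lie_group by (simp add: lie_group_def)

text \<open>All computations at the identity use this chart, which is also the one that
  \<^const>\<open>differential\<close> picks there. It identifies the Lie algebra with the model space.\<close>

definition c0 :: "('g, 'f) chart" where "c0 = (SOME c. c \<in> charts_at L \<one>)"

definition x0 :: 'f where "x0 = coord c0 \<one>"

abbreviation mul :: "'g \<times> 'g \<Rightarrow> 'g" where "mul \<equiv> (\<lambda>(x, y). x \<otimes> y)"

abbreviation conj2 :: "'g \<times> 'g \<Rightarrow> 'g" where "conj2 \<equiv> (\<lambda>z. fst z \<otimes> snd z \<otimes> inv (fst z))"

lemma charted_L: "charted L"
  using lie_group by (simp add: lie_group_def smooth_manifold_imp_charted)

lemma points_L: "points L = carrier G"
  using lie_group by (simp add: lie_group_def)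

lemma smooth_map_mul: "smooth_map (prod_manifold L L) L mul"
  and smooth_map_inv: "smooth_map L L (\<lambda>x. inv x)"
  using lie_group by (simp_all add: lie_group_def)

lemma c0_at_one: "c0 \<in> charts_at L \<one>"
  unfolding c0_def by (rule some_chart_at[OF charted_L]) (simp add: points_L)

lemmas c0_atlas = charts_atD(1)[OF c0_at_one]
lemmas one_in_c0 = charts_atD(2)[OF c0_at_one]

lemma c0_at: "h \<in> dom_of c0 \<Longrightarrow> c0 \<in> charts_at L h"
  using c0_atlas by (simp add: charts_at_def)

lemma dom_c0_carrier: "h \<in> dom_of c0 \<Longrightarrow> h \<in> carrier G"
  using dom_of_subset[OF charted_L c0_atlas] points_L by auto

lemma coord_inv_c0_carrier: "x \<in> img_of c0 \<Longrightarrow> coord_inv c0 x \<in> carrier G"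
  by (rule dom_c0_carrier[OF coord_inv_in_dom[OF charted_L c0_atlas]])

lemma coord_inv_x0: "coord_inv c0 x0 = \<one>"
  unfolding x0_def by (rule coord_inv_coord[OF charted_L c0_atlas one_in_c0])

lemma x0_img: "x0 \<in> img_of c0"
  unfolding x0_def using one_in_c0 by simp

lemma open_img_c0: "open (img_of c0)"
  by (rule open_img_of[OF charted_L c0_atlas])

lemma smooth_map_lmult: "g \<in> carrier G \<Longrightarrow> smooth_map L L (\<lambda>x. g \<otimes> x)"
  using smooth_map_compose[OF charted_L charted_prod_manifold[OF charted_L charted_L] charted_L
      smooth_map_Pair[OF charted_L charted_L charted_L smooth_map_const[OF charted_L] smooth_map_id[OF charted_L]]
      smooth_map_mul, of g]
  by (simp add: points_L)

lemma smooth_map_rmult: "g \<in> carrier G \<Longrightarrow> smooth_map L L (\<lambda>x. x \<otimes> g)"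
  using smooth_map_compose[OF charted_L charted_prod_manifold[OF charted_L charted_L] charted_L
      smooth_map_Pair[OF charted_L charted_L charted_L smooth_map_id[OF charted_L] smooth_map_const[OF charted_L]]
      smooth_map_mul, of g]
  by (simp add: points_L)

lemma smooth_map_conj: "g \<in> carrier G \<Longrightarrow> smooth_map L L (\<lambda>x. g \<otimes> x \<otimes> inv g)"
  by (rule smooth_map_compose[OF charted_L charted_L charted_L smooth_map_lmult smooth_map_rmult]) simp_all

lemma smooth_map_conj2: "smooth_map (prod_manifold L L) L conj2"
proof -
  note LL = charted_prod_manifold[OF charted_L charted_L]
  have "smooth_map (prod_manifold L L) L (\<lambda>z. inv (fst z))"
    by (rule smooth_map_compose[OF LL charted_L charted_L smooth_map_fst[OF charted_L charted_L] smooth_map_inv])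
  from smooth_map_compose[OF LL LL charted_L
      smooth_map_Pair[OF LL charted_L charted_L smooth_map_mul this] smooth_map_mul]
  show ?thesis by (simp add: case_prod_unfold)
qed

text \<open>In the chart, \<open>lfield Y\<close> is the left-invariant vector field with value \<open>Y\<close> at the identity.\<close>

definition lfield :: "'f \<Rightarrow> 'f \<Rightarrow> 'f" where
  "lfield Y x = dmap c0 c0 (\<lambda>h. coord_inv c0 x \<otimes> h) \<one> Y"

text \<open>The differential of conjugation by \<open>g\<close> at the identity.\<close>

definition Ad :: "'g \<Rightarrow> 'f \<Rightarrow> 'f" where
  "Ad g Y = dmap c0 c0 (\<lambda>h. g \<otimes> h \<otimes> inv g) \<one> Y"

text \<open>The bracket at the identity of the left-invariant vector fields, in coordinates.\<close>

definition bracket :: "'f \<Rightarrow> 'f \<Rightarrow> 'f" where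
  "bracket X Y = frechet_derivative (lfield Y) (at x0) X - frechet_derivative (lfield X) (at x0) Y"

lemma smooth_on_lfield: "smooth_on (img_of c0) (lfield Y)"
proof -
  have "{x \<in> dom_of c0. mul (x, \<one>) \<in> dom_of c0} = dom_of c0"
    by (auto simp: dom_c0_carrier)
  then show ?thesis
    using smooth_on_dmap_snd_slot[OF charted_L charted_L charted_L smooth_map_mul c0_atlas c0_at_one c0_atlas, of Y]
    by (simp add: lfield_def[abs_def])
qed

lemma smooth_on_Ad: "smooth_on (img_of c0) (\<lambda>x. Ad (coord_inv c0 x) Y)"
proof -
  have "{x \<in> dom_of c0. conj2 (x, \<one>) \<in> dom_of c0} = dom_of c0"
    using one_in_c0 by (auto simp: dom_c0_carrier)
  then show ?thesis
    using smooth_on_dmap_snd_slot[OF charted_L charted_L charted_L smooth_map_conj2 c0_atlas c0_at_one c0_atlas, of Y]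
    by (simp add: Ad_def)
qed

lemma dmap_one_id:
  assumes "\<And>h. h \<in> dom_of c0 \<Longrightarrow> f h = h"
  shows "dmap c0 c0 f \<one> Y = Y"
  using dmap_cong[OF charted_L c0_at_one, of f "\<lambda>h. h" c0] assms dmap_id[OF charted_L c0_at_one]
  by simp

lemma lfield_x0: "lfield Y x0 = Y"
  unfolding lfield_def coord_inv_x0 by (rule dmap_one_id) (simp add: dom_c0_carrier)

text \<open>Left translation by \<open>g\<close> preserves the left-invariant field, because \<open>g (h x) = (g h) x\<close>. The
  target chart is arbitrary.\<close>

lemma dmap_lmult_lfield:
  assumes g: "g \<in> carrier G" and h: "h \<in> dom_of c0" and gh: "d \<in> charts_at L (g \<otimes> h)"
  shows "dmap c0 d (\<lambda>x. g \<otimes> x) h (lfield Y (coord c0 h)) = dmap c0 d (\<lambda>x. (g \<otimes> h) \<otimes> x) \<one> Y"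
proof -
  have hG: "h \<in> carrier G" by (rule dom_c0_carrier[OF h])
  have "dmap c0 d (\<lambda>x. g \<otimes> (h \<otimes> x)) \<one> Y =
      dmap c0 d (\<lambda>x. g \<otimes> x) (h \<otimes> \<one>) (dmap c0 c0 (\<lambda>x. h \<otimes> x) \<one> Y)"
    by (rule dmap_compose[OF charted_L charted_L smooth_map_lmult[OF hG] smooth_map_lmult[OF g] c0_at_one])
      (use h gh hG c0_at[OF h] in simp_all)
  moreover have "dmap c0 d (\<lambda>x. (g \<otimes> h) \<otimes> x) \<one> = dmap c0 d (\<lambda>x. g \<otimes> (h \<otimes> x)) \<one>"
    by (rule dmap_cong[OF charted_L c0_at_one]) (use g hG dom_c0_carrier in \<open>simp add: m_assoc\<close>)
  ultimately show ?thesis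
    using hG by (simp add: lfield_def coord_inv_coord[OF charted_L c0_atlas h])
qed

lemma linear_Ad: "g \<in> carrier G \<Longrightarrow> linear (Ad g)"
  unfolding Ad_def
  by (rule linear_dmap[OF smooth_map_conj c0_at_one]) (simp_all add: c0_at_one)

lemma Ad_mult:
  assumes g: "g \<in> carrier G" and h: "h \<in> carrier G"
  shows "Ad (g \<otimes> h) Y = Ad g (Ad h Y)"
proof -
  have "dmap c0 c0 (\<lambda>x. g \<otimes> (h \<otimes> x \<otimes> inv h) \<otimes> inv g) \<one> Y =
      dmap c0 c0 (\<lambda>x. g \<otimes> x \<otimes> inv g) (h \<otimes> \<one> \<otimes> inv h) (dmap c0 c0 (\<lambda>x. h \<otimes> x \<otimes> inv h) \<one> Y)"
    by (rule dmap_compose[OF charted_L charted_L smooth_map_conj[OF h] smooth_map_conj[OF g] c0_at_one])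
      (use g h c0_at_one in simp_all)
  moreover have "dmap c0 c0 (\<lambda>x. (g \<otimes> h) \<otimes> x \<otimes> inv (g \<otimes> h)) \<one> =
      dmap c0 c0 (\<lambda>x. g \<otimes> (h \<otimes> x \<otimes> inv h) \<otimes> inv g) \<one>"
    by (rule dmap_cong[OF charted_L c0_at_one])
      (use g h dom_c0_carrier in \<open>simp add: m_assoc inv_mult_group\<close>)
  ultimately show ?thesis using h by (simp add: Ad_def)
qed

lemma Ad_one: "Ad \<one> Y = Y"
  unfolding Ad_def by (rule dmap_one_id) (simp add: dom_c0_carrier)

text \<open>Conjugation by \<open>g\<close> followed by right multiplication with \<open>g\<close> is left multiplication with \<open>g\<close>.
  This determines \<open>Ad\<close> by the multiplication alone, without its inverse.\<close>

lemma dmap_rmult_Ad: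
  assumes x: "x \<in> img_of c0"
  shows "dmap c0 c0 (\<lambda>h. h \<otimes> coord_inv c0 x) \<one> (Ad (coord_inv c0 x) Y) = lfield Y x"
proof -
  let ?g = "coord_inv c0 x"
  have gd: "?g \<in> dom_of c0" by (rule coord_inv_in_dom[OF charted_L c0_atlas x])
  then have g: "?g \<in> carrier G" by (rule dom_c0_carrier)
  have "dmap c0 c0 (\<lambda>h. (?g \<otimes> h \<otimes> inv ?g) \<otimes> ?g) \<one> Y =
      dmap c0 c0 (\<lambda>h. h \<otimes> ?g) (?g \<otimes> \<one> \<otimes> inv ?g) (dmap c0 c0 (\<lambda>h. ?g \<otimes> h \<otimes> inv ?g) \<one> Y)"
    by (rule dmap_compose[OF charted_L charted_L smooth_map_conj[OF g] smooth_map_rmult[OF g] c0_at_one])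
      (use g c0_at_one c0_at[OF gd] in simp_all)
  moreover have "dmap c0 c0 (\<lambda>h. (?g \<otimes> h \<otimes> inv ?g) \<otimes> ?g) \<one> = dmap c0 c0 (\<lambda>h. ?g \<otimes> h) \<one>"
    by (rule dmap_cong[OF charted_L c0_at_one]) (use g dom_c0_carrier in \<open>simp add: m_assoc\<close>)
  ultimately show ?thesis using g by (simp add: lfield_def Ad_def)
qed

text \<open>Let \<open>m\<close> be the multiplication in the chart. Differentiating the previous identity
  \<open>D\<^sub>1 m (x0, x) (Ad x Y) = D\<^sub>2 m (x, x0) Y\<close> in \<open>x\<close> at \<open>x0\<close> in the direction \<open>X\<close> gives
  \<open>D\<^sub>2 D\<^sub>1 m (X, Y) + D (Ad \<cdot> Y) X = D\<^sub>1 D\<^sub>2 m (X, Y)\<close>, and by the symmetry of second derivatives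
  the first term is the derivative of the left-invariant field of \<open>X\<close> in the direction \<open>Y\<close>.\<close>

theorem has_derivative_Ad:
  "((\<lambda>x. Ad (coord_inv c0 x) Y) has_derivative (\<lambda>X. bracket X Y)) (at x0)"
proof -
  let ?k = "prod_chart c0 c0"
  let ?m = "coord c0 \<circ> mul \<circ> coord_inv ?k"
  let ?W = "coord ?k ` {z \<in> dom_of ?k. mul z \<in> dom_of c0}"
  note LL = charted_prod_manifold[OF charted_L charted_L]
  have k: "?k \<in> charts_at (prod_manifold L L) (\<one>, \<one>)"
    by (rule charts_at_prod[OF c0_at_one c0_at_one])
  have W: "open ?W"
    by (rule open_coord_preimage[OF LL charts_atD(1)[OF k] smooth_map_continuous[OF smooth_map_mul]
          openin_dom_of[OF charted_L c0_atlas]])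
  have x0W: "(x0, x0) \<in> ?W"
    using one_in_c0 by (intro image_eqI[of _ _ "(\<one>, \<one>)"]) (auto simp: x0_def)
  have sm: "smooth_on ?W ?m"
    by (rule smooth_map_smooth_on[OF smooth_map_mul charts_atD(1)[OF k] c0_atlas])
  have D2: "((\<lambda>z. frechet_derivative ?m (at z) w) has_derivative
      frechet_derivative (\<lambda>z. frechet_derivative ?m (at z) w) (at (x0, x0))) (at (x0, x0))" for w
    by (rule smooth_on_has_derivative[OF smooth_on_frechet_derivative[OF sm] x0W])
  let ?D2 = "\<lambda>w. frechet_derivative (\<lambda>z. frechet_derivative ?m (at z) w) (at (x0, x0))"
  \<comment> \<open>the differential of right multiplication by \<open>x\<close> at the identity, which is the identity map for \<open>x = x0\<close>\<close>
  define R where "R x Z = frechet_derivative ?m (at (x0, x)) (Z, 0)" for x Z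
  have R: "R x Z = dmap c0 c0 (\<lambda>h. h \<otimes> coord_inv c0 x) \<one> Z" if x: "x \<in> img_of c0" for x Z
  proof -
    have d: "coord_inv c0 x \<in> dom_of c0" by (rule coord_inv_in_dom[OF charted_L c0_atlas x])
    then have "c0 \<in> charts_at L (mul (\<one>, coord_inv c0 x))" using dom_c0_carrier c0_at by simp
    from dmap_fst_slot[OF charted_L charted_L smooth_map_mul c0_at_one c0_at[OF d] this, of Z]
    show ?thesis by (simp add: R_def x0_def coord_coord_inv[OF charted_L c0_atlas x])
  qed
  have R_deriv: "((\<lambda>x. R x Z) has_derivative (\<lambda>X. ?D2 (Z, 0) (0, X))) (at x0)" for Z
    unfolding R_def
    by (rule has_derivative_compose[OF has_derivative_Pair[OF has_derivative_const has_derivative_ident]])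
      (rule D2)
  have lf: "lfield X x = frechet_derivative ?m (at (x, x0)) (0, X)" if x: "x \<in> img_of c0" for x X
  proof -
    have d: "coord_inv c0 x \<in> dom_of c0" by (rule coord_inv_in_dom[OF charted_L c0_atlas x])
    then have "c0 \<in> charts_at L (mul (coord_inv c0 x, \<one>))" using dom_c0_carrier c0_at by simp
    from dmap_snd_slot[OF charted_L charted_L smooth_map_mul c0_at[OF d] c0_at_one this, of X]
    show ?thesis by (simp add: lfield_def x0_def coord_coord_inv[OF charted_L c0_atlas x])
  qed
  have lf_deriv: "frechet_derivative (lfield X) (at x0) Y = ?D2 (0, X) (Y, 0)" for X Y
  proof -
    have "((\<lambda>x. frechet_derivative ?m (at (x, x0)) (0, X)) has_derivative (\<lambda>Y. ?D2 (0, X) (Y, 0))) (at x0)"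
      by (rule has_derivative_compose[OF has_derivative_Pair[OF has_derivative_ident has_derivative_const]])
        (rule D2)
    then have "(lfield X has_derivative (\<lambda>Y. ?D2 (0, X) (Y, 0))) (at x0)"
      by (rule has_derivative_transform_within_open[OF _ open_img_c0 x0_img]) (simp add: lf)
    from fun_cong[OF frechet_derivative_at[OF this], of Y] show ?thesis by (rule sym)
  qed
  have symm: "?D2 (Z, 0) (0, X) = ?D2 (0, X) (Z, 0)" for X Z
    by (rule second_derivative_symmetric[OF W _ x0W]) (use sm in \<open>simp only: smooth_on_def\<close>)
  let ?Z = "\<lambda>x. Ad (coord_inv c0 x) Y"
  let ?Z' = "frechet_derivative ?Z (at x0)"
  have Z: "(?Z has_derivative ?Z') (at x0)"
    by (rule smooth_on_has_derivative[OF smooth_on_Ad x0_img])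
  have Zx0: "?Z x0 = Y" by (simp add: coord_inv_x0 Ad_one)
  have linR: "linear (R x)" if x: "x \<in> img_of c0" for x
  proof -
    have d: "coord_inv c0 x \<in> dom_of c0" by (rule coord_inv_in_dom[OF charted_L c0_atlas x])
    have "R x = dmap c0 c0 (\<lambda>h. h \<otimes> coord_inv c0 x) \<one>" using R[OF x] by (rule ext)
    then show ?thesis
      using linear_dmap[OF smooth_map_rmult[OF dom_c0_carrier[OF d]] c0_at_one, of c0]
        dom_c0_carrier[OF d] c0_at[OF d] by simp
  qed
  \<comment> \<open>product rule for \<open>R x (Ad x Y)\<close>, where both the linear map and its argument vary\<close>
  have "((\<lambda>x. \<Sum>u\<in>onb. inner (?Z x) u *\<^sub>R R x u) has_derivative
      (\<lambda>X. \<Sum>u\<in>onb. inner (?Z x0) u *\<^sub>R ?D2 (u, 0) (0, X) + inner (?Z' X) u *\<^sub>R R x0 u)) (at x0)"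
    by (intro has_derivative_sum has_derivative_scaleR has_derivative_inner_left Z R_deriv)
  then have "(lfield Y has_derivative
      (\<lambda>X. \<Sum>u\<in>onb. inner (?Z x0) u *\<^sub>R ?D2 (u, 0) (0, X) + inner (?Z' X) u *\<^sub>R R x0 u)) (at x0)"
  proof (rule has_derivative_transform_within_open[OF _ open_img_c0 x0_img])
    fix x assume x: "x \<in> img_of c0"
    show "(\<Sum>u\<in>onb. inner (?Z x) u *\<^sub>R R x u) = lfield Y x"
      using dmap_rmult_Ad[OF x, of Y] R[OF x, of "?Z x"] linear_onb_expansion[OF linR[OF x], of "?Z x"] by simp
  qed
  note lfY = frechet_derivative_at[OF this]
  have "bracket X Y = ?Z' X" for X
  proof -
    have "R x0 Z = Z" for Z
      unfolding R[OF x0_img] coord_inv_x0 by (rule dmap_one_id) (simp add: dom_c0_carrier)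
    then have 1: "(\<Sum>u\<in>onb. inner (?Z' X) u *\<^sub>R R x0 u) = ?Z' X" by (simp add: onb_expansion)
    have "?D2 (0, X) (Y, 0) = (\<Sum>u\<in>onb. inner Y u *\<^sub>R ?D2 (0, X) (u, 0))"
    proof (rule linear_onb_expansion)
      have "linear (?D2 (0, X) \<circ> (\<lambda>Z. (Z, 0)))"
        by (rule linear_compose[OF _ has_derivative_linear[OF D2]]) (simp add: linearI)
      then show "linear (\<lambda>Y. ?D2 (0, X) (Y, 0))" by (simp only: comp_def)
    qed
    then have 2: "(\<Sum>u\<in>onb. inner Y u *\<^sub>R ?D2 (u, 0) (0, X)) = ?D2 (0, X) (Y, 0)"
      by (simp add: symm)
    have "frechet_derivative (lfield Y) (at x0) X = ?D2 (0, X) (Y, 0) + ?Z' X"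
      using fun_cong[OF lfY, of X] 1 2 by (simp only: Zx0 sum.distrib)
    then show ?thesis by (simp add: bracket_def lf_deriv[of X Y])
  qed
  then show ?thesis using Z by simp
qed

lemma ad_eq_bracket:
  "ad G L X Y c0 = bracket (X c0) (Y c0)"
proof -
  have liv: "left_invariant_vf G L Z (coord_inv c0 x) c0 = lfield (Z c0) x" if x: "x \<in> img_of c0" for Z x
    using c0_at[OF coord_inv_in_dom[OF charted_L c0_atlas x]] coord_inv_c0_carrier[OF x]
    by (simp add: left_invariant_vf_def differential_def lfield_def c0_def[symmetric] Let_def)
  have D: "frechet_derivative (\<lambda>x. left_invariant_vf G L Z (coord_inv c0 x) c0) (at x0) =
      frechet_derivative (lfield (Z c0)) (at x0)" for Z
    by (rule frechet_derivative_cong_open[OF open_img_c0 x0_img liv])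
  have "left_invariant_vf G L Z \<one> c0 = Z c0" for Z
    using liv[OF x0_img, of Z] by (simp add: coord_inv_x0 lfield_x0)
  then show ?thesis
    using c0_at_one D by (simp add: ad_def vf_bracket_def bracket_def flip: x0_def)
qed

end

section \<open>One-parameter subgroups\<close>

text \<open>If \<open>y\<close> is of class \<open>C\<^sup>k\<close>, then \<open>y' = F \<circ> y\<close> is of class \<open>C\<^sup>k\<close>, so \<open>y\<close> is of class \<open>C\<^sup>k\<^sup>+\<^sup>1\<close>.\<close>

lemma smooth_on_ode_solution:
  fixes y :: "real \<Rightarrow> 'a::findim_inner"
  assumes I: "open I" and U: "open U" and F: "smooth_on U F" and yU: "y ` I \<subseteq> U"
    and y: "\<And>t. t \<in> I \<Longrightarrow> (y has_vector_derivative F (y t)) (at t)"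
  shows "smooth_on I y"
  unfolding smooth_on_def
proof
  fix k show "Ck_on k I y"
  proof (induction k)
    case 0
    have "isCont y t" if "t \<in> I" for t by (rule has_vector_derivative_continuous[OF y[OF that]])
    then show ?case by (simp add: continuous_at_imp_continuous_on)
  next
    case (Suc k)
    have "Ck_on k I (\<lambda>t. F (y t))"
      by (rule Ck_on_compose[OF I U Suc _ yU]) (use F in \<open>simp add: smooth_on_def\<close>)
    then have "Ck_on k I (\<lambda>t. h *\<^sub>R F (y t))" for h
      by (rule Ck_on_linear_comp[OF I bounded_linear_scaleR_right])
    then show ?case
      by (intro Ck_on_SucI'[OF I, where D = "\<lambda>t h. h *\<^sub>R F (y t)"])
        (use y in \<open>simp_all add: has_vector_derivative_def\<close>)
  qed
qed

lemma (in group) local_hom_power: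
  fixes g :: "real \<Rightarrow> 'a"
  assumes hom: "\<And>s t. \<bar>s\<bar> < \<epsilon> \<Longrightarrow> \<bar>t\<bar> < \<epsilon> \<Longrightarrow> g (s + t) = g s \<otimes> g t"
    and car: "\<And>t. \<bar>t\<bar> < \<epsilon> \<Longrightarrow> g t \<in> carrier G"
    and u: "\<bar>u\<bar> < \<epsilon>" and n: "n > 0"
  shows "g u = g (u / real n) [^] n"
proof -
  have e: "\<epsilon> > 0" using u by linarith
  have "k \<le> n \<Longrightarrow> g (real k * (u / real n)) = g (u / real n) [^] k" for k
  proof (induction k)
    case 0
    have "g 0 = g 0 \<otimes> g 0" using hom[of 0 0] e by simp
    then show ?case using car[of 0] e by simp
  next
    case (Suc k)
    have b: "\<bar>real j * (u / real n)\<bar> < \<epsilon>" if "j \<le> n" for j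
    proof -
      have "\<bar>real j * (u / real n)\<bar> = (real j / real n) * \<bar>u\<bar>" by (simp add: abs_mult)
      also have "\<dots> \<le> 1 * \<bar>u\<bar>" using that n by (intro mult_right_mono) auto
      finally show ?thesis using u by simp
    qed
    have "g (real (Suc k) * (u / real n)) = g (real k * (u / real n) + u / real n)"
      by (simp add: algebra_simps add_divide_distrib)
    also have "\<dots> = g (real k * (u / real n)) \<otimes> g (u / real n)"
      using b[of k] b[of 1] Suc.prems n by (intro hom) simp_all
    finally show ?case using Suc by simp
  qed
  from this[of n] show ?thesis using n by simp
qed

lemma ex_subdivision:
  fixes \<epsilon> B :: real
  assumes "\<epsilon> > 0"
  obtains n :: nat where "n > 0" "\<And>t. \<bar>t\<bar> \<le> B \<Longrightarrow> \<bar>t / real n\<bar> < \<epsilon>"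
proof -
  obtain n :: nat where n: "\<bar>B\<bar> / \<epsilon> < real n" using reals_Archimedean2 by blast
  have "0 \<le> \<bar>B\<bar> / \<epsilon>" using assms by simp
  then have n0: "n > 0" using n by (cases n) auto
  have "\<bar>t / real n\<bar> < \<epsilon>" if "\<bar>t\<bar> \<le> B" for t
  proof -
    have "\<bar>B\<bar> < \<epsilon> * real n" using n assms by (simp add: field_simps)
    then have "\<bar>t\<bar> < \<epsilon> * real n" using that by linarith
    then show ?thesis using n0 by (simp add: field_simps)
  qed
  then show ?thesis using that n0 by blast
qed

text \<open>The extension is \<open>t \<mapsto> g (t / n) ^ n\<close> for large \<open>n\<close>; passing to a common multiple shows
  that the choice of \<open>n\<close> does not matter.\<close>

lemma (in group) local_hom_extends:
  fixes g :: "real \<Rightarrow> 'a"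
  assumes e: "\<epsilon> > 0"
    and hom: "\<And>s t. \<bar>s\<bar> < \<epsilon> \<Longrightarrow> \<bar>t\<bar> < \<epsilon> \<Longrightarrow> g (s + t) = g s \<otimes> g t"
    and car: "\<And>t. \<bar>t\<bar> < \<epsilon> \<Longrightarrow> g t \<in> carrier G"
  obtains \<gamma> where "\<And>s t. \<gamma> (s + t) = \<gamma> s \<otimes> \<gamma> t" "\<And>t. \<gamma> t \<in> carrier G" "\<And>t. \<bar>t\<bar> < \<epsilon> \<Longrightarrow> \<gamma> t = g t"
proof -
  have power: "g u = g (u / real n) [^] n" if "\<bar>u\<bar> < \<epsilon>" "n > 0" for u and n :: nat
    by (rule local_hom_power[of \<epsilon> g]) (use hom car that in simp_all)
  define N where "N t = (SOME n::nat. n > 0 \<and> \<bar>t / real n\<bar> < \<epsilon>)" for t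
  have N: "N t > 0 \<and> \<bar>t / real (N t)\<bar> < \<epsilon>" for t
  proof -
    obtain n :: nat where "n > 0" "\<bar>t / real n\<bar> < \<epsilon>" using ex_subdivision[OF e, of "\<bar>t\<bar>"] by blast
    then show ?thesis unfolding N_def by (intro someI[of "\<lambda>n. n > 0 \<and> \<bar>t / real n\<bar> < \<epsilon>" n]) simp
  qed
  have indep: "g (t / real n) [^] n = g (t / real m) [^] m"
    if n: "n > 0" "\<bar>t / real n\<bar> < \<epsilon>" and m: "m > 0" "\<bar>t / real m\<bar> < \<epsilon>" for t :: real and m n :: nat
  proof -
    have nm: "\<bar>t / real n / real m\<bar> < \<epsilon>"
    proof -
      have "\<bar>t / real n / real m\<bar> = \<bar>t / real n\<bar> / real m" by simp
      also have "\<dots> \<le> \<bar>t / real n\<bar> / 1" using m(1) by (intro divide_left_mono) auto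
      finally show ?thesis using n(2) by simp
    qed
    have eq: "t / real m / real n = t / real n / real m" by (simp add: field_simps)
    have "g (t / real n) [^] n = (g (t / real n / real m) [^] m) [^] n"
      using power[OF n(2) m(1)] by simp
    also have "\<dots> = (g (t / real n / real m) [^] n) [^] m"
      using car[OF nm] by (simp add: nat_pow_pow mult.commute)
    also have "\<dots> = g (t / real m) [^] m" using power[OF m(2) n(1), unfolded eq] by simp
    finally show ?thesis .
  qed
  define \<gamma> where "\<gamma> t = g (t / real (N t)) [^] N t" for t
  have \<gamma>: "\<gamma> t = g (t / real n) [^] n" if "n > 0" "\<bar>t / real n\<bar> < \<epsilon>" for t n
    unfolding \<gamma>_def using N[of t] that by (intro indep) auto
  have "\<gamma> (s + t) = \<gamma> s \<otimes> \<gamma> t" for s t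
  proof -
    obtain n :: nat where n0: "n > 0" and n: "\<And>u. \<bar>u\<bar> \<le> \<bar>s\<bar> + \<bar>t\<bar> \<Longrightarrow> \<bar>u / real n\<bar> < \<epsilon>"
      using ex_subdivision[OF e] by metis
    have s: "\<bar>s / real n\<bar> < \<epsilon>" and t: "\<bar>t / real n\<bar> < \<epsilon>" and st: "\<bar>(s + t) / real n\<bar> < \<epsilon>"
      by (intro n; simp)+
    have "\<gamma> (s + t) = g (s / real n + t / real n) [^] n"
      using \<gamma>[OF n0 st] by (simp add: add_divide_distrib)
    also have "\<dots> = (g (s / real n) \<otimes> g (t / real n)) [^] n" by (simp only: hom[OF s t])
    also have "\<dots> = g (s / real n) [^] n \<otimes> g (t / real n) [^] n"
      using hom[OF s t] hom[OF t s] by (intro pow_mult_distrib car s t) (simp add: add.commute)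
    also have "\<dots> = \<gamma> s \<otimes> \<gamma> t" by (simp only: \<gamma>[OF n0 s] \<gamma>[OF n0 t])
    finally show ?thesis .
  qed
  moreover have "\<gamma> t \<in> carrier G" for t unfolding \<gamma>_def using N car by simp
  moreover have "\<gamma> t = g t" if "\<bar>t\<bar> < \<epsilon>" for t
    using \<gamma>[of 1 t] that car[OF that] by simp
  ultimately show ?thesis by (rule that)
qed

text \<open>The value at \<open>t\<close> is the \<open>n\<close>-th power of the value at \<open>t / n\<close>.\<close>

lemma (in group) real_hom_eqI:
  fixes \<gamma> \<delta> :: "real \<Rightarrow> 'a"
  assumes \<gamma>: "\<And>s t. \<gamma> (s + t) = \<gamma> s \<otimes> \<gamma> t" "\<And>t. \<gamma> t \<in> carrier G"
    and \<delta>: "\<And>s t. \<delta> (s + t) = \<delta> s \<otimes> \<delta> t" "\<And>t. \<delta> t \<in> carrier G"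
    and e: "\<epsilon> > 0" and eq: "\<And>t. \<bar>t\<bar> < \<epsilon> \<Longrightarrow> \<gamma> t = \<delta> t"
  shows "\<gamma> = \<delta>"
proof
  fix t
  obtain n :: nat where n: "n > 0" "\<bar>t / real n\<bar> < \<epsilon>" using ex_subdivision[OF e, of "\<bar>t\<bar>"] by blast
  have "\<gamma> t = \<gamma> (t / real n) [^] n"
    by (rule local_hom_power[of "\<bar>t\<bar> + 1" \<gamma>]) (use \<gamma> n in simp_all)
  also have "\<dots> = \<delta> (t / real n) [^] n" using eq[OF n(2)] by simp
  also have "\<dots> = \<delta> t"
    by (rule local_hom_power[of "\<bar>t\<bar> + 1" \<delta>, symmetric]) (use \<delta> n in simp_all)
  finally show "\<gamma> t = \<delta> t" .
qed

lemma charted_real_line: "charted real_line"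
  using homeomorphic_map_id[of "euclidean :: real topology", unfolded id_def]
  by (auto simp: charted_def real_line_def is_chart_def comp_def coord_inv_real_line
      intro: smooth_on_bounded_linear bounded_linear_ident)

context lie_group_context
begin

lemma dmap_lmult_coord:
  "h \<in> dom_of c0 \<Longrightarrow> dmap c0 c0 (\<lambda>x. h \<otimes> x) \<one> Y = lfield Y (coord c0 h)"
  by (simp add: lfield_def coord_inv_coord[OF charted_L c0_atlas])

lemma lfield_locally_lipschitz:
  obtains r K where "r > 0" "K \<ge> 0" "cball x0 r \<subseteq> img_of c0"
    "\<And>x y. x \<in> cball x0 r \<Longrightarrow> y \<in> cball x0 r \<Longrightarrow> norm (lfield Y x - lfield Y y) \<le> K * norm (x - y)"
proof (rule C1_imp_locally_lipschitz[OF open_img_c0 _ x0_img])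
  show "Ck_on (Suc 0) (img_of c0) (lfield Y)" using smooth_on_lfield[of Y] unfolding smooth_on_def ..
qed (rule that)

text \<open>The integral curve of the left-invariant field through the identity is a local homomorphism, since
  both \<open>t \<mapsto> \<gamma> (s + t)\<close> and \<open>t \<mapsto> \<gamma> s \<gamma> t\<close> solve the differential equation with the value \<open>\<gamma> s\<close> at \<open>0\<close>.\<close>

lemma local_one_parameter_subgroup:
  obtains \<epsilon> g where "\<epsilon> > 0" "\<And>t. \<bar>t\<bar> < \<epsilon> \<Longrightarrow> g t \<in> dom_of c0"
    "\<And>s t. \<bar>s\<bar> < \<epsilon> \<Longrightarrow> \<bar>t\<bar> < \<epsilon> \<Longrightarrow> g (s + t) = g s \<otimes> g t"
    "smooth_on {-\<epsilon><..<\<epsilon>} (coord c0 \<circ> g)" "((coord c0 \<circ> g) has_vector_derivative Y) (at 0)"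
proof -
  let ?F = "lfield Y"
  obtain r K where r: "r > 0" and K: "K \<ge> 0" and rU: "cball x0 r \<subseteq> img_of c0"
    and lip: "\<And>x y. x \<in> cball x0 r \<Longrightarrow> y \<in> cball x0 r \<Longrightarrow> norm (?F x - ?F y) \<le> K * norm (x - y)"
    using lfield_locally_lipschitz[of Y] by blast
  obtain \<epsilon>0 y where \<epsilon>0: "\<epsilon>0 > 0" "K * \<epsilon>0 < 1" and y0: "y 0 = x0"
    and y: "\<And>t. \<bar>t\<bar> < \<epsilon>0 \<Longrightarrow> y t \<in> cball x0 r"
    and y': "\<And>t. \<bar>t\<bar> < \<epsilon>0 \<Longrightarrow> (y has_vector_derivative ?F (y t)) (at t)"
    using picard_local_existence[OF r K lip] by blast
  have yU: "y t \<in> img_of c0" if "\<bar>t\<bar> < \<epsilon>0" for t using y[OF that] rU by blast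
  define \<gamma> where "\<gamma> t = coord_inv c0 (y t)" for t
  have \<gamma>dom: "\<gamma> t \<in> dom_of c0" and c\<gamma>: "coord c0 (\<gamma> t) = y t" if "\<bar>t\<bar> < \<epsilon>0" for t
    unfolding \<gamma>_def using yU[OF that]
    by (simp_all add: coord_inv_in_dom[OF charted_L c0_atlas] coord_coord_inv[OF charted_L c0_atlas])
  have \<gamma>car: "\<gamma> t \<in> carrier G" if "\<bar>t\<bar> < \<epsilon>0" for t by (rule dom_c0_carrier[OF \<gamma>dom[OF that]])
  have \<gamma>0: "\<gamma> 0 = \<one>" by (simp add: \<gamma>_def y0 coord_inv_x0)
  have openI: "open {t::real. \<bar>t\<bar> < \<epsilon>0}" by (intro open_Collect_less continuous_intros)
  have c\<gamma>': "((coord c0 \<circ> \<gamma>) has_vector_derivative ?F (y t)) (at t)" if t: "\<bar>t\<bar> < \<epsilon>0" for t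
    unfolding has_vector_derivative_def
    by (rule has_derivative_transform_within_open[OF y'[OF t, unfolded has_vector_derivative_def] openI])
      (use t c\<gamma> in auto)

  \<comment> \<open>products of two points of the curve stay in the ball where the field is Lipschitz\<close>
  let ?k = "prod_chart c0 c0"
  let ?V = "{p \<in> dom_of c0. coord c0 p \<in> ball x0 r}"
  let ?P = "{z \<in> dom_of ?k. mul z \<in> ?V}"
  note LL = charted_prod_manifold[OF charted_L charted_L]
  have k: "?k \<in> atlas (prod_manifold L L)" by (rule charts_atD(1)[OF charts_at_prod[OF c0_at_one c0_at_one]])
  have "open (coord ?k ` ?P)"
    by (rule open_coord_preimage[OF LL k smooth_map_continuous[OF smooth_map_mul]
          openin_coord_vimage[OF charted_L c0_atlas open_ball]])
  moreover have "(x0, x0) \<in> coord ?k ` ?P"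
    using one_in_c0 r by (intro image_eqI[of _ _ "(\<one>, \<one>)"]) (auto simp: x0_def)
  ultimately obtain A B where AB: "open A" "open B" "x0 \<in> A" "x0 \<in> B" "A \<times> B \<subseteq> coord ?k ` ?P"
    by (elim open_prod_elim) auto
  have "isCont y 0" by (rule has_vector_derivative_continuous[OF y']) (use \<epsilon>0 in simp)
  then have "(y \<longlongrightarrow> y 0) (nhds 0)" by (simp add: isCont_def tendsto_at_iff_tendsto_nhds[where g = y])
  then have "eventually (\<lambda>t. y t \<in> A \<inter> B) (nhds 0)"
    by (rule topological_tendstoD) (use AB y0 in auto)
  then obtain \<delta> where \<delta>: "\<delta> > 0" "\<And>t. \<bar>t\<bar> < \<delta> \<Longrightarrow> y t \<in> A \<inter> B"
    by (auto simp: eventually_nhds_metric dist_real_def)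
  define \<epsilon> where "\<epsilon> = min (\<epsilon>0 / 2) \<delta>"
  have \<epsilon>: "\<epsilon> > 0" "\<epsilon> \<le> \<epsilon>0 / 2" "\<epsilon> \<le> \<delta>" using \<epsilon>0 \<delta> by (auto simp: \<epsilon>_def)
  have prod: "\<gamma> s \<otimes> \<gamma> t \<in> dom_of c0" "coord c0 (\<gamma> s \<otimes> \<gamma> t) \<in> cball x0 r"
    if s: "\<bar>s\<bar> < \<epsilon>" and t: "\<bar>t\<bar> < \<epsilon>" for s t
  proof -
    have "(y s, y t) \<in> coord ?k ` ?P" using \<delta>(2)[of s] \<delta>(2)[of t] s t \<epsilon> AB(5) by auto
    then obtain a b where ab: "a \<in> dom_of c0" "b \<in> dom_of c0" "a \<otimes> b \<in> ?V"
      "y s = coord c0 a" "y t = coord c0 b" by auto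
    then have "\<gamma> s = a" "\<gamma> t = b"
      by (simp_all add: \<gamma>_def coord_inv_coord[OF charted_L c0_atlas])
    with ab show "\<gamma> s \<otimes> \<gamma> t \<in> dom_of c0" "coord c0 (\<gamma> s \<otimes> \<gamma> t) \<in> cball x0 r" by auto
  qed

  have hom: "\<gamma> (s + t) = \<gamma> s \<otimes> \<gamma> t" if s: "\<bar>s\<bar> < \<epsilon>" and t: "\<bar>t\<bar> < \<epsilon>" for s t
  proof -
    have s0: "\<bar>s\<bar> < \<epsilon>0" using s \<epsilon> \<epsilon>0 by linarith
    have "y (s + t) = coord c0 (\<gamma> s \<otimes> \<gamma> t)"
    proof (rule picard_unique[where F = ?F and K = K and \<delta> = \<epsilon> and A = "cball x0 r" and t = t
          and y = "\<lambda>t. y (s + t)" and z = "\<lambda>t. coord c0 (\<gamma> s \<otimes> \<gamma> t)"])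
      have "K * \<epsilon> \<le> K * \<epsilon>0" using \<epsilon> \<epsilon>0 K by (intro mult_left_mono) auto
      then show "K * \<epsilon> < 1" using \<epsilon>0 by simp
      show "y (s + 0) = coord c0 (\<gamma> s \<otimes> \<gamma> 0)" using \<gamma>car[OF s0] c\<gamma>[OF s0] by (simp add: \<gamma>0)
      fix u :: real assume u: "\<bar>u\<bar> < \<epsilon>"
      have u0: "\<bar>u\<bar> < \<epsilon>0" and su: "\<bar>s + u\<bar> < \<epsilon>0" using s u \<epsilon> by linarith+
      show "y (s + u) \<in> cball x0 r" by (rule y[OF su])
      have "((\<lambda>u. s + u) has_vector_derivative 1) (at u)" by (auto intro!: derivative_eq_intros)
      from vector_diff_chain_at[OF this y'[OF su]]
      show "((\<lambda>u. y (s + u)) has_vector_derivative ?F (y (s + u))) (at u)" by (simp add: comp_def)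
      show "coord c0 (\<gamma> s \<otimes> \<gamma> u) \<in> cball x0 r" by (rule prod(2)[OF s u])
      have ev: "eventually (\<lambda>v. \<gamma> v \<in> dom_of c0) (nhds u)"
        using openI u0 \<gamma>dom by (auto simp: eventually_nhds)
      have "((\<lambda>u. coord c0 (\<gamma> s \<otimes> \<gamma> u)) has_vector_derivative
          dmap c0 c0 (\<lambda>x. \<gamma> s \<otimes> x) (\<gamma> u) (?F (y u))) (at u)"
        by (rule has_vector_derivative_compose_smooth_map[OF charted_L smooth_map_lmult[OF \<gamma>car[OF s0]] ev
              c0_at[OF \<gamma>dom[OF u0]] c0_at[OF prod(1)[OF s u]] c\<gamma>'[OF u0]])
      also have "dmap c0 c0 (\<lambda>x. \<gamma> s \<otimes> x) (\<gamma> u) (?F (y u)) = ?F (coord c0 (\<gamma> s \<otimes> \<gamma> u))"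
        using dmap_lmult_lfield[OF \<gamma>car[OF s0] \<gamma>dom[OF u0] c0_at[OF prod(1)[OF s u]], of Y]
        by (simp add: c\<gamma>[OF u0] dmap_lmult_coord[OF prod(1)[OF s u]])
      finally show "((\<lambda>u. coord c0 (\<gamma> s \<otimes> \<gamma> u)) has_vector_derivative
          ?F (coord c0 (\<gamma> s \<otimes> \<gamma> u))) (at u)" .
    qed (use K lip t in auto)
    then have "\<gamma> (s + t) = coord_inv c0 (coord c0 (\<gamma> s \<otimes> \<gamma> t))" by (simp add: \<gamma>_def)
    then show ?thesis by (simp only: coord_inv_coord[OF charted_L c0_atlas prod(1)[OF s t]])
  qed
  have small: "\<bar>t\<bar> < \<epsilon>0" if "\<bar>t\<bar> < \<epsilon>" for t using that \<epsilon> \<epsilon>0 by linarith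
  have "smooth_on {-\<epsilon><..<\<epsilon>} y"
    by (rule smooth_on_ode_solution[OF _ open_img_c0 smooth_on_lfield[of Y]])
      (use yU y' small in \<open>auto simp: abs_less_iff\<close>)
  then have "smooth_on {-\<epsilon><..<\<epsilon>} (coord c0 \<circ> \<gamma>)"
    by (rule smooth_on_cong) (use c\<gamma> small in \<open>auto simp: abs_less_iff\<close>)
  moreover have "((coord c0 \<circ> \<gamma>) has_vector_derivative Y) (at 0)"
    using c\<gamma>'[of 0] \<epsilon>0 by (simp add: y0 lfield_x0)
  ultimately show ?thesis using \<epsilon>(1) \<gamma>dom[OF small] hom by (intro that[of \<epsilon> \<gamma>]) blast+
qed

text \<open>Smoothness spreads from \<open>0\<close> to \<open>t0\<close> by the identity \<open>\<gamma> t = \<gamma> t0 \<gamma> (t - t0)\<close> and the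
  smoothness of left multiplication.\<close>

lemma smooth_map_real_hom:
  assumes \<gamma>: "\<And>s t. \<gamma> (s + t) = \<gamma> s \<otimes> \<gamma> t" "\<And>t. \<gamma> t \<in> carrier G"
    and e: "\<epsilon> > 0" and dom: "\<And>t. \<bar>t\<bar> < \<epsilon> \<Longrightarrow> \<gamma> t \<in> dom_of c0"
    and sm: "smooth_on {-\<epsilon><..<\<epsilon>} (coord c0 \<circ> \<gamma>)"
  shows "smooth_map real_line L \<gamma>"
proof -
  let ?I = "{-\<epsilon><..<\<epsilon>}" and ?y = "coord c0 \<circ> \<gamma>"
  \<comment> \<open>For \<open>V\<close> containing \<open>\<gamma> t0\<close>, the set \<open>T V t0\<close> is a neighbourhood of \<open>t0\<close> that \<open>\<gamma>\<close> maps into \<open>V\<close>, small enough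
    for the times \<open>t - t0\<close> to lie in the given interval.\<close>
  define A where "A V t0 = coord c0 ` {x \<in> dom_of c0. \<gamma> t0 \<otimes> x \<in> V}" for V t0
  define B where "B V t0 = {s \<in> ?I. ?y s \<in> A V t0}" for V t0
  define T where "T V t0 = (\<lambda>t. t - t0) -` B V t0" for V t0
  have A: "open (A V t0)" if "openin (mtop L) V" for V t0
    unfolding A_def
    by (rule open_coord_preimage[OF charted_L c0_atlas smooth_map_continuous[OF smooth_map_lmult[OF \<gamma>(2)]] that])
  have B: "open (B V t0)" if "openin (mtop L) V" for V t0
    using continuous_open_preimage[OF smooth_on_continuous_on[OF sm] _ A[OF that]]
    by (simp add: B_def vimage_def Int_def)
  have T: "open (T V t0)" if "openin (mtop L) V" for V t0
    unfolding T_def by (intro open_vimage B that continuous_intros)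
  have inA: "\<gamma> s \<in> dom_of c0 \<and> \<gamma> t0 \<otimes> \<gamma> s \<in> V" if s: "s \<in> B V t0" for s V t0
  proof -
    have "\<bar>s\<bar> < \<epsilon>" using s by (auto simp: B_def)
    then have d: "\<gamma> s \<in> dom_of c0" by (rule dom)
    obtain x where x: "x \<in> dom_of c0" "\<gamma> t0 \<otimes> x \<in> V" "coord c0 (\<gamma> s) = coord c0 x"
      using s by (auto simp: B_def A_def)
    then have "\<gamma> s = x" using inj_on_coord[OF charted_L c0_atlas] d by (auto dest: inj_onD)
    then show ?thesis using d x by simp
  qed
  have shift: "\<gamma> t = \<gamma> t0 \<otimes> \<gamma> (t - t0)" for t t0 using \<gamma>(1)[of t0 "t - t0"] by simp
  have TV: "\<gamma> t \<in> V" if "t \<in> T V t0" for t t0 V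
    using inA[of "t - t0" V t0] that shift[of t t0] by (simp add: T_def)
  have \<gamma>0: "\<gamma> 0 = \<one>" using \<gamma>(1)[of 0 0] \<gamma>(2)[of 0] by simp
  have t0T: "t0 \<in> T V t0" if "\<gamma> t0 \<in> V" for t0 V
    using that e one_in_c0 \<gamma>(2)[of t0] by (auto simp: T_def B_def A_def \<gamma>0)
  have cont: "continuous_map euclidean (mtop L) \<gamma>"
    unfolding continuous_map_def
  proof (intro conjI allI impI)
    show "\<gamma> \<in> topspace euclidean \<rightarrow> topspace (mtop L)" using \<gamma>(2) by (simp add: points_L)
    fix V assume V: "openin (mtop L) V"
    have "\<exists>T. open T \<and> t0 \<in> T \<and> T \<subseteq> {t. \<gamma> t \<in> V}" if "\<gamma> t0 \<in> V" for t0
      using T[OF V, of t0] t0T[OF that] TV by (intro exI[of _ "T V t0"]) auto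
    then have "open {t. \<gamma> t \<in> V}" by (subst open_subopen) blast
    then show "openin euclidean {x \<in> topspace euclidean. \<gamma> x \<in> V}" by simp
  qed
  moreover have "smooth_on {t. \<gamma> t \<in> dom_of d} (coord d \<circ> \<gamma>)" if d: "d \<in> atlas L" for d
  proof (rule smooth_on_local)
    fix t0 assume "t0 \<in> {t. \<gamma> t \<in> dom_of d}"
    then have t0: "\<gamma> t0 \<in> dom_of d" by simp
    let ?V = "dom_of d"
    have V: "openin (mtop L) ?V" by (rule openin_dom_of[OF charted_L d])
    let ?f = "coord d \<circ> (\<lambda>x. \<gamma> t0 \<otimes> x) \<circ> coord_inv c0"
    have "smooth_on (A ?V t0) ?f"
      unfolding A_def by (rule smooth_map_smooth_on[OF smooth_map_lmult[OF \<gamma>(2)] c0_atlas d])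
    moreover have "smooth_on (B ?V t0) ?y" by (rule smooth_on_subset[OF sm]) (auto simp: B_def)
    ultimately have 1: "smooth_on (B ?V t0) (\<lambda>s. ?f (?y s))"
      by (rule smooth_on_compose[OF _ _ B[OF V] A[OF V]]) (auto simp: B_def)
    have "smooth_on (T ?V t0) (\<lambda>t. t + (- t0))"
      unfolding smooth_on_def
      by (intro allI Ck_on_add Ck_on_const Ck_on_bounded_linear bounded_linear_ident T[OF V])
    then have "smooth_on (T ?V t0) (\<lambda>t. ?f (?y (t + (- t0))))"
      by (rule smooth_on_compose[OF 1 _ T[OF V] B[OF V]]) (auto simp: T_def)
    then have "smooth_on (T ?V t0) (coord d \<circ> \<gamma>)"
    proof (rule smooth_on_cong[OF _ T[OF V]])
      fix t assume "t \<in> T ?V t0"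
      then have "\<gamma> (t - t0) \<in> dom_of c0" using inA[of "t - t0" ?V t0] by (simp add: T_def)
      then show "?f (?y (t + (- t0))) = (coord d \<circ> \<gamma>) t"
        using shift[of t t0] by (simp add: coord_inv_coord[OF charted_L c0_atlas])
    qed
    then show "\<exists>U. open U \<and> t0 \<in> U \<and> smooth_on U (coord d \<circ> \<gamma>)"
      using T[OF V, of t0] t0T[OF t0] by (intro exI[of _ "T ?V t0"]) simp
  qed
  ultimately show ?thesis by (simp add: smooth_map_real_line)
qed

lemma ex_one_parameter_subgroup:
  obtains \<gamma> where "one_parameter_subgroup G L \<gamma>" "((coord c0 \<circ> \<gamma>) has_vector_derivative Y) (at 0)"
proof -
  obtain \<epsilon> g where g: "\<epsilon> > 0" "\<And>t. \<bar>t\<bar> < \<epsilon> \<Longrightarrow> g t \<in> dom_of c0"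
    "\<And>s t. \<bar>s\<bar> < \<epsilon> \<Longrightarrow> \<bar>t\<bar> < \<epsilon> \<Longrightarrow> g (s + t) = g s \<otimes> g t"
    "smooth_on {-\<epsilon><..<\<epsilon>} (coord c0 \<circ> g)" "((coord c0 \<circ> g) has_vector_derivative Y) (at 0)"
    using local_one_parameter_subgroup[of Y] by blast
  obtain \<gamma> where \<gamma>: "\<And>s t. \<gamma> (s + t) = \<gamma> s \<otimes> \<gamma> t" "\<And>t. \<gamma> t \<in> carrier G"
    and eq: "\<And>t. \<bar>t\<bar> < \<epsilon> \<Longrightarrow> \<gamma> t = g t"
    using local_hom_extends[OF g(1,3) dom_c0_carrier[OF g(2)]] by blast
  have eq': "(coord c0 \<circ> g) t = (coord c0 \<circ> \<gamma>) t" if "t \<in> {-\<epsilon><..<\<epsilon>}" for t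
    using eq[of t] that by (simp add: abs_less_iff)
  have "smooth_on {-\<epsilon><..<\<epsilon>} (coord c0 \<circ> \<gamma>)"
    by (rule smooth_on_cong[OF g(4) open_greaterThanLessThan eq'])
  then have "smooth_map real_line L \<gamma>"
    by (intro smooth_map_real_hom[OF \<gamma> g(1)]) (simp_all only: eq g(2))
  moreover have "((coord c0 \<circ> \<gamma>) has_vector_derivative Y) (at 0)"
    unfolding has_vector_derivative_def
    by (rule has_derivative_transform_within_open[OF g(5)[unfolded has_vector_derivative_def]
          open_greaterThanLessThan _ eq']) (use g(1) in auto)
  ultimately show ?thesis using \<gamma>(1) by (intro that[of \<gamma>]) (simp_all add: one_parameter_subgroup_def)
qed

context
  fixes \<gamma> :: "real \<Rightarrow> 'g"
  assumes \<gamma>: "one_parameter_subgroup G L \<gamma>"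
begin

lemma one_parameter_subgroup_add: "\<gamma> (s + t) = \<gamma> s \<otimes> \<gamma> t"
  using \<gamma> by (simp add: one_parameter_subgroup_def)

lemma one_parameter_subgroup_continuous: "continuous_map euclidean (mtop L) \<gamma>"
  using \<gamma> by (simp add: one_parameter_subgroup_def smooth_map_real_line)

lemma one_parameter_subgroup_carrier: "\<gamma> t \<in> carrier G"
  using funcset_mem[OF continuous_map_funspace[OF one_parameter_subgroup_continuous], of t]
  by (simp add: points_L)

lemma one_parameter_subgroup_zero: "\<gamma> 0 = \<one>"
  using one_parameter_subgroup_add[of 0 0] one_parameter_subgroup_carrier[of 0] by simp

lemma one_parameter_subgroup_eventually:
  assumes "openin (mtop L) V" "\<gamma> t \<in> V"
  shows "eventually (\<lambda>s. \<gamma> s \<in> V) (nhds t)"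
proof -
  have "open {s. \<gamma> s \<in> V}"
    using openin_continuous_map_preimage[OF one_parameter_subgroup_continuous assms(1)] by simp
  from eventually_nhds_in_open[OF this, of t] assms(2) show ?thesis by simp
qed

lemma one_parameter_subgroup_smooth_on: "d \<in> atlas L \<Longrightarrow> smooth_on {t. \<gamma> t \<in> dom_of d} (coord d \<circ> \<gamma>)"
  using \<gamma> by (simp add: one_parameter_subgroup_def smooth_map_real_line)

lemma one_parameter_subgroup_differentiable:
  assumes "d \<in> charts_at L (\<gamma> t)"
  shows "((coord d \<circ> \<gamma>) has_vector_derivative vector_derivative (coord d \<circ> \<gamma>) (at t)) (at t)"
proof -
  have "((coord d \<circ> \<gamma>) has_derivative frechet_derivative (coord d \<circ> \<gamma>) (at t)) (at t)"
    by (rule smooth_on_has_derivative[OF one_parameter_subgroup_smooth_on[OF charts_atD(1)[OF assms]]])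
      (use charts_atD(2)[OF assms] in simp)
  then have "(coord d \<circ> \<gamma>) differentiable (at t)" by (rule differentiableI)
  then show ?thesis by (simp only: vector_derivative_works)
qed

text \<open>Since \<open>\<gamma> s = \<gamma> t \<gamma> (s - t)\<close>, a derivative at time \<open>t\<close> is a derivative at time \<open>0\<close>, where the
  velocity is known. For the inclusion \<open>f x = x\<close> this says that \<open>\<gamma>\<close> is an integral curve of the
  left-invariant field.\<close>

lemma one_parameter_subgroup_derivative:
  assumes v: "((coord c0 \<circ> \<gamma>) has_vector_derivative Y) (at 0)"
    and f: "smooth_map L N f" and d: "d \<in> charts_at N (f (\<gamma> t))"
  shows "((\<lambda>s. coord d (f (\<gamma> s))) has_vector_derivative dmap c0 d (\<lambda>x. f (\<gamma> t \<otimes> x)) \<one> Y) (at t)"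
proof -
  note car = one_parameter_subgroup_carrier[of t]
  have ev: "eventually (\<lambda>s. \<gamma> s \<in> dom_of c0) (nhds 0)"
    by (rule one_parameter_subgroup_eventually[OF openin_dom_of[OF charted_L c0_atlas]])
      (simp add: one_parameter_subgroup_zero one_in_c0)
  obtain e where e: "e \<in> charts_at L (\<gamma> t)"
    using charted_ex_chart[OF charted_L, of "\<gamma> t"] car by (auto simp: points_L)
  have c0': "c0 \<in> charts_at L (\<gamma> 0)" by (simp add: one_parameter_subgroup_zero c0_at_one)
  have e': "e \<in> charts_at L (\<gamma> t \<otimes> \<gamma> 0)" using e car by (simp add: one_parameter_subgroup_zero)
  have ev': "eventually (\<lambda>s. \<gamma> t \<otimes> \<gamma> s \<in> dom_of e) (nhds 0)"
  proof -
    have "open {s. (\<lambda>s. \<gamma> t \<otimes> \<gamma> s) s \<in> dom_of e}"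
      using openin_continuous_map_preimage[OF continuous_map_compose[OF one_parameter_subgroup_continuous
          smooth_map_continuous[OF smooth_map_lmult[OF car]]] openin_dom_of[OF charted_L charts_atD(1)[OF e]]]
      by simp
    from eventually_nhds_in_open[OF this, of 0] show ?thesis
      using charts_atD(2)[OF e'] by simp
  qed
  have "((\<lambda>s. coord e (\<gamma> t \<otimes> \<gamma> s)) has_vector_derivative dmap c0 e (\<lambda>x. \<gamma> t \<otimes> x) (\<gamma> 0) Y) (at 0)"
    by (rule has_vector_derivative_compose_smooth_map[OF charted_L smooth_map_lmult[OF car] ev c0' e' v])
  then have "((coord e \<circ> (\<lambda>s. \<gamma> t \<otimes> \<gamma> s)) has_vector_derivative dmap c0 e (\<lambda>x. \<gamma> t \<otimes> x) \<one> Y) (at 0)"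
    by (simp add: comp_def one_parameter_subgroup_zero)
  from has_vector_derivative_compose_smooth_map[OF charted_L f ev' e' _ this, of d]
  have "((\<lambda>s. coord d (f (\<gamma> t \<otimes> \<gamma> s))) has_vector_derivative
      dmap e d f (\<gamma> t) (dmap c0 e (\<lambda>x. \<gamma> t \<otimes> x) \<one> Y)) (at 0)"
    using d car by (simp add: one_parameter_subgroup_zero)
  also have "dmap e d f (\<gamma> t) (dmap c0 e (\<lambda>x. \<gamma> t \<otimes> x) \<one> Y) = dmap c0 d (\<lambda>x. f (\<gamma> t \<otimes> x)) \<one> Y"
    using dmap_compose[OF charted_L charted_L smooth_map_lmult[OF car] f c0_at_one, of e d Y] e d car
    by simp
  finally have 0: "((\<lambda>s. coord d (f (\<gamma> t \<otimes> \<gamma> s))) has_vector_derivative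
      dmap c0 d (\<lambda>x. f (\<gamma> t \<otimes> x)) \<one> Y) (at (t - t))" by simp
  have "((\<lambda>s. s - t) has_vector_derivative 1) (at t)" by (auto intro!: derivative_eq_intros)
  from vector_diff_chain_at[OF this 0] show ?thesis
    by (simp add: comp_def flip: one_parameter_subgroup_add)
qed

end

text \<open>Both curves solve the same differential equation near \<open>0\<close>, so they agree there, and homomorphisms
  are determined by their values near \<open>0\<close>.\<close>

lemma one_parameter_subgroup_unique:
  assumes \<gamma>: "one_parameter_subgroup G L \<gamma>" "((coord c0 \<circ> \<gamma>) has_vector_derivative Y) (at 0)"
    and \<delta>: "one_parameter_subgroup G L \<delta>" "((coord c0 \<circ> \<delta>) has_vector_derivative Y) (at 0)"
  shows "\<gamma> = \<delta>"
proof -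
  obtain r K where r: "r > 0" and K: "K \<ge> 0" and rU: "cball x0 r \<subseteq> img_of c0"
    and lip: "\<And>x y. x \<in> cball x0 r \<Longrightarrow> y \<in> cball x0 r \<Longrightarrow> norm (lfield Y x - lfield Y y) \<le> K * norm (x - y)"
    using lfield_locally_lipschitz[of Y] by blast
  let ?V = "{p \<in> dom_of c0. coord c0 p \<in> ball x0 r}"
  have V: "openin (mtop L) ?V" by (rule openin_coord_vimage[OF charted_L c0_atlas open_ball])
  have oneV: "\<one> \<in> ?V" using one_in_c0 r by (simp add: x0_def)
  have "eventually (\<lambda>t. \<gamma> t \<in> ?V \<and> \<delta> t \<in> ?V) (nhds 0)"
    using one_parameter_subgroup_eventually[OF \<gamma>(1) V, of 0] one_parameter_subgroup_eventually[OF \<delta>(1) V, of 0]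
      oneV one_parameter_subgroup_zero[OF \<gamma>(1)] one_parameter_subgroup_zero[OF \<delta>(1)]
    by (intro eventually_conj) simp_all
  then obtain \<epsilon>0 where \<epsilon>0: "\<epsilon>0 > 0" "\<And>t. \<bar>t\<bar> < \<epsilon>0 \<Longrightarrow> \<gamma> t \<in> ?V \<and> \<delta> t \<in> ?V"
    by (auto simp: eventually_nhds_metric dist_real_def)
  define \<epsilon> where "\<epsilon> = min \<epsilon>0 (1 / (K + 1))"
  have \<epsilon>: "\<epsilon> > 0" "\<epsilon> \<le> \<epsilon>0" using \<epsilon>0 K by (auto simp: \<epsilon>_def)
  have "K * \<epsilon> \<le> K * (1 / (K + 1))" using K by (intro mult_left_mono) (auto simp: \<epsilon>_def)
  also have "\<dots> < 1" using K by (simp add: field_simps)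
  finally have K\<epsilon>: "K * \<epsilon> < 1" .
  have ode: "((\<lambda>t. coord c0 (\<beta> t)) has_vector_derivative lfield Y (coord c0 (\<beta> t))) (at t)"
    if \<beta>: "one_parameter_subgroup G L \<beta>" "((coord c0 \<circ> \<beta>) has_vector_derivative Y) (at 0)"
      and t: "\<beta> t \<in> dom_of c0" for \<beta> t
    using one_parameter_subgroup_derivative[OF \<beta> smooth_map_id[OF charted_L] c0_at[OF t]]
    by (simp add: dmap_lmult_coord[OF t])
  have "\<gamma> t = \<delta> t" if t: "\<bar>t\<bar> < \<epsilon>" for t
  proof -
    have "coord c0 (\<gamma> t) = coord c0 (\<delta> t)"
    proof (rule picard_unique[OF K K\<epsilon> lip _ _ _ _ _ t])
      show "coord c0 (\<gamma> 0) = coord c0 (\<delta> 0)"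
        by (simp add: one_parameter_subgroup_zero[OF \<gamma>(1)] one_parameter_subgroup_zero[OF \<delta>(1)])
      fix s assume "\<bar>s\<bar> < \<epsilon>"
      then have s: "\<gamma> s \<in> ?V" "\<delta> s \<in> ?V" using \<epsilon>0(2)[of s] \<epsilon>(2) by auto
      show "coord c0 (\<gamma> s) \<in> cball x0 r" "coord c0 (\<delta> s) \<in> cball x0 r" using s by auto
      show "((\<lambda>t. coord c0 (\<gamma> t)) has_vector_derivative lfield Y (coord c0 (\<gamma> s))) (at s)"
        by (rule ode[OF \<gamma>]) (use s in simp)
      show "((\<lambda>t. coord c0 (\<delta> t)) has_vector_derivative lfield Y (coord c0 (\<delta> s))) (at s)"
        by (rule ode[OF \<delta>]) (use s in simp)
    qed
    moreover have "\<gamma> t \<in> dom_of c0" "\<delta> t \<in> dom_of c0" using \<epsilon>0(2)[of t] \<epsilon>(2) t by auto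
    ultimately show ?thesis using inj_on_coord[OF charted_L c0_atlas] by (auto dest: inj_onD)
  qed
  then show ?thesis
    by (intro real_hom_eqI[OF one_parameter_subgroup_add[OF \<gamma>(1)] one_parameter_subgroup_carrier[OF \<gamma>(1)]
          one_parameter_subgroup_add[OF \<delta>(1)] one_parameter_subgroup_carrier[OF \<delta>(1)] \<epsilon>(1)])
qed

lemma velocity_eqD:
  assumes "one_parameter_subgroup G L \<gamma>" "velocity L \<gamma> 0 = X"
  shows "((coord c0 \<circ> \<gamma>) has_vector_derivative X c0) (at 0)"
proof -
  have "c0 \<in> charts_at L (\<gamma> 0)" by (simp add: one_parameter_subgroup_zero[OF assms(1)] c0_at_one)
  moreover from this have "X c0 = vector_derivative (coord c0 \<circ> \<gamma>) (at 0)"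
    by (simp add: velocity_def flip: assms(2))
  ultimately show ?thesis using one_parameter_subgroup_differentiable[OF assms(1)] by simp
qed

lemma ex_one_parameter_subgroup_velocity:
  assumes X: "X \<in> lie_algebra G L"
  obtains \<gamma> where "one_parameter_subgroup G L \<gamma>" "velocity L \<gamma> 0 = X"
proof -
  obtain \<gamma> where \<gamma>: "one_parameter_subgroup G L \<gamma>" "((coord c0 \<circ> \<gamma>) has_vector_derivative X c0) (at 0)"
    using ex_one_parameter_subgroup by blast
  have "velocity L \<gamma> 0 c = X c" for c
  proof (cases "c \<in> charts_at L \<one>")
    case True
    have "((\<lambda>s. coord c (\<gamma> s)) has_vector_derivative dmap c0 c (\<lambda>x. \<gamma> 0 \<otimes> x) \<one> (X c0)) (at 0)"
      by (rule one_parameter_subgroup_derivative[OF \<gamma> smooth_map_id[OF charted_L]])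
        (simp add: one_parameter_subgroup_zero[OF \<gamma>(1)] True)
    also have "dmap c0 c (\<lambda>x. \<gamma> 0 \<otimes> x) \<one> = dmap c0 c (\<lambda>x. x) \<one>"
      by (rule dmap_cong[OF charted_L c0_at_one])
        (simp add: one_parameter_subgroup_zero[OF \<gamma>(1)] dom_c0_carrier)
    also have "dmap c0 c (\<lambda>x. x) \<one> (X c0) = X c"
    proof -
      have "X c = frechet_derivative (coord c \<circ> coord_inv c0) (at (coord c0 \<one>)) (X c0)"
        using X True c0_at_one unfolding lie_algebra_def tangent_space_def by blast
      moreover have "coord c \<circ> (\<lambda>x. x) \<circ> coord_inv c0 = coord c \<circ> coord_inv c0"
        by (simp add: comp_def)
      ultimately show ?thesis by simp
    qed
    finally show ?thesis
      using True by (simp add: velocity_def one_parameter_subgroup_zero[OF \<gamma>(1)] comp_def vector_derivative_at)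
  next
    case False
    then have "X c = 0" using X unfolding lie_algebra_def tangent_space_def by blast
    then show ?thesis
      using False by (simp add: velocity_def one_parameter_subgroup_zero[OF \<gamma>(1)])
  qed
  then show ?thesis using that[OF \<gamma>(1)] by blast
qed

text \<open>The one-parameter subgroup with velocity \<open>t X\<close> is \<open>s \<mapsto> \<gamma> (t s)\<close>. By uniqueness it is the one selected
  in the definition of \<^const>\<open>lie_exp\<close>.\<close>

lemma lie_exp_scaleR:
  assumes \<gamma>: "one_parameter_subgroup G L \<gamma>" "velocity L \<gamma> 0 = X"
  shows "lie_exp G L (t *\<^sub>R X) = \<gamma> t"
proof -
  let ?\<delta> = "\<lambda>s. \<gamma> (t * s)"
  note rl = charted_real_line
  have "smooth_map real_line real_line (\<lambda>s. t * s)"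
    unfolding smooth_map_real_line
    by (auto simp: real_line_def comp_def
        intro: smooth_on_bounded_linear bounded_linear_mult_right continuous_on_mult_left continuous_on_id)
  then have "smooth_map real_line L ?\<delta>"
    by (rule smooth_map_compose[OF rl rl charted_L]) (use \<gamma>(1) in \<open>simp add: one_parameter_subgroup_def\<close>)
  then have \<delta>: "one_parameter_subgroup G L ?\<delta>"
    using \<gamma>(1) by (simp add: one_parameter_subgroup_def distrib_left)
  have "velocity L ?\<delta> 0 c = (t *\<^sub>R X) c" for c
  proof (cases "c \<in> charts_at L \<one>")
    case True
    have "((coord c \<circ> \<gamma>) has_vector_derivative vector_derivative (coord c \<circ> \<gamma>) (at 0)) (at (t * 0))"
      using one_parameter_subgroup_differentiable[OF \<gamma>(1), of c 0] True
      by (simp add: one_parameter_subgroup_zero[OF \<gamma>(1)])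
    moreover have "((\<lambda>s. t * s) has_vector_derivative t) (at 0)"
      by (auto intro!: derivative_eq_intros)
    ultimately have "((coord c \<circ> \<gamma>) \<circ> (\<lambda>s. t * s) has_vector_derivative
        t *\<^sub>R vector_derivative (coord c \<circ> \<gamma>) (at 0)) (at 0)"
      by (intro vector_diff_chain_at)
    moreover have "vector_derivative (coord c \<circ> \<gamma>) (at 0) = X c"
      using fun_cong[OF \<gamma>(2), of c] True by (simp add: velocity_def one_parameter_subgroup_zero[OF \<gamma>(1)])
    ultimately show ?thesis
      using True by (simp add: velocity_def one_parameter_subgroup_zero[OF \<gamma>(1)] vector_derivative_at
          scaleR_fun_def comp_def)
  next
    case False
    then show ?thesis
      using fun_cong[OF \<gamma>(2), of c]
      by (simp add: velocity_def one_parameter_subgroup_zero[OF \<gamma>(1)] scaleR_fun_def)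
  qed
  then have v: "velocity L ?\<delta> 0 = t *\<^sub>R X" by blast
  have "(THE \<gamma>. one_parameter_subgroup G L \<gamma> \<and> velocity L \<gamma> 0 = t *\<^sub>R X) = ?\<delta>"
  proof (rule the_equality)
    fix \<beta> assume \<beta>: "one_parameter_subgroup G L \<beta> \<and> velocity L \<beta> 0 = t *\<^sub>R X"
    show "\<beta> = ?\<delta>"
      by (rule one_parameter_subgroup_unique[OF conjunct1[OF \<beta>]
            velocity_eqD[OF conjunct1[OF \<beta>] conjunct2[OF \<beta>]] \<delta> velocity_eqD[OF \<delta> v]])
  qed (use \<delta> v in simp)
  then show ?thesis by (simp add: lie_exp_def)
qed

end

section \<open>Isometric actions\<close>

lemma dmap_ident: "dmap c d (\<lambda>x. x) p = frechet_derivative (coord d \<circ> coord_inv c) (at (coord c p))"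
  by (simp add: comp_def)

locale isometric_action_context = lie_group_context G L
  for G :: "('g, 'z) monoid_scheme" (structure) and L :: "('g, 'f::findim_inner) manifold" +
  fixes M :: "('m, 'e::findim_inner) manifold"
    and h :: "'m \<Rightarrow> ('m, 'e) tvec \<Rightarrow> ('m, 'e) tvec \<Rightarrow> real"
    and \<phi> :: "'g \<Rightarrow> 'm \<Rightarrow> 'm"
  assumes riemannian: "riemannian_manifold M h"
    and smooth_action: "smooth_action G L M \<phi>"
    and faithful_action: "faithful_action G (points M) \<phi>"
    and isometric_action: "isometric_action G M h \<phi>"
begin

sublocale act: faithful_action G "points M" \<phi>
  by (rule faithful_action)

lemma charted_M: "charted M"
  using riemannian by (simp add: riemannian_manifold_def smooth_manifold_imp_charted)

lemma smooth_map_act: "smooth_map (prod_manifold L M) M (\<lambda>(g, x). \<phi> g x)"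
  using smooth_action by (simp add: smooth_action_def)

lemma act_closed: "g \<in> carrier G \<Longrightarrow> p \<in> points M \<Longrightarrow> \<phi> g p \<in> points M"
  by (rule act.element_image) simp_all

lemma act_one: "p \<in> points M \<Longrightarrow> \<phi> \<one> p = p"
  by (simp flip: act.id_eq_one)

lemma act_mult: "g \<in> carrier G \<Longrightarrow> k \<in> carrier G \<Longrightarrow> p \<in> points M \<Longrightarrow> \<phi> (g \<otimes> k) p = \<phi> g (\<phi> k p)"
  by (rule act.composition_rule)

lemma smooth_map_orbit: "p \<in> points M \<Longrightarrow> smooth_map L M (\<lambda>g. \<phi> g p)"
  using smooth_map_compose[OF charted_L charted_prod_manifold[OF charted_L charted_M] charted_M
      smooth_map_Pair[OF charted_L charted_L charted_M smooth_map_id[OF charted_L] smooth_map_const[OF charted_L]]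
      smooth_map_act, of p]
  by simp

lemma smooth_map_act1: "g \<in> carrier G \<Longrightarrow> smooth_map M M (\<phi> g)"
  using smooth_map_compose[OF charted_M charted_prod_manifold[OF charted_L charted_M] charted_M
      smooth_map_Pair[OF charted_M charted_L charted_M smooth_map_const[OF charted_M] smooth_map_id[OF charted_M]]
      smooth_map_act, of g]
  by (simp add: points_L)

text \<open>The value at \<open>p\<close> of the Killing (or fundamental) vector field of \<open>Y\<close>, as the differential at the
  identity of the orbit map of \<open>p\<close>. In this form it is visibly linear in \<open>Y\<close>.\<close>

definition fund :: "'m \<Rightarrow> 'f \<Rightarrow> ('m, 'e) tvec" where
  "fund p Y = (\<lambda>d. if d \<in> charts_at M p then dmap c0 d (\<lambda>g. \<phi> g p) \<one> Y else 0)"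

context
  fixes p assumes p: "p \<in> points M"
begin

lemma charts_at_orbit: "d \<in> charts_at M p \<Longrightarrow> d \<in> charts_at M (\<phi> \<one> p)"
  by (simp add: act_one p)

lemma fund_in_tangent_space: "fund p Y \<in> tangent_space M p"
  unfolding tangent_space_def
proof (intro CollectI conjI ballI allI impI)
  fix c d assume c: "c \<in> charts_at M p" and d: "d \<in> charts_at M p"
  have "dmap c0 d (\<lambda>g. \<phi> g p) \<one> Y = dmap c d (\<lambda>x. x) (\<phi> \<one> p) (dmap c0 c (\<lambda>g. \<phi> g p) \<one> Y)"
    by (rule dmap_compose[OF charted_L charted_M smooth_map_orbit[OF p] smooth_map_id[OF charted_M] c0_at_one
          charts_at_orbit[OF c] charts_at_orbit[OF d]])
  then show "fund p Y d = frechet_derivative (coord d \<circ> coord_inv c) (at (coord c p)) (fund p Y c)"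
    using c d by (simp only: fund_def if_True dmap_ident act_one p)
qed (simp add: fund_def)

lemma linear_dmap_orbit: "d \<in> charts_at M p \<Longrightarrow> linear (dmap c0 d (\<lambda>g. \<phi> g p) \<one>)"
  by (rule linear_dmap[OF smooth_map_orbit[OF p] c0_at_one charts_at_orbit])

lemma fund_add: "fund p (Y + Z) = fund p Y + fund p Z"
  by (rule ext) (simp add: fund_def linear_add[OF linear_dmap_orbit])

lemma fund_scaleR: "fund p (r *\<^sub>R Y) = r *\<^sub>R fund p Y"
  by (rule ext) (simp add: fund_def scaleR_fun_def linear_scale[OF linear_dmap_orbit])

text \<open>Differentiate \<open>g (x p) = (g x g\<^sup>-\<^sup>1) (g p)\<close> in \<open>x\<close> at the identity.\<close>

lemma differential_fund:
  assumes g: "g \<in> carrier G"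
  shows "differential M M (\<phi> g) p (fund p Y) = fund (\<phi> g p) (Ad g Y)"
proof
  fix d
  define c where "c = (SOME c. c \<in> charts_at M p)"
  have c: "c \<in> charts_at M p" unfolding c_def by (rule some_chart_at[OF charted_M p])
  show "differential M M (\<phi> g) p (fund p Y) d = fund (\<phi> g p) (Ad g Y) d"
  proof (cases "d \<in> charts_at M (\<phi> g p)")
    case True
    note gp = act_closed[OF g p]
    have "dmap c0 d (\<lambda>x. \<phi> g (\<phi> x p)) \<one> Y = dmap c d (\<phi> g) (\<phi> \<one> p) (dmap c0 c (\<lambda>x. \<phi> x p) \<one> Y)"
      by (rule dmap_compose[OF charted_L charted_M smooth_map_orbit[OF p] smooth_map_act1[OF g] c0_at_one
            charts_at_orbit[OF c]]) (simp add: act_one p True)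
    moreover have "dmap c0 d (\<lambda>x. \<phi> (g \<otimes> x \<otimes> inv g) (\<phi> g p)) \<one> Y =
        dmap c0 d (\<lambda>x. \<phi> x (\<phi> g p)) (g \<otimes> \<one> \<otimes> inv g) (dmap c0 c0 (\<lambda>x. g \<otimes> x \<otimes> inv g) \<one> Y)"
      by (rule dmap_compose[OF charted_L charted_L smooth_map_conj[OF g] smooth_map_orbit[OF gp] c0_at_one])
        (simp_all add: g act_one gp True c0_at_one)
    moreover have "dmap c0 d (\<lambda>x. \<phi> g (\<phi> x p)) \<one> = dmap c0 d (\<lambda>x. \<phi> (g \<otimes> x \<otimes> inv g) (\<phi> g p)) \<one>"
    proof (rule dmap_cong[OF charted_L c0_at_one])
      fix x assume "x \<in> dom_of c0"
      then have x: "x \<in> carrier G" by (rule dom_c0_carrier)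
      have "\<phi> (g \<otimes> x \<otimes> inv g) (\<phi> g p) = \<phi> (g \<otimes> x \<otimes> inv g \<otimes> g) p"
        using g x p by (simp add: act_mult)
      then show "\<phi> g (\<phi> x p) = \<phi> (g \<otimes> x \<otimes> inv g) (\<phi> g p)"
        using g x p by (simp add: m_assoc act_mult)
    qed
    ultimately show ?thesis
      using True c g by (simp add: differential_def fund_def Ad_def Let_def act_one p flip: c_def)
  next
    case False
    then show ?thesis by (simp add: differential_def fund_def Let_def)
  qed
qed

end

text \<open>The squared length at \<open>p\<close> of the Killing field of \<open>Y\<close>, a positive semidefinite quadratic form in \<open>Y\<close>.\<close>

definition qform :: "'m \<Rightarrow> 'f \<Rightarrow> real" where "qform p Y = h p (fund p Y) (fund p Y)"

lemma metric:
  assumes "p \<in> points M" "u \<in> tangent_space M p" "v \<in> tangent_space M p" "w \<in> tangent_space M p"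
  shows "h p (u + v) w = h p u w + h p v w" "h p (r *\<^sub>R u) w = r * h p u w" "h p u w = h p w u"
    and "u \<noteq> 0 \<Longrightarrow> h p u u > 0"
  using riemannian assms unfolding riemannian_manifold_def riemannian_metric_def by blast+

lemma qform_scaleR:
  assumes p: "p \<in> points M"
  shows "qform p (r *\<^sub>R Y) = r\<^sup>2 * qform p Y"
proof -
  note T = fund_in_tangent_space[OF p]
  have "qform p (r *\<^sub>R Y) = r * h p (fund p Y) (fund p (r *\<^sub>R Y))"
    using metric(2)[OF p T T T, of r Y "r *\<^sub>R Y"] by (simp only: qform_def fund_scaleR[OF p])
  also have "h p (fund p Y) (fund p (r *\<^sub>R Y)) = r * h p (fund p Y) (fund p Y)"
    using metric(3)[OF p T T T, of Y "r *\<^sub>R Y"] metric(2)[OF p T T T, of r Y Y]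
    by (simp only: fund_scaleR[OF p])
  finally show ?thesis by (simp add: qform_def power2_eq_square)
qed

lemma qform_nonneg: "p \<in> points M \<Longrightarrow> qform p Y \<ge> 0"
proof (cases "fund p Y = 0")
  case True
  assume "p \<in> points M"
  then have "h p (0 *\<^sub>R fund p Y) (fund p Y) = 0"
    using metric(2)[of p "fund p Y" "fund p Y" "fund p Y" 0] by (simp only: fund_in_tangent_space mult_zero_left)
  then show ?thesis using True by (simp add: qform_def)
next
  case False
  assume p: "p \<in> points M"
  show ?thesis
    unfolding qform_def
    by (rule less_imp_le[OF metric(4)[OF p fund_in_tangent_space[OF p] fund_in_tangent_space[OF p]
          fund_in_tangent_space[OF p] False]])
qed

lemma qform_eq_0D: "p \<in> points M \<Longrightarrow> qform p Y = 0 \<Longrightarrow> fund p Y = 0"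
  using metric(4)[of p "fund p Y" "fund p Y" "fund p Y"]
  by (force simp: qform_def fund_in_tangent_space)

text \<open>This is \<open>|y + z|\<^sup>2 \<le> |y + z|\<^sup>2 + |y - z|\<^sup>2 = 2 |y|\<^sup>2 + 2 |z|\<^sup>2\<close>, a substitute for the triangle
  inequality that avoids square roots.\<close>

lemma qform_add_le:
  assumes p: "p \<in> points M"
  shows "qform p (Y + Z) \<le> 2 * qform p Y + 2 * qform p Z"
proof -
  note T = fund_in_tangent_space[OF p]
  have eq: "qform p (Y + Z) = qform p Y + 2 * h p (fund p Y) (fund p Z) + qform p Z" for Z
  proof -
    have "qform p (Y + Z) = h p (fund p Y) (fund p (Y + Z)) + h p (fund p Z) (fund p (Y + Z))"
      using metric(1)[OF p T T T, of Y Z "Y + Z"] by (simp only: qform_def fund_add[OF p])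
    also have "h p (fund p Y) (fund p (Y + Z)) = h p (fund p Y) (fund p Y) + h p (fund p Z) (fund p Y)"
      using metric(3)[OF p T T T, of Y "Y + Z"] metric(1)[OF p T T T, of Y Z Y]
      by (simp only: fund_add[OF p])
    also have "h p (fund p Z) (fund p (Y + Z)) = h p (fund p Y) (fund p Z) + h p (fund p Z) (fund p Z)"
      using metric(3)[OF p T T T, of Z "Y + Z"] metric(1)[OF p T T T, of Y Z Z]
      by (simp only: fund_add[OF p])
    also have "h p (fund p Z) (fund p Y) = h p (fund p Y) (fund p Z)"
      by (rule metric(3)[OF p T T T])
    finally show ?thesis by (simp add: qform_def)
  qed
  have "h p (fund p Y) (fund p ((-1) *\<^sub>R Z)) = - h p (fund p Y) (fund p Z)"
    using metric(3)[OF p T T T, of Y "(-1) *\<^sub>R Z"] metric(2)[OF p T T T, of "-1" Z Y]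
      metric(3)[OF p T T T, of Z Y] by (simp only: fund_scaleR[OF p])
  moreover have "0 \<le> qform p (Y + (-1) *\<^sub>R Z)" by (rule qform_nonneg[OF p])
  ultimately have "0 \<le> qform p Y - 2 * h p (fund p Y) (fund p Z) + qform p Z"
    using eq[of "(-1) *\<^sub>R Z"] qform_scaleR[OF p, of "-1" Z] by simp
  then show ?thesis using eq[of Z] by simp
qed

lemma qform_Ad:
  assumes g: "g \<in> carrier G" and p: "p \<in> points M"
  shows "qform (\<phi> g p) (Ad g Y) = qform p Y"
proof -
  have "h (\<phi> g p) (differential M M (\<phi> g) p u) (differential M M (\<phi> g) p v) = h p u v"
    if "u \<in> tangent_space M p" "v \<in> tangent_space M p" for u v
    using isometric_action g p that unfolding isometric_action_def by blast
  from this[OF fund_in_tangent_space[OF p] fund_in_tangent_space[OF p], of Y Y]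
  show ?thesis by (simp add: qform_def differential_fund[OF p g])
qed

text \<open>The elements of the Lie algebra with bounded Killing field.\<close>

definition bdd :: "'f set" where "bdd = {Y. \<exists>C. \<forall>p\<in>points M. qform p Y \<le> C}"

text \<open>A bound that holds at all points of \<open>M\<close> is not affected by moving the point with \<open>g\<close>.\<close>

lemma qform_Ad_le:
  assumes C: "\<And>p. p \<in> points M \<Longrightarrow> qform p Y \<le> C" and g: "g \<in> carrier G" and p: "p \<in> points M"
  shows "qform p (Ad g Y) \<le> C"
proof -
  have "\<phi> g (\<phi> (inv g) p) = p" using act_mult[of g "inv g" p] g p by (simp add: act_one)
  then have "qform p (Ad g Y) = qform (\<phi> (inv g) p) Y"
    using qform_Ad[OF g act_closed[OF inv_closed[OF g] p], of Y] by simp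
  then show ?thesis using C act_closed[OF inv_closed[OF g] p] by simp
qed

lemma Ad_in_bdd: "Y \<in> bdd \<Longrightarrow> g \<in> carrier G \<Longrightarrow> Ad g Y \<in> bdd"
  unfolding bdd_def using qform_Ad_le by blast

lemma subspace_bdd: "subspace bdd"
  unfolding subspace_def
proof (intro conjI ballI allI)
  have "qform p 0 = 0" if "p \<in> points M" for p
    using qform_scaleR[OF that, of 0 0] by simp
  then show "0 \<in> bdd" unfolding bdd_def by (intro CollectI exI[of _ 0]) simp
next
  fix Y Z assume "Y \<in> bdd" "Z \<in> bdd"
  then obtain C D where C: "\<And>p. p \<in> points M \<Longrightarrow> qform p Y \<le> C" and D: "\<And>p. p \<in> points M \<Longrightarrow> qform p Z \<le> D"
    unfolding bdd_def by blast
  have "qform p (Y + Z) \<le> 2 * C + 2 * D" if "p \<in> points M" for p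
    using qform_add_le[OF that, of Y Z] C[OF that] D[OF that] by simp
  then show "Y + Z \<in> bdd" unfolding bdd_def by blast
next
  fix r Y assume "Y \<in> bdd"
  then obtain C where C: "\<And>p. p \<in> points M \<Longrightarrow> qform p Y \<le> C" unfolding bdd_def by blast
  have "qform p (r *\<^sub>R Y) \<le> r\<^sup>2 * C" if "p \<in> points M" for p
    unfolding qform_scaleR[OF that] by (intro mult_left_mono C that) simp
  then show "r *\<^sub>R Y \<in> bdd" unfolding bdd_def by blast
qed

text \<open>The map \<open>g \<mapsto> Ad g X\<close> takes values in the subspace, hence so does its derivative at the identity.\<close>

lemma bracket_in_bdd:
  assumes X: "X \<in> bdd"
  shows "bracket Y X \<in> bdd" "bracket X Y \<in> bdd"
proof -
  show 1: "bracket Y X \<in> bdd"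
    by (rule derivative_in_subspace[OF subspace_bdd has_derivative_Ad[of X] open_img_c0 x0_img])
      (rule Ad_in_bdd[OF X coord_inv_c0_carrier])
  have "bracket X Y = - bracket Y X" by (simp add: bracket_def)
  then show "bracket X Y \<in> bdd" using subspace_neg[OF subspace_bdd 1] by simp
qed

lemma killing_field_eq_fund:
  assumes X: "X \<in> lie_algebra G L" and p: "p \<in> points M"
  shows "killing_field G L M \<phi> X p = fund p (X c0)"
proof
  fix d
  obtain \<gamma> where \<gamma>: "one_parameter_subgroup G L \<gamma>" "velocity L \<gamma> 0 = X"
    by (rule ex_one_parameter_subgroup_velocity[OF X])
  note \<gamma>0 = one_parameter_subgroup_zero[OF \<gamma>(1)]
  have 0: "\<phi> (\<gamma> 0) p = p" by (simp add: \<gamma>0 act_one p)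
  show "killing_field G L M \<phi> X p d = fund p (X c0) d"
  proof (cases "d \<in> charts_at M p")
    case True
    have "((\<lambda>s. coord d (\<phi> (\<gamma> s) p)) has_vector_derivative
        dmap c0 d (\<lambda>x. \<phi> (\<gamma> 0 \<otimes> x) p) \<one> (X c0)) (at 0)"
      by (rule one_parameter_subgroup_derivative[OF \<gamma>(1) velocity_eqD[OF \<gamma>] smooth_map_orbit[OF p]])
        (simp add: 0 True)
    also have "dmap c0 d (\<lambda>x. \<phi> (\<gamma> 0 \<otimes> x) p) \<one> = dmap c0 d (\<lambda>x. \<phi> x p) \<one>"
      by (rule dmap_cong[OF charted_L c0_at_one]) (simp add: \<gamma>0 dom_c0_carrier)
    finally show ?thesis
      using True by (simp add: killing_field_def velocity_def lie_exp_scaleR[OF \<gamma>] 0 fund_def comp_def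
          vector_derivative_at)
  next
    case False
    then show ?thesis by (simp add: killing_field_def velocity_def lie_exp_scaleR[OF \<gamma>] 0 fund_def)
  qed
qed

text \<open>If the Killing field vanishes, the one-parameter subgroup fixes every point, hence is trivial
  because the action is effective.\<close>

lemma fund_eq_0_imp:
  assumes 0: "\<And>p. p \<in> points M \<Longrightarrow> fund p Y = 0"
  shows "Y = 0"
proof -
  obtain \<gamma> where \<gamma>: "one_parameter_subgroup G L \<gamma>" "((coord c0 \<circ> \<gamma>) has_vector_derivative Y) (at 0)"
    using ex_one_parameter_subgroup by blast
  note car = one_parameter_subgroup_carrier[OF \<gamma>(1)]
  have fixed: "\<phi> (\<gamma> t) p = \<phi> (\<gamma> 0) p" if p: "p \<in> points M" for t p
  proof (rule curve_constant[OF charted_M, of "\<lambda>t. \<phi> (\<gamma> t) p"])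
    show "smooth_map real_line M (\<lambda>t. \<phi> (\<gamma> t) p)"
      using \<gamma>(1) by (intro smooth_map_compose[OF charted_real_line charted_L charted_M _ smooth_map_orbit[OF p]])
        (simp add: one_parameter_subgroup_def)
    fix t d assume d: "d \<in> charts_at M (\<phi> (\<gamma> t) p)"
    obtain c where c: "c \<in> charts_at M p" using charted_ex_chart[OF charted_M p] by blast
    have "dmap c0 d (\<lambda>x. \<phi> (\<gamma> t) (\<phi> x p)) \<one> Y =
        dmap c d (\<phi> (\<gamma> t)) (\<phi> \<one> p) (dmap c0 c (\<lambda>x. \<phi> x p) \<one> Y)"
      by (rule dmap_compose[OF charted_L charted_M smooth_map_orbit[OF p] smooth_map_act1[OF car] c0_at_one
            charts_at_orbit[OF p c]]) (simp add: act_one p d)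
    also have "dmap c0 c (\<lambda>x. \<phi> x p) \<one> Y = 0"
      using fun_cong[OF 0[OF p], of c] c by (simp add: fund_def)
    also have "dmap c d (\<phi> (\<gamma> t)) (\<phi> \<one> p) 0 = 0"
      using linear_0[OF linear_dmap[OF smooth_map_act1[OF car] c d]] by (simp add: act_one p)
    also have "dmap c0 d (\<lambda>x. \<phi> (\<gamma> t) (\<phi> x p)) \<one> = dmap c0 d (\<lambda>x. \<phi> (\<gamma> t \<otimes> x) p) \<one>"
      by (rule dmap_cong[OF charted_L c0_at_one]) (simp add: act_mult car dom_c0_carrier p)
    finally have "dmap c0 d (\<lambda>x. \<phi> (\<gamma> t \<otimes> x) p) \<one> Y = 0" .
    then show "((coord d \<circ> (\<lambda>t. \<phi> (\<gamma> t) p)) has_vector_derivative 0) (at t)"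
      using one_parameter_subgroup_derivative[OF \<gamma> smooth_map_orbit[OF p] d] by (simp add: comp_def)
  qed
  have "\<gamma> t = \<one>" for t
  proof (rule inj_onD[OF act.faithful])
    show "\<phi> (\<gamma> t) = \<phi> \<one>"
    proof (rule extensionalityI[of _ "points M"])
      show "\<phi> (\<gamma> t) \<in> extensional (points M)" "\<phi> \<one> \<in> extensional (points M)"
        using act.bij_prop0[of "\<gamma> t"] act.bij_prop0[of \<one>] car by (auto simp: Bij_def)
      show "\<phi> (\<gamma> t) p = \<phi> \<one> p" if "p \<in> points M" for p
        using fixed[OF that, of t] by (simp add: one_parameter_subgroup_zero[OF \<gamma>(1)])
    qed
  qed (simp_all add: car)
  then have "coord c0 \<circ> \<gamma> = (\<lambda>t. coord c0 \<one>)" by (simp add: fun_eq_iff)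
  from vector_derivative_unique_at[OF \<gamma>(2)[unfolded this] has_vector_derivative_const] show "Y = 0" .
qed

section \<open>Eigenvalues\<close>

lemma has_vector_derivative_Ad:
  assumes \<gamma>: "one_parameter_subgroup G L \<gamma>" "((coord c0 \<circ> \<gamma>) has_vector_derivative X) (at 0)"
  shows "((\<lambda>t. Ad (\<gamma> t) Y) has_vector_derivative Ad (\<gamma> t) (bracket X Y)) (at t)"
proof -
  note car = one_parameter_subgroup_carrier[OF \<gamma>(1)]
  note \<gamma>0 = one_parameter_subgroup_zero[OF \<gamma>(1)]
  note bl = linear_imp_bounded_linear[OF linear_Ad[OF car[of t]]]
  have D: "((\<lambda>x. Ad (coord_inv c0 x) Y) has_derivative (\<lambda>X. bracket X Y)) (at ((coord c0 \<circ> \<gamma>) 0))"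
    using has_derivative_Ad[of Y] by (simp add: \<gamma>0 x0_def)
  have "((\<lambda>s. Ad (coord_inv c0 ((coord c0 \<circ> \<gamma>) s)) Y) has_derivative (\<lambda>s. bracket (s *\<^sub>R X) Y)) (at 0)"
    by (rule has_derivative_compose[OF \<gamma>(2)[unfolded has_vector_derivative_def] D])
  then have 1: "((\<lambda>s. Ad (coord_inv c0 ((coord c0 \<circ> \<gamma>) s)) Y) has_vector_derivative bracket X Y) (at 0)"
    by (simp add: has_vector_derivative_def linear_scale[OF has_derivative_linear[OF has_derivative_Ad]])
  have "eventually (\<lambda>s. \<gamma> s \<in> dom_of c0) (nhds 0)"
    by (rule one_parameter_subgroup_eventually[OF \<gamma>(1) openin_dom_of[OF charted_L c0_atlas]])
      (simp add: \<gamma>0 one_in_c0)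
  then obtain U where U: "open U" "0 \<in> U" "\<And>s. s \<in> U \<Longrightarrow> \<gamma> s \<in> dom_of c0"
    unfolding eventually_nhds by blast
  have "((\<lambda>s. Ad (\<gamma> s) Y) has_vector_derivative bracket X Y) (at 0)"
    unfolding has_vector_derivative_def
    by (rule has_derivative_transform_within_open[OF 1[unfolded has_vector_derivative_def] U(1,2)])
      (use U(3) in \<open>simp add: coord_inv_coord[OF charted_L c0_atlas]\<close>)
  from bounded_linear.has_vector_derivative[OF bl this]
  have 2: "((\<lambda>s. Ad (\<gamma> t) (Ad (\<gamma> s) Y)) has_vector_derivative Ad (\<gamma> t) (bracket X Y)) (at (t - t))"
    by simp
  have "((\<lambda>s. s - t) has_vector_derivative 1) (at t)" by (auto intro!: derivative_eq_intros)
  from vector_diff_chain_at[OF this 2]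
  have "((\<lambda>s. Ad (\<gamma> t) (Ad (\<gamma> (s - t)) Y)) has_vector_derivative Ad (\<gamma> t) (bracket X Y)) (at t)"
    by (simp add: comp_def)
  moreover have "Ad (\<gamma> t) (Ad (\<gamma> (s - t)) Y) = Ad (\<gamma> s) Y" for s
    using Ad_mult[OF car[of t] car[of "s - t"], of Y] one_parameter_subgroup_add[OF \<gamma>(1), of t "s - t"]
    by simp
  ultimately show ?thesis by simp
qed

end

text \<open>The equations say \<open>w' = (a + \<i> b) w\<close> for \<open>w = f + \<i> g\<close>; the conclusion is the real part of
  \<open>exp (- \<i> b t) w t = exp (a t) w 0\<close>.\<close>

lemma rotating_solution:
  fixes f g :: "real \<Rightarrow> 'a::real_normed_vector"
  assumes f: "\<And>t. (f has_vector_derivative a *\<^sub>R f t - b *\<^sub>R g t) (at t)"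
    and g: "\<And>t. (g has_vector_derivative b *\<^sub>R f t + a *\<^sub>R g t) (at t)"
  shows "cos (b * t) *\<^sub>R f t + sin (b * t) *\<^sub>R g t = exp (a * t) *\<^sub>R f 0"
proof -
  define E where "E t = exp (- a * t) *\<^sub>R (cos (b * t) *\<^sub>R f t + sin (b * t) *\<^sub>R g t)" for t
  have "(E has_vector_derivative 0) (at t)" for t
  proof -
    have 1: "((\<lambda>t. cos (b * t)) has_real_derivative - b * sin (b * t)) (at t)"
      "((\<lambda>t. sin (b * t)) has_real_derivative b * cos (b * t)) (at t)"
      "((\<lambda>t. exp (- a * t)) has_real_derivative - a * exp (- a * t)) (at t)"
      by (auto intro!: derivative_eq_intros)
    have "(E has_vector_derivative
        exp (- a * t) *\<^sub>R ((cos (b * t) *\<^sub>R (a *\<^sub>R f t - b *\<^sub>R g t) + (- b * sin (b * t)) *\<^sub>R f t) +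
            (sin (b * t) *\<^sub>R (b *\<^sub>R f t + a *\<^sub>R g t) + (b * cos (b * t)) *\<^sub>R g t)) +
        (- a * exp (- a * t)) *\<^sub>R (cos (b * t) *\<^sub>R f t + sin (b * t) *\<^sub>R g t)) (at t)"
      unfolding E_def by (intro has_vector_derivative_scaleR has_vector_derivative_add 1 f g)
    also have "exp (- a * t) *\<^sub>R ((cos (b * t) *\<^sub>R (a *\<^sub>R f t - b *\<^sub>R g t) + (- b * sin (b * t)) *\<^sub>R f t) +
            (sin (b * t) *\<^sub>R (b *\<^sub>R f t + a *\<^sub>R g t) + (b * cos (b * t)) *\<^sub>R g t)) +
        (- a * exp (- a * t)) *\<^sub>R (cos (b * t) *\<^sub>R f t + sin (b * t) *\<^sub>R g t) = 0"
      by (simp add: algebra_simps)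
    finally show ?thesis .
  qed
  then have "norm (E t - E 0) \<le> 0 * \<bar>t - 0\<bar>"
    by (intro vector_derivative_bound[where I = UNIV and f' = "\<lambda>_. 0"]) auto
  then have "E t = E 0" by simp
  then have "exp (a * t) *\<^sub>R E t = exp (a * t) *\<^sub>R f 0" by (simp add: E_def)
  moreover have "exp (a * t) * exp (- a * t) = 1" by (simp flip: exp_add)
  ultimately show ?thesis by (simp add: E_def)
qed

lemma exp_bounded_imp_zero:
  fixes a q C :: real
  assumes a: "a \<noteq> 0" and q: "q \<ge> 0" and le: "\<And>t. (exp (a * t))\<^sup>2 * q \<le> C"
  shows "q = 0"
proof (rule ccontr)
  assume "q \<noteq> 0"
  then have q: "q > 0" using q by simp
  \<comment> \<open>so that \<open>(exp (a s))\<^sup>2 = exp (C / q) \<ge> 1 + C / q\<close>, which is too large for the bound\<close>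
  define s where "s = C / q / (2 * a)"
  have "a * s + a * s = C / q" using a by (simp add: s_def)
  then have "(exp (a * s))\<^sup>2 = exp (C / q)" by (simp add: power2_eq_square flip: exp_add)
  moreover have "(1 + C / q) * q \<le> exp (C / q) * q" using q by (intro mult_right_mono) auto
  ultimately have "(1 + C / q) * q \<le> C" using le[of s] by simp
  moreover have "(1 + C / q) * q = q + C" using q by (simp add: distrib_right)
  ultimately show False using q by simp
qed

context isometric_action_context
begin

text \<open>Being values of \<open>ad X\<close>, \<open>a u - b v\<close> and \<open>b u + a v\<close> have bounded Killing fields, hence so do \<open>u\<close>
  and \<open>v\<close>. The bounds persist for their images under \<open>Ad (exp t X)\<close>, of which \<open>exp (a t) u\<close> is a
  combination with coefficients \<open>cos (b t)\<close> and \<open>sin (b t)\<close>. But \<open>exp (a t)\<close> is unbounded.\<close>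

lemma qform_eigenvector_eq_0:
  assumes X: "X \<in> bdd" and u: "bracket X u = a *\<^sub>R u - b *\<^sub>R v" and v: "bracket X v = b *\<^sub>R u + a *\<^sub>R v"
    and a: "a \<noteq> 0" and p: "p \<in> points M"
  shows "qform p u = 0"
proof -
  note S = subspace_bdd
  have uv: "a *\<^sub>R u - b *\<^sub>R v \<in> bdd" "b *\<^sub>R u + a *\<^sub>R v \<in> bdd"
    using bracket_in_bdd(2)[OF X, of u] bracket_in_bdd(2)[OF X, of v] u v by simp_all
  have n: "a\<^sup>2 + b\<^sup>2 \<noteq> 0" using a by (simp add: sum_power2_eq_zero_iff)
  have "a *\<^sub>R (a *\<^sub>R u - b *\<^sub>R v) + b *\<^sub>R (b *\<^sub>R u + a *\<^sub>R v) = (a\<^sup>2 + b\<^sup>2) *\<^sub>R u"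
    "a *\<^sub>R (b *\<^sub>R u + a *\<^sub>R v) - b *\<^sub>R (a *\<^sub>R u - b *\<^sub>R v) = (a\<^sup>2 + b\<^sup>2) *\<^sub>R v"
    by (simp_all add: algebra_simps power2_eq_square)
  then have "(a\<^sup>2 + b\<^sup>2) *\<^sub>R u \<in> bdd" "(a\<^sup>2 + b\<^sup>2) *\<^sub>R v \<in> bdd"
    using subspace_add[OF S subspace_scale[OF S uv(1), of a] subspace_scale[OF S uv(2), of b]]
      subspace_diff[OF S subspace_scale[OF S uv(2), of a] subspace_scale[OF S uv(1), of b]] by simp_all
  from this[THEN subspace_scale[OF S, of _ "inverse (a\<^sup>2 + b\<^sup>2)"]]
  have "u \<in> bdd" "v \<in> bdd" using n by simp_all
  then obtain C D where C: "\<And>p. p \<in> points M \<Longrightarrow> qform p u \<le> C" and D: "\<And>p. p \<in> points M \<Longrightarrow> qform p v \<le> D"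
    unfolding bdd_def by blast
  obtain \<gamma> where \<gamma>: "one_parameter_subgroup G L \<gamma>" "((coord c0 \<circ> \<gamma>) has_vector_derivative X) (at 0)"
    using ex_one_parameter_subgroup by blast
  note car = one_parameter_subgroup_carrier[OF \<gamma>(1)]
  let ?f = "\<lambda>t. Ad (\<gamma> t) u" and ?g = "\<lambda>t. Ad (\<gamma> t) v"
  have f: "(?f has_vector_derivative a *\<^sub>R ?f t - b *\<^sub>R ?g t) (at t)" for t
    using has_vector_derivative_Ad[OF \<gamma>, of u t] linear_Ad[OF car[of t]]
    by (simp add: u linear_diff linear_scale)
  have g: "(?g has_vector_derivative b *\<^sub>R ?f t + a *\<^sub>R ?g t) (at t)" for t
    using has_vector_derivative_Ad[OF \<gamma>, of v t] linear_Ad[OF car[of t]]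
    by (simp add: v linear_add linear_scale)
  have "(exp (a * t))\<^sup>2 * qform p u \<le> 2 * C + 2 * D" for t
  proof -
    have "(exp (a * t))\<^sup>2 * qform p u = qform p (exp (a * t) *\<^sub>R ?f 0)"
      by (simp add: qform_scaleR[OF p] one_parameter_subgroup_zero[OF \<gamma>(1)] Ad_one)
    also have "\<dots> = qform p (cos (b * t) *\<^sub>R ?f t + sin (b * t) *\<^sub>R ?g t)"
      using rotating_solution[OF f g, of t] by simp
    also have "\<dots> \<le> 2 * ((cos (b * t))\<^sup>2 * qform p (?f t)) + 2 * ((sin (b * t))\<^sup>2 * qform p (?g t))"
      using qform_add_le[OF p] by (simp only: qform_scaleR[OF p, symmetric])
    also have "\<dots> \<le> 2 * (1 * C) + 2 * (1 * D)"
      by (intro add_mono mult_left_mono mult_mono qform_Ad_le[OF C car p] qform_Ad_le[OF D car p])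
        (simp_all add: abs_square_le_1 qform_nonneg[OF p])
    finally show ?thesis by simp
  qed
  then show ?thesis by (rule exp_bounded_imp_zero[OF a qform_nonneg[OF p]])
qed

lemma bounded_imp_eigenvalue_imaginary:
  assumes X: "X \<in> lie_algebra G L" and bounded: "bounded_vf M h (killing_field G L M \<phi> X)"
    and z: "complex_eigenvalue (lie_algebra G L) (ad G L X) z"
  shows "Re z = 0"
proof (rule ccontr)
  assume a: "Re z \<noteq> 0"
  have bdd: "X c0 \<in> bdd"
  proof -
    obtain B where B: "\<And>p. p \<in> points M \<Longrightarrow> \<bar>sqrt (qform p (X c0))\<bar> \<le> B"
      using bounded killing_field_eq_fund[OF X]
      by (auto simp: bounded_vf_def bounded_iff tvec_length_def qform_def)
    have "qform p (X c0) \<le> B\<^sup>2" if p: "p \<in> points M" for p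
      using power_mono[OF B[OF p], of 2] qform_nonneg[OF p] by simp
    then show ?thesis unfolding bdd_def by blast
  qed
  from z obtain u v where uv: "u \<in> lie_algebra G L" "v \<in> lie_algebra G L" "(u, v) \<noteq> 0"
    and "ad G L X u = Re z *\<^sub>R u - Im z *\<^sub>R v" "ad G L X v = Im z *\<^sub>R u + Re z *\<^sub>R v"
    by (auto simp: complex_eigenvalue_def complex_scale_def)
  from this(4,5)[THEN fun_cong, of c0]
  have u: "bracket (X c0) (u c0) = Re z *\<^sub>R u c0 - Im z *\<^sub>R v c0"
    and v: "bracket (X c0) (v c0) = Im z *\<^sub>R u c0 + Re z *\<^sub>R v c0"
    by (simp_all add: ad_eq_bracket scaleR_fun_def)
  \<comment> \<open>with \<open>u + \<i> v\<close>, also \<open>- \<i> (u + \<i> v) = v - \<i> u\<close> is an eigenvector\<close>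
  have "bracket (X c0) (- u c0) = - bracket (X c0) (u c0)"
  proof -
    have "((\<lambda>x. - Ad (coord_inv c0 x) (u c0)) has_derivative (\<lambda>X. - bracket X (u c0))) (at x0)"
      by (intro has_derivative_minus has_derivative_Ad)
    then have "((\<lambda>x. Ad (coord_inv c0 x) (- u c0)) has_derivative (\<lambda>X. - bracket X (u c0))) (at x0)"
      by (rule has_derivative_transform_within_open[OF _ open_img_c0 x0_img])
        (simp add: linear_neg[OF linear_Ad[OF coord_inv_c0_carrier]])
    from fun_cong[OF has_derivative_unique[OF has_derivative_Ad this]] show ?thesis .
  qed
  then have v': "bracket (X c0) (v c0) = Re z *\<^sub>R v c0 - Im z *\<^sub>R (- u c0)"
    and u': "bracket (X c0) (- u c0) = Im z *\<^sub>R v c0 + Re z *\<^sub>R (- u c0)"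
    using u v by simp_all
  have "u c0 = 0"
    by (rule fund_eq_0_imp[OF qform_eq_0D[OF _ qform_eigenvector_eq_0[OF bdd u v a]]])
  moreover have "v c0 = 0"
    by (rule fund_eq_0_imp[OF qform_eq_0D[OF _ qform_eigenvector_eq_0[OF bdd v' u' a]]])
  moreover have "w = 0" if w: "w \<in> lie_algebra G L" "w c0 = 0" for w
  proof
    fix d
    show "w d = 0 d"
    proof (cases "d \<in> charts_at L \<one>")
      case True
      then have "w d = dmap c0 d (\<lambda>x. x) \<one> (w c0)"
        using w(1) c0_at_one unfolding lie_algebra_def tangent_space_def dmap_ident by blast
      then show ?thesis
        using w(2) linear_0[OF linear_dmap[OF smooth_map_id[OF charted_L] c0_at_one True]] by simp
    next
      case False
      then have "w d = 0" using w(1) unfolding lie_algebra_def tangent_space_def by blast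
      then show ?thesis by simp
    qed
  qed
  ultimately have "u = 0" "v = 0" using uv by blast+
  then show False using uv(3) by (simp add: zero_prod_def)
qed

end

theorem corollary1p4:
  fixes M :: "('m, 'e::findim_inner) manifold"
    and h :: "'m \<Rightarrow> ('m, 'e) tvec \<Rightarrow> ('m, 'e) tvec \<Rightarrow> real"
    and G :: "('g, 'z) monoid_scheme"
    and L :: "('g, 'f::findim_inner) manifold"
    and \<phi> :: "'g \<Rightarrow> 'm \<Rightarrow> 'm"
    and X :: "('g, 'f) tvec"
  assumes "riemannian_manifold M h" and "connected_space (mtop M)"
    and "lie_group G L" and "connected_space (mtop L)"
    and "smooth_action G L M \<phi>"
    and "faithful_action G (points M) \<phi>"
    and "isometric_action G M h \<phi>"
    and "X \<in> lie_algebra G L"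
    and "bounded_vf M h (killing_field G L M \<phi> X)"
  shows "\<forall>z. complex_eigenvalue (lie_algebra G L) (ad G L X) z \<longrightarrow>
           (\<exists>r::real. z = complex_of_real r * \<i>)"
proof -
  interpret isometric_action_context G L M h \<phi>
    by (intro isometric_action_context.intro lie_group_context.intro
        isometric_action_context_axioms.intro assms)
  show ?thesis
  proof (intro allI impI)
    fix z assume "complex_eigenvalue (lie_algebra G L) (ad G L X) z"
    then have "Re z = 0" by (rule bounded_imp_eigenvalue_imaginary[OF assms(8,9)])
    then have "z = complex_of_real (Im z) * \<i>" by (simp add: complex_eq_iff)
    then show "\<exists>r::real. z = complex_of_real r * \<i>" ..
  qed
qed

end
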